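(* Let $V$ be a vertex algebra. (a) If a sequence of $V$-modules and $V$-homomorphisms $0\to N'\xrightarrow{\varphi}N\xrightarrow{\psi}N''$ is exact, then for any $V$-module $M$ the sequence $0\to\mathrm{Vhom}(M,N')\xrightarrow{\varphi_*}\mathrm{Vhom}(M,N)\xrightarrow{\psi_*}\mathrm{Vhom}(M,N'')$ is an exact sequence of $V$-modules. (b) If a sequence of $V$-modules and $V$-homomorphisms $M'\xrightarrow{\varphi}M\xrightarrow{\psi}M''\to0$ is exact, then for any $V$-module $N$ the sequence $0\to\mathrm{Vhom}(M'',N)\xrightarrow{\psi^*}\mathrm{Vhom}(M,N)\xrightarrow{\varphi^*}\mathrm{Vhom}(M',N)$ is an exact sequence of $V$-modules.
   Context: All vector spaces are over an algebraically closed field $\mathbf k$ of characteristic $0$. For $n\in\mathbb Z$, $(x+y)^n:=\sum_{k\ge 0}\binom nk x^{n-k}y^k$, i.e. binomials are expanded in nonnegative powers of the second-listed variable; a series evaluated at $z+y$, $y+z$, etc. is expanded by this rule. Vertex algebra: a vector space $V$ with a linear map $V\otimes V\to V((z))$, $a\otimes b\mapsto a_{\dot z}b=\sum_{n}(a_nb)z^{-n-1}$, a vector $\mathbf 1\in V$ and $d\in\mathrm{End}(V)$ such that for $a,b,c\in V$: $\mathbf 1_{\dot z}a=a$, $a_{\dot z}\mathbf 1=e^{zd}a$; $(da)_{\dot z}b=\frac{d}{dz}(a_{\dot z}b)$, $d(a_{\dot z}b)=(da)_{\dot z}b+a_{\dot z}(db)$; $a_{\dot z}b=e^{zd}(b_{\dot{-z}}a)$;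 and there is $l\in\mathbb N$ with $(z+w)^l(a_{\dot z}b)_{\dot w}c=(z+w)^l a_{\dot{z+w}}(b_{\dot w}c)$. $V$-module: a vector space $M$ with $d\in\mathrm{End}(M)$ and a linear map $V\otimes M\to M((z))$, $a\otimes u\mapsto a_{\dot z}u$, such that $\mathbf 1_{\dot z}u=u$; $(da)_{\dot z}u=\frac{d}{dz}(a_{\dot z}u)$, $d(a_{\dot z}u)=(da)_{\dot z}u+a_{\dot z}(du)$; and for all $a,b\in V$, $u\in M$ there is $l\in\mathbb N$ with $(z+x)^l(a_{\dot z}b)_{\dot x}u=(z+x)^la_{\dot{z+x}}(b_{\dot x}u)$. A $V$-homomorphism is a linear map $\varphi$ with $\varphi(a_{\dot z}u)=a_{\dot z}\varphi(u)$ and $\varphi(du)=d\varphi(u)$. $\mathrm{Vhom}(M,N)$ is the space of vertex homomorphisms from $M$ to $N$: linear maps $f_z:M\to N((z))$ with $f_z(du)=(d-\frac{d}{dz})f_z(u)$ for all $u\in M$, and such that for every $a\in V$ there is $k\in\mathbb N$ with $(z-x)^ka_{\dot z}(f_x(u))=(z-x)^kf_x(a_{\dot z}u)$ for all $u\in M$. It is a $V$-module with $(df)_z=\frac{d}{dz}f_z$ and $(a_{\dot z}f)_y(u)=a_{\dot{z+y}}(f_y(u))-f_y(a_{\dot{z+y}}u-a_{\dot{y+z}}u)$. For a $V$-homomorphism $f:A\to B$ and a $V$-module $C$: $f_*:\mathrm{Vhom}(C,A)\to\mathrm{Vhom}(C,B)$, $[f_*(\psi)]_z(c)=f(\psi_z(c))$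 ($f$ applied coefficientwise), and $f^*:\mathrm{Vhom}(B,C)\to\mathrm{Vhom}(A,C)$, $[f^*(\phi)]_z(a)=\phi_z(f(a))$. *)

theory Defs
  imports
    Complex_Main
    "HOL-Library.Function_Algebras"
    "HOL-Library.Groups_Big_Fun"
    "HOL-Computational_Algebra.Polynomial"
begin

section \<open>Formal series\<close>

text \<open>
  A formal series in one variable is its coefficient function: for g :: int => 'm,
  g n is the coefficient of z^n. A series in two variables is F :: int => int => 'm, with F i j the
  coefficient of z^i x^j. Summations over all integers use Sum_any (the sum over the support, for
  finite support); every support that occurs below for elements of the carriers is finite.
\<close>

definition laurent :: "'m::zero set \<Rightarrow> (int \<Rightarrow> 'm) \<Rightarrow> bool" where
  "laurent S g \<longleftrightarrow> (\<forall>n. g n \<in> S) \<and> (\<exists>N. \<forall>n<N. g n = 0)"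

definition deriv_series :: "('k::field \<Rightarrow> 'm \<Rightarrow> 'm) \<Rightarrow> (int \<Rightarrow> 'm) \<Rightarrow> int \<Rightarrow> 'm" where
  "deriv_series s g = (\<lambda>n. s (of_int (n + 1)) (g (n + 1)))"

definition scale_series :: "('k \<Rightarrow> 'm \<Rightarrow> 'm) \<Rightarrow> 'k \<Rightarrow> (int \<Rightarrow> 'm) \<Rightarrow> int \<Rightarrow> 'm" where
  "scale_series s c g = (\<lambda>n. s c (g n))"

text \<open>The series g(x + y), expanded in nonnegative powers of y; the result at i, j is the
  coefficient of x^i y^j.\<close>

definition expand_sum :: "('k::field_char_0 \<Rightarrow> 'm::zero \<Rightarrow> 'm) \<Rightarrow> (int \<Rightarrow> 'm) \<Rightarrow> int \<Rightarrow> int \<Rightarrow> 'm" where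
  "expand_sum s g i j =
     (if 0 \<le> j then s (of_int (i + j) gchoose nat j) (g (i + j)) else 0)"

text \<open>Multiplication by z + x and by z - x.\<close>

definition mult_plus :: "(int \<Rightarrow> int \<Rightarrow> 'm::ab_group_add) \<Rightarrow> int \<Rightarrow> int \<Rightarrow> 'm" where
  "mult_plus F = (\<lambda>i j. F (i - 1) j + F i (j - 1))"

definition mult_minus :: "(int \<Rightarrow> int \<Rightarrow> 'm::ab_group_add) \<Rightarrow> int \<Rightarrow> int \<Rightarrow> 'm" where
  "mult_minus F = (\<lambda>i j. F (i - 1) j - F i (j - 1))"

text \<open>For a family of series T(u) depending linearly on u, and a Laurent series h in x, the series
  T(h(x)) evaluated at z + x, i.e. the sum over n of T(h n)(z + x) x^n.\<close>

definition apply_at_sum ::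
  "('k::field_char_0 \<Rightarrow> 'n::ab_group_add \<Rightarrow> 'n) \<Rightarrow> ('m \<Rightarrow> int \<Rightarrow> 'n) \<Rightarrow> (int \<Rightarrow> 'm) \<Rightarrow> int \<Rightarrow> int \<Rightarrow> 'n" where
  "apply_at_sum s T h i j = Sum_any (\<lambda>n. expand_sum s (T (h n)) i (j - n))"

section \<open>Vector spaces and linear maps\<close>

text \<open>Vector spaces are subspaces of an ambient vector space; this makes it possible to treat
  spaces of vertex homomorphisms and arbitrary modules alike.\<close>

definition space_on :: "'m set \<Rightarrow> ('k::field \<Rightarrow> 'm::ab_group_add \<Rightarrow> 'm) \<Rightarrow> bool" where
  "space_on S s \<longleftrightarrow> vector_space s \<and> module.subspace s S"

definition linear_on ::
  "'m::ab_group_add set \<Rightarrow> ('k::field \<Rightarrow> 'm \<Rightarrow> 'm) \<Rightarrow> ('k \<Rightarrow> 'n::ab_group_add \<Rightarrow> 'n) \<Rightarrow> ('m \<Rightarrow> 'n) \<Rightarrow> bool" where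
  "linear_on S s t f \<longleftrightarrow>
     (\<forall>u\<in>S. \<forall>w\<in>S. f (u + w) = f u + f w) \<and> (\<forall>c. \<forall>u\<in>S. f (s c u) = t c (f u))"

section \<open>Vertex algebras and modules\<close>

text \<open>act M a u is the series a_z u; in the usual notation act M a u n is a_(-n-1) u.\<close>

record ('k, 'v, 'm) vmod =
  carrier :: "'m set"
  smult :: "'k \<Rightarrow> 'm \<Rightarrow> 'm"
  D :: "'m \<Rightarrow> 'm"
  act :: "'v \<Rightarrow> 'm \<Rightarrow> int \<Rightarrow> 'm"

record ('k, 'v) valg = "('k, 'v, 'v) vmod" +
  vac :: 'v

definition weak_assoc ::
  "('k::field_char_0, 'v) valg \<Rightarrow> ('k, 'v, 'm::ab_group_add, 'z) vmod_scheme \<Rightarrow> 'v \<Rightarrow> 'v \<Rightarrow> 'm \<Rightarrow> bool" where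
  "weak_assoc V M a b u \<longleftrightarrow>
     (\<exists>l. (mult_plus ^^ l) (\<lambda>i j. act M (act V a b i) u j) =
          (mult_plus ^^ l) (apply_at_sum (smult M) (act M a) (act M b u)))"

definition vmodule ::
  "('k::field_char_0, 'v::ab_group_add) valg \<Rightarrow> ('k, 'v, 'm::ab_group_add, 'z) vmod_scheme \<Rightarrow> bool" where
  "vmodule V M \<longleftrightarrow>
     space_on (carrier M) (smult M) \<and>
     D M ` carrier M \<subseteq> carrier M \<and> linear_on (carrier M) (smult M) (smult M) (D M) \<and>
     (\<forall>a\<in>carrier V. \<forall>u\<in>carrier M. laurent (carrier M) (act M a u)) \<and>
     (\<forall>a\<in>carrier V. linear_on (carrier M) (smult M) (scale_series (smult M)) (act M a)) \<and>
     (\<forall>u\<in>carrier M. linear_on (carrier V) (smult V) (scale_series (smult M)) (\<lambda>a. act M a u)) \<and>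
     (\<forall>u\<in>carrier M. act M (vac V) u = (\<lambda>n. if n = 0 then u else 0)) \<and>
     (\<forall>a\<in>carrier V. \<forall>u\<in>carrier M. act M (D V a) u = deriv_series (smult M) (act M a u)) \<and>
     (\<forall>a\<in>carrier V. \<forall>u\<in>carrier M. \<forall>n.
        D M (act M a u n) = act M (D V a) u n + act M a (D M u) n) \<and>
     (\<forall>a\<in>carrier V. \<forall>b\<in>carrier V. \<forall>u\<in>carrier M. weak_assoc V M a b u)"

text \<open>The series e^(z d) u.\<close>

definition exp_D :: "('k::field_char_0, 'v, 'm::ab_group_add, 'z) vmod_scheme \<Rightarrow> 'm \<Rightarrow> int \<Rightarrow> 'm" where
  "exp_D M u n = (if 0 \<le> n then smult M (1 / fact (nat n)) ((D M ^^ nat n) u) else 0)"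

text \<open>The axioms of a vertex algebra other than vac in V, a_z 1 = e^(z d) a and skew-symmetry are
  literally those of a module, read for the action of V on itself. The last conjunct is
  a_z b = e^(z d) (b_(-z) a).\<close>

definition vertex_algebra :: "('k::field_char_0, 'v::ab_group_add) valg \<Rightarrow> bool" where
  "vertex_algebra V \<longleftrightarrow>
     vac V \<in> carrier V \<and> vmodule V V \<and>
     (\<forall>a\<in>carrier V. act V a (vac V) = exp_D V a) \<and>
     (\<forall>a\<in>carrier V. \<forall>b\<in>carrier V. \<forall>k.
        act V a b k =
          Sum_any (\<lambda>n. exp_D V (smult V ((- 1) powi n) (act V b a n)) (k - n)))"

definition vmodule_hom ::
  "('k::field_char_0, 'v) valg \<Rightarrow> ('k, 'v, 'm::ab_group_add) vmod \<Rightarrow>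
   ('k, 'v, 'n::ab_group_add) vmod \<Rightarrow> ('m \<Rightarrow> 'n) \<Rightarrow> bool" where
  "vmodule_hom V M N \<phi> \<longleftrightarrow>
     \<phi> ` carrier M \<subseteq> carrier N \<and> linear_on (carrier M) (smult M) (smult N) \<phi> \<and>
     (\<forall>a\<in>carrier V. \<forall>u\<in>carrier M. \<forall>n. \<phi> (act M a u n) = act N a (\<phi> u) n) \<and>
     (\<forall>u\<in>carrier M. \<phi> (D M u) = D N (\<phi> u))"

section \<open>Vertex homomorphisms\<close>

text \<open>f u is the series f_z(u). Since f only matters on the carrier of M, it is required to vanish
  outside, so that equality of vertex homomorphisms is equality of functions.\<close>

definition vertex_homs ::
  "('k::field_char_0, 'v) valg \<Rightarrow> ('k, 'v, 'm::ab_group_add) vmod \<Rightarrow>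
   ('k, 'v, 'n::ab_group_add) vmod \<Rightarrow> ('m \<Rightarrow> int \<Rightarrow> 'n) set" where
  "vertex_homs V M N = {f.
     (\<forall>u. u \<notin> carrier M \<longrightarrow> f u = 0) \<and>
     (\<forall>u\<in>carrier M. laurent (carrier N) (f u)) \<and>
     linear_on (carrier M) (smult M) (scale_series (smult N)) f \<and>
     (\<forall>u\<in>carrier M. \<forall>n. f (D M u) n = D N (f u n) - deriv_series (smult N) (f u) n) \<and>
     (\<forall>a\<in>carrier V. \<exists>k. \<forall>u\<in>carrier M.
        (mult_minus ^^ k) (\<lambda>i j. act N a (f u j) i) =
        (mult_minus ^^ k) (\<lambda>i j. f (act M a u i) j))}"

text \<open>
  The action on Vhom(M, N) is (a_z f)_y(u) = a_(z+y)(f_y(u)) - f_y(a_(z+y) u - a_(y+z) u),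
  where i and j below are the exponents of z and y. In the second term the coefficient of z^i y^n
  in the argument of f_y vanishes for all but finitely many n.
\<close>

definition Vhom ::
  "('k::field_char_0, 'v) valg \<Rightarrow> ('k, 'v, 'm::ab_group_add) vmod \<Rightarrow>
   ('k, 'v, 'n::ab_group_add) vmod \<Rightarrow> ('k, 'v, 'm \<Rightarrow> int \<Rightarrow> 'n) vmod" where
  "Vhom V M N = \<lparr>
     carrier = vertex_homs V M N,
     smult = (\<lambda>c f u. scale_series (smult N) c (f u)),
     D = (\<lambda>f u. deriv_series (smult N) (f u)),
     act = (\<lambda>a f i u j.
       if u \<in> carrier M then
         apply_at_sum (smult N) (act N a) (f u) i j -
         Sum_any (\<lambda>n. f (expand_sum (smult M) (act M a u) i n -
                          expand_sum (smult M) (act M a u) n i) (j - n))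
       else 0)\<rparr>"

definition push :: "('n \<Rightarrow> 'p) \<Rightarrow> ('m \<Rightarrow> int \<Rightarrow> 'n) \<Rightarrow> 'm \<Rightarrow> int \<Rightarrow> 'p" where
  "push \<phi> f = (\<lambda>u n. \<phi> (f u n))"

text \<open>Pullback along a homomorphism with domain A; the case distinction restores the convention
  that vertex homomorphisms vanish outside the carrier.\<close>

definition pull ::
  "('k, 'v, 'm) vmod \<Rightarrow> ('m \<Rightarrow> 'n) \<Rightarrow> ('n \<Rightarrow> int \<Rightarrow> 'p::zero) \<Rightarrow> 'm \<Rightarrow> int \<Rightarrow> 'p" where
  "pull A \<phi> f = (\<lambda>u. if u \<in> carrier A then f (\<phi> u) else 0)"

section \<open>Exact sequences\<close>

definition vmodule_seq ::
  "('k::field_char_0, 'v::ab_group_add) valg \<Rightarrow> ('k, 'v, 'a::ab_group_add) vmod \<Rightarrow> ('a \<Rightarrow> 'b) \<Rightarrow>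
   ('k, 'v, 'b::ab_group_add) vmod \<Rightarrow> ('b \<Rightarrow> 'c) \<Rightarrow> ('k, 'v, 'c::ab_group_add) vmod \<Rightarrow> bool" where
  "vmodule_seq V A f B g C \<longleftrightarrow>
     vmodule V A \<and> vmodule V B \<and> vmodule V C \<and> vmodule_hom V A B f \<and> vmodule_hom V B C g"

definition kernel :: "('k, 'v, 'a) vmod \<Rightarrow> ('a \<Rightarrow> 'b::zero) \<Rightarrow> 'a set" where
  "kernel A f = {u \<in> carrier A. f u = 0}"

text \<open>Exactness of 0 -> A -> B -> C and of A -> B -> C -> 0.\<close>

definition left_exact_seq ::
  "('k::field_char_0, 'v::ab_group_add) valg \<Rightarrow> ('k, 'v, 'a::ab_group_add) vmod \<Rightarrow> ('a \<Rightarrow> 'b) \<Rightarrow>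
   ('k, 'v, 'b::ab_group_add) vmod \<Rightarrow> ('b \<Rightarrow> 'c) \<Rightarrow> ('k, 'v, 'c::ab_group_add) vmod \<Rightarrow> bool" where
  "left_exact_seq V A f B g C \<longleftrightarrow>
     vmodule_seq V A f B g C \<and> kernel A f = {0} \<and> f ` carrier A = kernel B g"

definition right_exact_seq ::
  "('k::field_char_0, 'v::ab_group_add) valg \<Rightarrow> ('k, 'v, 'a::ab_group_add) vmod \<Rightarrow> ('a \<Rightarrow> 'b) \<Rightarrow>
   ('k, 'v, 'b::ab_group_add) vmod \<Rightarrow> ('b \<Rightarrow> 'c) \<Rightarrow> ('k, 'v, 'c::ab_group_add) vmod \<Rightarrow> bool" where
  "right_exact_seq V A f B g C \<longleftrightarrow>
     vmodule_seq V A f B g C \<and> f ` carrier A = kernel B g \<and> g ` carrier B = carrier C"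

end

theory Submission
  imports Defs
begin

text \<open>
  Exactness itself is formal: an injection of modules lets one lift vertex homomorphisms with values in
  its image, and a surjection lets one factor those that vanish on its kernel. The substance is that
  Vhom(M, N) is a module. The series a(z + y) f(y) u - f(y) (a(z + y) u - a(y + z) u) is the residue
  product of a(w) f(y) u and f(y) a(w) u, whose coefficient of z^i pairs with (w - y)^(-i - 1) expanded
  in the two regions. It turns multiplication by w - y into multiplication by z. Locality of modules
  follows from weak associativity and skew-symmetry; closedness of Vhom under the action is Dong's
  lemma; and weak associativity holds because, after multiplication by the power of z + x making a(p)
  and f(y) commute, both iterated residue products shift in the same way under multiplication and
  division by p - q, and agree at the residue in z.
\<close>

text \<open>The main obstacle is uniformity in u. In a module the exponent l of weak associativity
  may depend on u, whereas in Vhom(M, N) weak associativity is an identity between functions of u,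
  so one l must serve all u. Uniform exponents come from locality: for a and f by the definition of
  vertex homomorphisms, and for a and b on a module because twice a bound for the pole order of b_z
  a suffices, which involves V only. The product (a_z b)_x f contains the operator orders abf, baf,
  fab, fba, and a_m (b_n f) contains abf, bfa, afb, fba. Two orders agree; the remaining pairs baf,
  bfa and fab, afb differ by an exchange of a and f, and this is what the power of z + x pays for.
  Each order has its own bounds on exponents, and a quotient by p - q exists only in the expansion
  that fits the order. Hence the argument runs on quadruples of triple series with explicit
  boundedness conditions, not on formal operators.\<close>

section \<open>Binomial kernels\<close>

text \<open>bin_fst i m and bin_snd i m are the coefficients of z^i y^(m - i) in the expansions of
  (z + y)^m in nonnegative powers of y and of z, respectively.\<close>

definition bin_fst :: "int \<Rightarrow> int \<Rightarrow> 'k::field_char_0" where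
  "bin_fst i m = (if i \<le> m then of_int m gchoose nat (m - i) else 0)"

definition bin_snd :: "int \<Rightarrow> int \<Rightarrow> 'k::field_char_0" where
  "bin_snd i m = (if 0 \<le> i then of_int m gchoose nat i else 0)"

text \<open>For negative m these are the coefficients of a multiple of a derivative of the formal
  delta function; for the other m they all vanish.\<close>

definition bin_diff :: "int \<Rightarrow> int \<Rightarrow> 'k::field_char_0" where
  "bin_diff i m = bin_fst i m - bin_snd i m"

text \<open>The two laws are (z + y) (z + y)^(m - 1) = (z + y)^m and d/dz (z + y)^m = m (z + y)^(m -
  1), read off at one coefficient. They hold in either expansion and are linear in \<open>K\<close>,
  so one set of calculations serves all three kernels.\<close>

definition binomial_kernel :: "(int \<Rightarrow> int \<Rightarrow> 'k::field_char_0) \<Rightarrow> bool" where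
  "binomial_kernel K \<longleftrightarrow>
     (\<forall>i m. K i m = K (i - 1) (m - 1) + K i (m - 1)) \<and>
     (\<forall>i m. of_int m * K i (m - 1) = of_int (i + 1) * K (i + 1) m)"

lemma kernel_pascal: "binomial_kernel K \<Longrightarrow> K i m = K (i - 1) (m - 1) + K i (m - 1)"
  and kernel_absorb: "binomial_kernel K \<Longrightarrow> of_int m * K i (m - 1) = of_int (i + 1) * K (i + 1) m"
  unfolding binomial_kernel_def by blast+

text \<open>The counterpart for d/dy, since m - i is the exponent of y.\<close>

lemma kernel_absorb': "binomial_kernel K \<Longrightarrow> of_int m * K i (m - 1) = of_int (m - i) * K i m"
  using kernel_pascal[of K i m] kernel_absorb[of K m "i - 1"] by (simp add: algebra_simps)

lemma binomial_kernel_fst: "binomial_kernel (bin_fst :: int \<Rightarrow> int \<Rightarrow> 'k::field_char_0)"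
  unfolding binomial_kernel_def
proof (intro conjI allI)
  fix i m :: int
  show pascal: "(bin_fst i m :: 'k) = bin_fst (i - 1) (m - 1) + bin_fst i (m - 1)"
  proof (cases "i < m")
    case True
    define k where "k = nat (m - 1 - i)"
    have "nat (m - i) = Suc k" "nat (m - 1 - (i - 1)) = Suc k"
      using True by (auto simp: k_def)
    then show ?thesis
      using True gbinomial_Suc_Suc[of "of_int (m - 1) :: 'k" k] by (simp add: bin_fst_def k_def)
  qed (auto simp: bin_fst_def)
  show "of_int m * (bin_fst i (m - 1) :: 'k) = of_int (i + 1) * bin_fst (i + 1) m"
  proof (cases "i < m")
    case True
    define k where "k = nat (m - 1 - i)"
    have "(of_int m - of_nat k :: 'k) = of_int (i + 1)"
      using True by (simp add: k_def)
    then show ?thesis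
      using True gbinomial_absorb_comp[of "of_int m :: 'k" k] by (simp add: bin_fst_def k_def algebra_simps)
  qed (auto simp: bin_fst_def)
qed

lemma binomial_kernel_snd: "binomial_kernel (bin_snd :: int \<Rightarrow> int \<Rightarrow> 'k::field_char_0)"
  unfolding binomial_kernel_def
proof (intro conjI allI)
  fix i m :: int
  show "(bin_snd i m :: 'k) = bin_snd (i - 1) (m - 1) + bin_snd i (m - 1)"
  proof (cases "0 < i")
    case True
    define k where "k = nat (i - 1)"
    have "nat i = Suc k"
      using True by (auto simp: k_def)
    then show ?thesis
      using True gbinomial_Suc_Suc[of "of_int (m - 1) :: 'k" k] by (simp add: bin_snd_def k_def)
  qed (auto simp: bin_snd_def)
  show "of_int m * (bin_snd i (m - 1) :: 'k) = of_int (i + 1) * bin_snd (i + 1) m"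
  proof (cases "0 \<le> i")
    case True
    define k where "k = nat i"
    have "nat (i + 1) = Suc k" "(of_int (i + 1) :: 'k) = of_nat (Suc k)"
      using True by (auto simp: k_def)
    then show ?thesis
      using True gbinomial_absorption[of k "of_int m :: 'k"] by (simp add: bin_snd_def k_def algebra_simps)
  next
    case False
    then show ?thesis
      by (cases "i = -1") (auto simp: bin_snd_def)
  qed
qed

lemma binomial_kernel_diff: "binomial_kernel (bin_diff :: int \<Rightarrow> int \<Rightarrow> 'k::field_char_0)"
  unfolding binomial_kernel_def bin_diff_def
proof (intro conjI allI)
  fix i m :: int
  show "(bin_fst i m - bin_snd i m :: 'k) =
      bin_fst (i - 1) (m - 1) - bin_snd (i - 1) (m - 1) + (bin_fst i (m - 1) - bin_snd i (m - 1))"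
    by (subst kernel_pascal[OF binomial_kernel_fst, of i m],
        subst kernel_pascal[OF binomial_kernel_snd, of i m]) simp
  have "of_int m * (bin_fst i (m - 1) :: 'k) = of_int (i + 1) * bin_fst (i + 1) m"
    "of_int m * (bin_snd i (m - 1) :: 'k) = of_int (i + 1) * bin_snd (i + 1) m"
    by (intro kernel_absorb binomial_kernel_fst binomial_kernel_snd)+
  then show "of_int m * (bin_fst i (m - 1) - bin_snd i (m - 1) :: 'k) =
      of_int (i + 1) * (bin_fst (i + 1) m - bin_snd (i + 1) m)"
    by (simp only: right_diff_distrib)
qed

lemmas binomial_kernels = binomial_kernel_fst binomial_kernel_snd binomial_kernel_diff

lemma gchoose_int_eq_0: "0 \<le> m \<Longrightarrow> nat m < n \<Longrightarrow> (of_int m gchoose n :: 'k::field_char_0) = 0"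
  by (metis binomial_eq_0 binomial_gbinomial int_nat_eq of_int_of_nat_eq of_nat_0)

lemma bin_fst_eq_0: "m < i \<Longrightarrow> bin_fst i m = 0"
  by (simp add: bin_fst_def)

lemma bin_fst_eq_0': "i < 0 \<Longrightarrow> 0 \<le> m \<Longrightarrow> bin_fst i m = (0 :: 'k::field_char_0)"
proof -
  assume a: "i < 0" "0 \<le> m"
  have "(of_int m gchoose nat (m - i) :: 'k) = 0"
    using a by (intro gchoose_int_eq_0) auto
  then show ?thesis
    by (simp add: bin_fst_def)
qed

lemma bin_fst_same [simp]: "bin_fst i i = 1"
  by (simp add: bin_fst_def)

lemma bin_diff_neg: "i < 0 \<Longrightarrow> bin_diff i m = bin_fst i m"
  by (simp add: bin_diff_def bin_snd_def)

text \<open>A nonnegative power of z + y is a polynomial, so its two expansions agree. Consequently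
  only negative powers of w contribute to the second term of \<open>vprod\<close>.\<close>

lemma bin_diff_eq_0: "0 \<le> m \<Longrightarrow> bin_diff i m = (0 :: 'k::field_char_0)"
proof (cases "0 \<le> i")
  case True
  assume m0: "0 \<le> m"
  then have m: "(of_int m :: 'k) = of_nat (nat m)"
    by simp
  show ?thesis
  proof (cases "i \<le> m")
    case le: True
    then have "nat (m - i) = nat m - nat i" "nat i \<le> nat m"
      using True by auto
    then have "(of_int m gchoose nat (m - i) :: 'k) = of_int m gchoose nat i"
      unfolding m using gbinomial_of_nat_symmetric[of "nat i" "nat m", where ?'a = 'k] by simp
    then show ?thesis
      using True le by (simp add: bin_diff_def bin_fst_def bin_snd_def)
  next
    case False
    have "(of_int m gchoose nat i :: 'k) = 0"
      using False True m0 by (intro gchoose_int_eq_0) auto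
    then show ?thesis
      using True False by (simp add: bin_diff_def bin_fst_def bin_snd_def)
  qed
qed (simp add: bin_diff_neg bin_fst_eq_0')

text \<open>Among the powers of z + y only the one with m = -1 has a residue in z. Hence the residue
  of C(z + y, y) in z is the residue of C(w, y) in w.\<close>

lemma bin_fst_minus1: "bin_fst (-1) m = (if m = -1 then 1 else (0 :: 'k::field_char_0))"
  using bin_fst_eq_0'[of "-1" m] bin_fst_eq_0[of m "-1"] by (cases "m < -1"; cases "m = -1") auto

section \<open>Operations on double series\<close>

definition shift1 :: "(int \<Rightarrow> int \<Rightarrow> 'm) \<Rightarrow> int \<Rightarrow> int \<Rightarrow> 'm" where
  "shift1 C = (\<lambda>m j. C (m - 1) j)"

definition shift2 :: "(int \<Rightarrow> int \<Rightarrow> 'm) \<Rightarrow> int \<Rightarrow> int \<Rightarrow> 'm" where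
  "shift2 C = (\<lambda>m j. C m (j - 1))"

definition deriv1 :: "('k::field \<Rightarrow> 'm \<Rightarrow> 'm) \<Rightarrow> (int \<Rightarrow> int \<Rightarrow> 'm) \<Rightarrow> int \<Rightarrow> int \<Rightarrow> 'm" where
  "deriv1 s C = (\<lambda>m j. s (of_int (m + 1)) (C (m + 1) j))"

definition deriv2 :: "('k::field \<Rightarrow> 'm \<Rightarrow> 'm) \<Rightarrow> (int \<Rightarrow> int \<Rightarrow> 'm) \<Rightarrow> int \<Rightarrow> int \<Rightarrow> 'm" where
  "deriv2 s C = (\<lambda>m j. s (of_int (j + 1)) (C m (j + 1)))"

text \<open>For C(w, y), the series subst_sum s bin_fst C is C(z + y, y), its indices being the exponents
  of z and y.\<close>

definition subst_sum ::
  "('k::field_char_0 \<Rightarrow> 'm::ab_group_add \<Rightarrow> 'm) \<Rightarrow> (int \<Rightarrow> int \<Rightarrow> 'k) \<Rightarrow> (int \<Rightarrow> int \<Rightarrow> 'm) \<Rightarrow>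
   int \<Rightarrow> int \<Rightarrow> 'm" where
  "subst_sum s K C i j = Sum_any (\<lambda>m. s (K i m) (C m (i + j - m)))"

text \<open>\<open>Sum_any\<close> returns 0 on an infinite support, so the rules for
  \<open>subst_sum\<close> are available only under such a condition. The second index is d - m
  because the substitution preserves the total degree.\<close>

definition admissible :: "(int \<Rightarrow> int \<Rightarrow> 'k::zero) \<Rightarrow> (int \<Rightarrow> int \<Rightarrow> 'm::zero) \<Rightarrow> bool" where
  "admissible K C \<longleftrightarrow> (\<forall>i d. finite {m. K i m \<noteq> 0 \<and> C m (d - m) \<noteq> 0})"

text \<open>For A = a(w) f(y) u and B = f(y) a(w) u this is the action (a_z f)_y(u) of Vhom.\<close>

definition vprod ::
  "('k::field_char_0 \<Rightarrow> 'm::ab_group_add \<Rightarrow> 'm) \<Rightarrow> (int \<Rightarrow> int \<Rightarrow> 'm) \<Rightarrow> (int \<Rightarrow> int \<Rightarrow> 'm) \<Rightarrow>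
   int \<Rightarrow> int \<Rightarrow> 'm" where
  "vprod s A B i j = subst_sum s bin_fst A i j - subst_sum s bin_diff B i j"

lemma Sum_any_int_shift: "Sum_any g = Sum_any (\<lambda>m. g (m + c))" for g :: "int \<Rightarrow> 'n::comm_monoid_add" and c :: int
  by (rule Sum_any.reindex_cong[of "\<lambda>m. m + c"]) (auto intro!: o_bij[of "\<lambda>m. m - c"])

section \<open>The substitution w = z + y in double series\<close>

locale char0_space = vector_space s for s :: "'k::field_char_0 \<Rightarrow> 'm::ab_group_add \<Rightarrow> 'm"
begin

text \<open>The kernel forces i \<le> m, and the lower bound on the second exponent forces m \<le> d
  - J.\<close>

lemma admissible_fst:
  assumes "\<And>m j. j < J \<Longrightarrow> C m j = 0"
  shows "admissible (bin_fst :: int \<Rightarrow> int \<Rightarrow> 'k) (C :: int \<Rightarrow> int \<Rightarrow> 'n::zero)"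
  unfolding admissible_def
proof (intro allI)
  fix i d :: int
  have "{m. bin_fst i m \<noteq> (0 :: 'k) \<and> C m (d - m) \<noteq> 0} \<subseteq> {i..d - J}"
  proof
    fix m assume "m \<in> {m. bin_fst i m \<noteq> (0 :: 'k) \<and> C m (d - m) \<noteq> 0}"
    then show "m \<in> {i..d - J}"
      using assms[of "d - m" m] by (cases "d - m < J") (auto simp: bin_fst_def split: if_splits)
  qed
  then show "finite {m. bin_fst i m \<noteq> (0 :: 'k) \<and> C m (d - m) \<noteq> 0}"
    by (rule finite_subset) simp
qed

text \<open>The kernel lives on negative m, so a lower bound in the first variable already leaves a
  finite range.\<close>

lemma admissible_diff:
  assumes C: "\<And>m j. m < M \<Longrightarrow> C m j = 0"
  shows "admissible (bin_diff :: int \<Rightarrow> int \<Rightarrow> 'k) (C :: int \<Rightarrow> int \<Rightarrow> 'n::zero)"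
  unfolding admissible_def
proof (intro allI)
  fix i d :: int
  have "{m. bin_diff i m \<noteq> (0 :: 'k) \<and> C m (d - m) \<noteq> 0} \<subseteq> {M..0}"
  proof
    fix m assume "m \<in> {m. bin_diff i m \<noteq> (0 :: 'k) \<and> C m (d - m) \<noteq> 0}"
    then show "m \<in> {M..0}"
      using C[of m] by (cases "m < M"; cases "0 \<le> m") (auto simp: bin_diff_eq_0)
  qed
  then show "finite {m. bin_diff i m \<noteq> (0 :: 'k) \<and> C m (d - m) \<noteq> 0}"
    by (rule finite_subset) simp
qed

lemma admissible_subset:
  assumes "admissible K C" and "\<And>m j. C m j = 0 \<Longrightarrow> C' m j = 0"
  shows "admissible K C'"
  unfolding admissible_def
proof (intro allI)
  fix i d :: int
  have "{m. K i m \<noteq> 0 \<and> C' m (d - m) \<noteq> 0} \<subseteq> {m. K i m \<noteq> 0 \<and> C m (d - m) \<noteq> 0}"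
    using assms(2) by blast
  then show "finite {m. K i m \<noteq> 0 \<and> C' m (d - m) \<noteq> 0}"
    by (rule finite_subset) (use assms(1) in \<open>auto simp: admissible_def\<close>)
qed

lemma admissible_union:
  assumes "admissible K C" "admissible K C'" and "\<And>m j. C m j = 0 \<Longrightarrow> C' m j = 0 \<Longrightarrow> C'' m j = 0"
  shows "admissible K C''"
  unfolding admissible_def
proof (intro allI)
  fix i d :: int
  have "{m. K i m \<noteq> 0 \<and> C'' m (d - m) \<noteq> 0} \<subseteq>
      {m. K i m \<noteq> 0 \<and> C m (d - m) \<noteq> 0} \<union> {m. K i m \<noteq> 0 \<and> C' m (d - m) \<noteq> 0}"
    using assms(3) by blast
  then show "finite {m. K i m \<noteq> 0 \<and> C'' m (d - m) \<noteq> 0}"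
    by (rule finite_subset) (use assms(1,2) in \<open>auto simp: admissible_def\<close>)
qed

lemma admissible_shift2: "admissible K C \<Longrightarrow> admissible K (shift2 C)"
proof -
  have "d - m - 1 = d - 1 - m" for d m :: int
    by simp
  then show "admissible K C \<Longrightarrow> admissible K (shift2 C)"
    unfolding admissible_def shift2_def by presburger
qed

lemma admissible_shift1:
  fixes C :: "int \<Rightarrow> int \<Rightarrow> 'n::zero"
  assumes "binomial_kernel (K :: int \<Rightarrow> int \<Rightarrow> 'k)" "admissible K C"
  shows "admissible K (shift1 C)"
  unfolding admissible_def shift1_def
proof (intro allI)
  fix i d :: int
  \<comment> \<open>By Pascal's rule a nonzero kernel entry has a nonzero neighbour in the previous
    row, so two supports of \<open>C\<close> cover the new one.\<close>
  have "{m. K i m \<noteq> 0 \<and> C (m - 1) (d - m) \<noteq> 0} \<subseteq> (\<lambda>m::int. m + 1) `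
     ({m. K (i - 1) m \<noteq> 0 \<and> C m ((d - 1) - m) \<noteq> 0} \<union> {m. K i m \<noteq> 0 \<and> C m ((d - 1) - m) \<noteq> 0})"
  proof
    fix m assume m: "m \<in> {m. K i m \<noteq> 0 \<and> C (m - 1) (d - m) \<noteq> 0}"
    then have "K (i - 1) (m - 1) \<noteq> 0 \<or> K i (m - 1) \<noteq> 0"
      using kernel_pascal[OF assms(1), of i m] by auto
    then show "m \<in> (\<lambda>m. m + 1) `
     ({m. K (i - 1) m \<noteq> 0 \<and> C m ((d - 1) - m) \<noteq> 0} \<union> {m. K i m \<noteq> 0 \<and> C m ((d - 1) - m) \<noteq> 0})"
      using m by (intro image_eqI[of _ _ "m - 1"]) auto
  qed
  then show "finite {m. K i m \<noteq> 0 \<and> C (m - 1) (d - m) \<noteq> 0}"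
    by (rule finite_subset) (use assms(2) in \<open>auto simp: admissible_def\<close>)
qed

lemma admissible_mult:
  assumes "binomial_kernel (K :: int \<Rightarrow> int \<Rightarrow> 'k)" "admissible K (C :: int \<Rightarrow> int \<Rightarrow> 'm)"
  shows "admissible K (mult_plus C)" "admissible K (mult_minus C)"
  by (rule admissible_union[OF admissible_shift1[OF assms] admissible_shift2[OF assms(2)]];
      simp add: mult_plus_def mult_minus_def shift1_def shift2_def)+

lemma admissible_deriv2:
  assumes "admissible K C"
  shows "admissible K (deriv2 s C)"
  unfolding admissible_def deriv2_def
proof (intro allI)
  fix i d :: int
  have "{m. K i m \<noteq> 0 \<and> s (of_int (d - m + 1)) (C m (d - m + 1)) \<noteq> 0} \<subseteq>
     {m. K i m \<noteq> 0 \<and> C m ((d + 1) - m) \<noteq> 0}"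
    by (auto simp: algebra_simps)
  then show "finite {m. K i m \<noteq> 0 \<and> s (of_int (d - m + 1)) (C m (d - m + 1)) \<noteq> 0}"
    by (rule finite_subset) (use assms in \<open>auto simp: admissible_def\<close>)
qed

lemma admissible_deriv1:
  assumes "binomial_kernel (K :: int \<Rightarrow> int \<Rightarrow> 'k)" "admissible K C"
  shows "admissible K (deriv1 s C)"
  unfolding admissible_def deriv1_def
proof (intro allI)
  fix i d :: int
  have "{m. K i m \<noteq> 0 \<and> s (of_int (m + 1)) (C (m + 1) (d - m)) \<noteq> 0} \<subseteq>
     (\<lambda>m. m - 1) ` {m. K (i + 1) m \<noteq> 0 \<and> C m ((d + 1) - m) \<noteq> 0}"
  proof
    fix m assume m: "m \<in> {m. K i m \<noteq> 0 \<and> s (of_int (m + 1)) (C (m + 1) (d - m)) \<noteq> 0}"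
    then have "(of_int m + 1 :: 'k) \<noteq> 0"
      by (metis (mono_tags, lifting) mem_Collect_eq of_int_1 of_int_add scale_zero_left)
    \<comment> \<open>Absorption reads (m + 1) K i m = (i + 1) K (i + 1) (m + 1), and both factors
      on the left are nonzero.\<close>
    then have "K (i + 1) (m + 1) \<noteq> 0"
      using kernel_absorb[OF assms(1), of "m + 1" i] m by auto
    then show "m \<in> (\<lambda>m. m - 1) ` {m. K (i + 1) m \<noteq> 0 \<and> C m ((d + 1) - m) \<noteq> 0}"
      using m by (intro image_eqI[of _ _ "m + 1"]) auto
  qed
  then show "finite {m. K i m \<noteq> 0 \<and> s (of_int (m + 1)) (C (m + 1) (d - m)) \<noteq> 0}"
    by (rule finite_subset) (use assms(2) in \<open>auto simp: admissible_def\<close>)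
qed

lemma admissibleD: "admissible K C \<Longrightarrow> finite {m. K i m \<noteq> 0 \<and> C m (d - m) \<noteq> 0}"
  by (simp add: admissible_def)

lemma subst_sum_support:
  assumes "admissible K C"
  shows "finite {m. s (K i m) (C m (d - m)) \<noteq> 0}"
  by (rule finite_subset[of _ "{m. K i m \<noteq> 0 \<and> C m (d - m) \<noteq> 0}"])
    (use assms in \<open>auto simp: admissible_def\<close>)

lemma subst_sum_add:
  assumes "admissible K C" "admissible K C'"
  shows "subst_sum s K (\<lambda>m j. C m j + C' m j) i j = subst_sum s K C i j + subst_sum s K C' i j"
  unfolding subst_sum_def
  by (subst Sum_any.distrib[symmetric]) (auto intro!: admissibleD assms simp: scale_right_distrib)

lemma Sum_any_scale:
  assumes "finite {n. g n \<noteq> 0}"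
  shows "s c (Sum_any g) = Sum_any (\<lambda>n. s c (g n))"
proof -
  have "Sum_any (\<lambda>n. s c (g n)) = sum (\<lambda>n. s c (g n)) {n. g n \<noteq> 0}"
    by (rule Sum_any.expand_superset[OF assms]) auto
  then show ?thesis
    by (simp add: Sum_any.expand_set scale_sum_right)
qed

lemma subst_sum_scale:
  assumes "admissible K C"
  shows "subst_sum s K (\<lambda>m j. s c (C m j)) i j = s c (subst_sum s K C i j)"
  unfolding subst_sum_def
  by (subst Sum_any_scale) (auto intro!: admissibleD assms simp: mult.commute)

lemma subst_sum_uminus:
  assumes "admissible K C"
  shows "subst_sum s K (\<lambda>m j. - C m j) i j = - subst_sum s K C i j"
  using subst_sum_scale[OF assms, of "- 1"] by simp

lemma subst_sum_minus:
  assumes "admissible K C" "admissible K C'"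
  shows "subst_sum s K (\<lambda>m j. C m j - C' m j) i j = subst_sum s K C i j - subst_sum s K C' i j"
  using subst_sum_add[OF assms(1) admissible_subset[OF assms(2)], of "\<lambda>m j. - C' m j"]
  by (simp add: subst_sum_uminus[OF assms(2)])

lemma subst_sum_shift2: "subst_sum s K (shift2 C) i j = subst_sum s K C i (j - 1)"
  by (simp add: subst_sum_def shift2_def algebra_simps)

lemma subst_sum_eq_0: "(\<And>m. K i m = 0 \<or> C m (i + j - m) = 0) \<Longrightarrow> subst_sum s K C i j = 0"
proof -
  assume a: "\<And>m. K i m = 0 \<or> C m (i + j - m) = 0"
  have "s (K i m) (C m (i + j - m)) = 0" for m
    using a[of m] by auto
  then show ?thesis
    unfolding subst_sum_def by (simp only: Sum_any.neutral)
qed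

text \<open>Multiplication by w becomes multiplication by z + y; on kernels this is Pascal's
  rule.\<close>

lemma subst_sum_shift1:
  assumes "binomial_kernel K" "admissible K C"
  shows "subst_sum s K (shift1 C) i j = subst_sum s K C (i - 1) j + subst_sum s K C i (j - 1)"
proof -
  have "subst_sum s K (shift1 C) i j = Sum_any (\<lambda>m. s (K i (m + 1)) (C m (i + j - 1 - m)))"
    unfolding subst_sum_def shift1_def by (subst Sum_any_int_shift[of _ 1]) (simp add: algebra_simps)
  also have "\<dots> = Sum_any (\<lambda>m. s (K (i - 1) m) (C m (i + j - 1 - m)) + s (K i m) (C m (i + j - 1 - m)))"
    by (subst kernel_pascal[OF assms(1)]) (simp add: scale_left_distrib)
  also have "\<dots> = subst_sum s K C (i - 1) j + subst_sum s K C i (j - 1)"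
    unfolding subst_sum_def
    by (subst Sum_any.distrib) (auto intro!: admissibleD assms simp: diff_add_eq add_diff_eq)
  finally show ?thesis .
qed

lemma subst_sum_mult_plus:
  assumes "binomial_kernel K" "admissible K C"
  shows "subst_sum s K (shift1 C) = mult_plus (subst_sum s K C)"
  by (intro ext) (simp add: subst_sum_shift1[OF assms] mult_plus_def)

lemma subst_sum_mult_minus:
  assumes "binomial_kernel K" "admissible K C"
  shows "subst_sum s K (mult_minus C) i j = subst_sum s K C (i - 1) j"
proof -
  have "mult_minus C = (\<lambda>m j. shift1 C m j - shift2 C m j)"
    by (simp add: mult_minus_def shift1_def shift2_def)
  then show ?thesis
    by (simp add: subst_sum_minus admissible_shift1 admissible_shift2 assms subst_sum_shift1 subst_sum_shift2)
qed

text \<open>The chain rule in z, which is the absorption law of the kernel.\<close>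

lemma subst_sum_deriv1:
  assumes "binomial_kernel K" "admissible K C"
  shows "subst_sum s K (deriv1 s C) i j = s (of_int (i + 1)) (subst_sum s K C (i + 1) j)"
proof -
  have "s (of_int (i + 1)) (subst_sum s K C (i + 1) j) =
      Sum_any (\<lambda>m. s (of_int (i + 1) * K (i + 1) m) (C m (i + 1 + j - m)))"
    unfolding subst_sum_def by (subst Sum_any_scale) (auto intro!: admissibleD assms)
  also have "\<dots> = Sum_any (\<lambda>m. s (of_int m * K i (m - 1)) (C m (i + 1 + j - m)))"
    using kernel_absorb[OF assms(1)] by simp
  also have "\<dots> = subst_sum s K (deriv1 s C) i j"
    unfolding subst_sum_def deriv1_def
    by (subst Sum_any_int_shift[of _ 1]) (simp add: algebra_simps)
  finally show ?thesis ..
qed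

text \<open>The chain rule in y: this variable occurs in both arguments of C(z + y, y), so its
  derivative is the sum of both partial derivatives.\<close>

lemma subst_sum_deriv2:
  assumes "binomial_kernel K" "admissible K C"
  shows "subst_sum s K (deriv1 s C) i j + subst_sum s K (deriv2 s C) i j =
     s (of_int (j + 1)) (subst_sum s K C i (j + 1))"
proof -
  have fin: "finite {m. s (K i m) (s (of_int (i + j - m + 1)) (C m (i + j - m + 1))) \<noteq> 0}"
    using subst_sum_support[OF admissible_deriv2[OF assms(2)], of i "i + j"] by (simp add: deriv2_def)
  have fin': "finite {m. s (K i (m - 1)) (s (of_int m) (C m (i + j + 1 - m))) \<noteq> 0}"
  proof -
    have "{m. s (K i (m - 1)) (s (of_int m) (C m (i + j + 1 - m))) \<noteq> 0} \<subseteq>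
        (\<lambda>m. m + 1) ` {m. s (K i m) (deriv1 s C m (i + j - m)) \<noteq> 0}"
    proof
      fix m assume "m \<in> {m. s (K i (m - 1)) (s (of_int m) (C m (i + j + 1 - m))) \<noteq> 0}"
      then show "m \<in> (\<lambda>m. m + 1) ` {m. s (K i m) (deriv1 s C m (i + j - m)) \<noteq> 0}"
        by (intro image_eqI[of _ _ "m - 1"]) (auto simp: deriv1_def algebra_simps)
    qed
    then show ?thesis
      by (rule finite_subset) (use subst_sum_support[OF admissible_deriv1[OF assms], of i "i + j"] in simp)
  qed
  have "subst_sum s K (deriv1 s C) i j = Sum_any (\<lambda>m. s (K i (m - 1)) (s (of_int m) (C m (i + j + 1 - m))))"
    unfolding subst_sum_def deriv1_def
    by (subst (2) Sum_any_int_shift[of _ 1]) (simp add: algebra_simps)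
  then have "subst_sum s K (deriv1 s C) i j + subst_sum s K (deriv2 s C) i j =
      Sum_any (\<lambda>m. s (of_int m * K i (m - 1) + of_int (i + j - m + 1) * K i m) (C m (i + (j + 1) - m)))"
    using Sum_any.distrib[OF fin' fin] unfolding subst_sum_def deriv2_def
    by (simp add: scale_left_distrib add.commute add.left_commute mult.commute add_diff_eq diff_add_eq)
  also have "\<dots> = Sum_any (\<lambda>m. s (of_int (j + 1)) (s (K i m) (C m (i + (j + 1) - m))))"
  proof -
    have "of_int m * K i (m - 1) + of_int (i + j - m + 1) * K i m = of_int (j + 1) * K i m" for m
      unfolding kernel_absorb'[OF assms(1)] by (simp add: algebra_simps)
    then show ?thesis
      by simp
  qed
  also have "\<dots> = s (of_int (j + 1)) (subst_sum s K C i (j + 1))"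
    unfolding subst_sum_def by (subst Sum_any_scale) (auto intro!: admissibleD assms)
  finally show ?thesis .
qed

end

text \<open>The series do not mention the field of the kernels, so a type token fixes it.\<close>

abbreviation adm2 ::
  "'k::field_char_0 itself \<Rightarrow> (int \<Rightarrow> int \<Rightarrow> 'n::zero) \<Rightarrow> (int \<Rightarrow> int \<Rightarrow> 'n) \<Rightarrow> bool" where
  "adm2 k A B \<equiv> admissible (bin_fst :: int \<Rightarrow> int \<Rightarrow> 'k) A \<and> admissible (bin_diff :: int \<Rightarrow> int \<Rightarrow> 'k) B"

section \<open>Rules for the residue product\<close>

context char0_space
begin

lemma adm2_mult_minus: "adm2 TYPE('k) A B \<Longrightarrow> adm2 TYPE('k) (mult_minus A) (mult_minus B)" for A B :: "int \<Rightarrow> int \<Rightarrow> 'm"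
  by (simp add: admissible_mult binomial_kernels)

lemma adm2_shift1: "adm2 TYPE('k) A B \<Longrightarrow> adm2 TYPE('k) (shift1 A) (shift1 B)" for A B :: "int \<Rightarrow> int \<Rightarrow> 'm"
  by (simp add: admissible_shift1 binomial_kernels)

lemma adm2_shift2: "adm2 TYPE('k) A B \<Longrightarrow> adm2 TYPE('k) (shift2 A) (shift2 B)" for A B :: "int \<Rightarrow> int \<Rightarrow> 'm"
  by (simp add: admissible_shift2)

lemma adm2_add: "adm2 TYPE('k) A B \<Longrightarrow> adm2 TYPE('k) A' B' \<Longrightarrow> adm2 TYPE('k) (\<lambda>m j. A m j + A' m j) (\<lambda>m j. B m j + B' m j)"
  for A B A' B' :: "int \<Rightarrow> int \<Rightarrow> 'm"
  by (intro conjI; elim conjE; erule (1) admissible_union; simp)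

lemma adm2_minus: "adm2 TYPE('k) A B \<Longrightarrow> adm2 TYPE('k) A' B' \<Longrightarrow> adm2 TYPE('k) (\<lambda>m j. A m j - A' m j) (\<lambda>m j. B m j - B' m j)"
  for A B A' B' :: "int \<Rightarrow> int \<Rightarrow> 'm"
  by (intro conjI; elim conjE; erule (1) admissible_union; simp)

lemma vprod_add:
  "adm2 TYPE('k) A B \<Longrightarrow> adm2 TYPE('k) A' B' \<Longrightarrow>
     vprod s (\<lambda>m j. A m j + A' m j) (\<lambda>m j. B m j + B' m j) i j = vprod s A B i j + vprod s A' B' i j"
  by (simp add: vprod_def subst_sum_add)

lemma vprod_minus:
  "adm2 TYPE('k) A B \<Longrightarrow> adm2 TYPE('k) A' B' \<Longrightarrow>
     vprod s (\<lambda>m j. A m j - A' m j) (\<lambda>m j. B m j - B' m j) i j = vprod s A B i j - vprod s A' B' i j"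
  by (simp add: vprod_def subst_sum_minus)

lemma vprod_scale:
  "adm2 TYPE('k) A B \<Longrightarrow> vprod s (\<lambda>m j. s c (A m j)) (\<lambda>m j. s c (B m j)) i j = s c (vprod s A B i j)"
  by (simp add: vprod_def subst_sum_scale scale_right_diff_distrib)

lemma vprod_shift2: "vprod s (shift2 A) (shift2 B) i j = vprod s A B i (j - 1)"
  by (simp add: vprod_def subst_sum_shift2)

lemma vprod_shift1:
  "adm2 TYPE('k) A B \<Longrightarrow> vprod s (shift1 A) (shift1 B) i j = vprod s A B (i - 1) j + vprod s A B i (j - 1)"
  by (simp add: vprod_def subst_sum_shift1 binomial_kernels)

lemma vprod_mult_minus:
  "adm2 TYPE('k) A B \<Longrightarrow> vprod s (mult_minus A) (mult_minus B) i j = vprod s A B (i - 1) j"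
  by (simp add: vprod_def subst_sum_mult_minus binomial_kernels)

lemma vprod_deriv1:
  "adm2 TYPE('k) A B \<Longrightarrow> vprod s (deriv1 s A) (deriv1 s B) i j = s (of_int (i + 1)) (vprod s A B (i + 1) j)"
  by (simp add: vprod_def subst_sum_deriv1 binomial_kernels scale_right_diff_distrib)

lemma vprod_deriv2:
  assumes "adm2 TYPE('k) A B"
  shows "vprod s (deriv1 s A) (deriv1 s B) i j + vprod s (deriv2 s A) (deriv2 s B) i j =
     s (of_int (j + 1)) (vprod s A B i (j + 1))"
  unfolding vprod_def scale_right_diff_distrib
    subst_sum_deriv2[OF binomial_kernel_fst conjunct1[OF assms], symmetric]
    subst_sum_deriv2[OF binomial_kernel_diff conjunct2[OF assms], symmetric]
  by simp

text \<open>The expansion \<open>bin_snd\<close> has no negative powers of z, so in the polar part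
  both regions carry the same kernel.\<close>

lemma vprod_neg:
  "i < 0 \<Longrightarrow> vprod s A B i j = subst_sum s bin_fst A i j - subst_sum s bin_fst B i j"
  by (simp add: vprod_def subst_sum_def bin_diff_neg)

lemma subst_sum_minus1: "subst_sum s bin_fst C (- 1) j = C (- 1) j"
  unfolding subst_sum_def
  by (subst Sum_any.expand_superset[of "{-1}"]) (auto simp: bin_fst_minus1)

lemma vprod_minus1: "vprod s A B (- 1) j = A (- 1) j - B (- 1) j"
  by (simp add: vprod_neg subst_sum_minus1)

lemma vprod_mult_minus_pow:
  "adm2 TYPE('k) A B \<Longrightarrow> vprod s ((mult_minus ^^ k) A) ((mult_minus ^^ k) B) i j = vprod s A B (i - int k) j"
proof (induction k arbitrary: A B)
  case (Suc k)
  show ?case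
    using Suc.IH[OF adm2_mult_minus[OF Suc.prems]] Suc.prems
    by (simp add: funpow_Suc_right vprod_mult_minus algebra_simps del: funpow.simps)
qed simp

text \<open>Multiplying both series by (w - y)^k moves the coefficient of z^i to that of z^(i + k),
  still a negative exponent, where equal series cancel. This yields the truncation of a_z f in
  z.\<close>

lemma vprod_eq_0:
  assumes "adm2 TYPE('k) A B" "(mult_minus ^^ k) A = (mult_minus ^^ k) B" "i < - int k"
  shows "vprod s A B i j = 0"
  using vprod_mult_minus_pow[OF assms(1), of k "i + int k" j] assms(2,3) by (simp add: vprod_neg)

lemma subst_sum_fst_low:
  assumes "\<And>m j. j < J \<Longrightarrow> A m j = 0" "j < J"
  shows "subst_sum s bin_fst A i j = 0"
proof (rule subst_sum_eq_0)
  fix m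
  show "bin_fst i m = (0 :: 'k) \<or> A m (i + j - m) = 0"
    using assms by (cases "m < i") (auto simp: bin_fst_eq_0)
qed

lemma subst_sum_diff_low:
  assumes "\<And>m j. m < M \<Longrightarrow> B m j = 0" "\<And>m. \<exists>J. \<forall>j<J. B m j = 0"
  shows "\<exists>J. \<forall>j<J. subst_sum s bin_diff B i j = 0"
proof -
  obtain J where J: "\<And>m j. j < J m \<Longrightarrow> B m j = 0"
    using assms(2) by metis
  \<comment> \<open>Only m in {M..0} can contribute, and i + j - m < J m means j < J m + m - i; the
    minimum over this finite range serves all of them.\<close>
  define L where "L = Min ((\<lambda>m. J m + m - i) ` {M..0})"
  have "subst_sum s bin_diff B i j = 0" if "j < L" for j
  proof (rule subst_sum_eq_0)
    fix m
    consider "m < M" | "0 \<le> m" | "m \<in> {M..0}"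
      by fastforce
    then show "bin_diff i m = (0 :: 'k) \<or> B m (i + j - m) = 0"
    proof cases
      case 3
      then have "L \<le> J m + m - i"
        unfolding L_def by (intro Min_le) auto
      then show ?thesis
        using J[of "i + j - m" m] that by auto
    qed (simp_all add: assms(1) bin_diff_eq_0)
  qed
  then show ?thesis
    by blast
qed

lemma vprod_low:
  assumes "\<And>m j. j < J \<Longrightarrow> A m j = 0" "\<And>m j. m < M \<Longrightarrow> B m j = 0" "\<And>m. \<exists>J. \<forall>j<J. B m j = 0"
  shows "\<exists>J. \<forall>j<J. vprod s A B i j = 0"
proof -
  obtain J' where "\<forall>j<J'. subst_sum s bin_diff B i j = 0"
    using subst_sum_diff_low[of M B i, OF assms(2,3)] by blast
  then have "\<forall>j<min J J'. vprod s A B i j = 0"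
    using subst_sum_fst_low[of J A, OF assms(1)] by (simp add: vprod_def)
  then show ?thesis
    by blast
qed

text \<open>If C has no negative powers of its first variable, C(z + y, y) = C(y + z, y).\<close>

lemma subst_sum_diff_nonneg:
  "(\<And>m j. m < 0 \<Longrightarrow> B m j = 0) \<Longrightarrow> subst_sum s bin_diff B i j = 0"
proof (rule subst_sum_eq_0)
  fix m
  assume "\<And>m j. m < 0 \<Longrightarrow> B m j = 0"
  then show "bin_diff i m = (0 :: 'k) \<or> B m (i + j - m) = 0"
    by (cases "m < 0") (auto simp: bin_diff_eq_0)
qed

text \<open>The substitution is unitriangular: at (i, j) it gives C i j plus entries with smaller
  second exponent, which vanish by induction above the bound J. The predicate \<open>Q\<close>
  singles out first exponents that the kernel does not leave; it is used for all exponents and for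
  the negative ones.\<close>

lemma subst_sum_fst_inj:
  assumes Q: "\<And>i m. Q i \<Longrightarrow> bin_fst i m \<noteq> (0 :: 'k) \<Longrightarrow> Q m"
    and low: "\<And>m j. j < J \<Longrightarrow> C m j = 0"
    and zero: "\<And>i j. Q i \<Longrightarrow> subst_sum s bin_fst C i j = 0"
  shows "Q i \<Longrightarrow> C i j = 0"
proof (induction "nat (j - J)" arbitrary: i j rule: less_induct)
  case less
  have "C m (i + j - m) = 0" if "m \<noteq> i" "bin_fst i m \<noteq> (0 :: 'k)" for m
  proof (cases "i + j - m < J")
    case False
    have "i < m"
      using that bin_fst_eq_0[of m i, where 'a = 'k] by (cases "m < i") auto
    then show ?thesis
      using False by (intro less.hyps Q[OF less.prems that(2)]) auto
  qed (simp add: low)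
  then have "subst_sum s bin_fst C i j = s 1 (C i j)"
    unfolding subst_sum_def
    by (subst Sum_any.expand_superset[of "{i}"]) auto
  then show ?case
    using zero[OF less.prems] by simp
qed

end

text \<open>The coefficient at (i, j + 1) expresses F i j through F (i - 1) (j + 1), so agreement
  for small i propagates upwards. Some such bound is essential, because z + x annihilates delta-like
  series.\<close>

lemma mult_plus_inj:
  fixes F G :: "int \<Rightarrow> int \<Rightarrow> 'm::ab_group_add"
  assumes "mult_plus F = mult_plus G" "\<And>i j. i < I \<Longrightarrow> F i j = G i j"
  shows "F = G"
proof -
  have "F i j = G i j" for i j
  proof (induction "nat (i + 1 - I)" arbitrary: i j rule: less_induct)
    case less
    show ?case
    proof (cases "i < I")
      case False
      then have "F (i - 1) (j + 1) = G (i - 1) (j + 1)"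
        by (intro less.hyps) auto
      then show ?thesis
        using fun_cong[OF fun_cong[OF assms(1)], of i "j + 1"] by (simp add: mult_plus_def)
    qed (use assms(2) in auto)
  qed
  then show ?thesis
    by (intro ext)
qed

lemma mult_plus_pow_inj:
  fixes F G :: "int \<Rightarrow> int \<Rightarrow> 'm::ab_group_add"
  assumes "(mult_plus ^^ l) F = (mult_plus ^^ l) G" "\<And>i j. i < I \<Longrightarrow> F i j = G i j"
  shows "F = G"
  using assms
proof (induction l arbitrary: F G)
  case (Suc l)
  have "mult_plus F = mult_plus G"
  proof (rule Suc.IH)
    show "(mult_plus ^^ l) (mult_plus F) = (mult_plus ^^ l) (mult_plus G)"
      using Suc.prems(1) by (simp only: funpow_Suc_right o_apply)
    show "mult_plus F i j = mult_plus G i j" if "i < I" for i j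
      using that by (simp add: mult_plus_def Suc.prems(2))
  qed
  then show ?case
    using Suc.prems(2) by (rule mult_plus_inj)
qed simp

section \<open>Linear maps applied to formal series\<close>

definition lin_map ::
  "'m::ab_group_add set \<Rightarrow> ('k::field_char_0 \<Rightarrow> 'm \<Rightarrow> 'm) \<Rightarrow> 'n::ab_group_add set \<Rightarrow> ('k \<Rightarrow> 'n \<Rightarrow> 'n) \<Rightarrow>
   ('m \<Rightarrow> 'n) \<Rightarrow> bool" where
  "lin_map S s T t g \<longleftrightarrow> space_on S s \<and> space_on T t \<and> g ` S \<subseteq> T \<and> linear_on S s t g"

lemma space_onD:
  assumes "space_on S s"
  shows "0 \<in> S" "u \<in> S \<Longrightarrow> v \<in> S \<Longrightarrow> u + v \<in> S" "u \<in> S \<Longrightarrow> s c u \<in> S"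
    "u \<in> S \<Longrightarrow> v \<in> S \<Longrightarrow> u - v \<in> S" "u \<in> S \<Longrightarrow> - u \<in> S" "vector_space s"
proof -
  interpret vector_space s
    using assms by (simp add: space_on_def)
  have S: "subspace S"
    using assms by (simp add: space_on_def)
  show "0 \<in> S" "u \<in> S \<Longrightarrow> v \<in> S \<Longrightarrow> u + v \<in> S" "u \<in> S \<Longrightarrow> s c u \<in> S"
    "u \<in> S \<Longrightarrow> v \<in> S \<Longrightarrow> u - v \<in> S" "u \<in> S \<Longrightarrow> - u \<in> S"
    using S by (auto intro: subspace_0 subspace_add subspace_scale subspace_diff subspace_neg)
  show "vector_space s" ..
qed

lemma space_on_char0: "space_on S s \<Longrightarrow> char0_space s"
  by (simp add: char0_space_def space_on_def)

lemma space_on_sum: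
  assumes "space_on S s" "\<And>n. n \<in> A \<Longrightarrow> h n \<in> S"
  shows "sum h A \<in> S"
  using assms(2) by (induction A rule: infinite_finite_induct) (simp_all add: space_onD(1,2)[OF assms(1)])

lemma space_on_Sum_any: "space_on S s \<Longrightarrow> (\<And>n. h n \<in> S) \<Longrightarrow> Sum_any h \<in> S"
  by (simp add: Sum_any.expand_set space_on_sum)

lemma space_on_subst_sum: "space_on S s \<Longrightarrow> (\<And>m j. C m j \<in> S) \<Longrightarrow> subst_sum s K C i j \<in> S"
  unfolding subst_sum_def by (rule space_on_Sum_any) (simp_all add: space_onD(3)[of S s])

lemma space_on_vprod:
  "space_on S s \<Longrightarrow> (\<And>m j. A m j \<in> S) \<Longrightarrow> (\<And>m j. B m j \<in> S) \<Longrightarrow> vprod s A B i j \<in> S"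
  unfolding vprod_def by (intro space_onD(4) space_on_subst_sum)

lemma space_on_mult_minus_pow:
  "space_on S s \<Longrightarrow> (\<And>m j. C m j \<in> S) \<Longrightarrow> (mult_minus ^^ k) C m j \<in> S"
  by (induction k arbitrary: m j) (simp_all add: mult_minus_def space_onD(4))

context
  fixes S :: "'m::ab_group_add set" and s :: "'k::field_char_0 \<Rightarrow> 'm \<Rightarrow> 'm"
    and T :: "'n::ab_group_add set" and t :: "'k \<Rightarrow> 'n \<Rightarrow> 'n" and g :: "'m \<Rightarrow> 'n"
  assumes g: "lin_map S s T t g"
begin

lemma lin_map_spaces: "space_on S s" "space_on T t"
  using g by (auto simp: lin_map_def)

lemma lin_map_closed: "u \<in> S \<Longrightarrow> g u \<in> T"
  using g by (auto simp: lin_map_def)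

lemma lin_map_add: "u \<in> S \<Longrightarrow> v \<in> S \<Longrightarrow> g (u + v) = g u + g v"
  using g by (auto simp: lin_map_def linear_on_def)

lemma lin_map_scale: "u \<in> S \<Longrightarrow> g (s c u) = t c (g u)"
  using g by (auto simp: lin_map_def linear_on_def)

lemma lin_map_0: "g 0 = 0"
proof -
  interpret s: vector_space s
    using space_onD(6)[OF lin_map_spaces(1)] .
  interpret t: vector_space t
    using space_onD(6)[OF lin_map_spaces(2)] .
  show ?thesis
    using lin_map_scale[OF space_onD(1)[OF lin_map_spaces(1)], of 0] by simp
qed

lemma lin_map_diff: "u \<in> S \<Longrightarrow> v \<in> S \<Longrightarrow> g (u - v) = g u - g v"
  using lin_map_add[of "u - v" v] space_onD(4)[OF lin_map_spaces(1)] by (simp add: eq_diff_eq)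

lemma lin_map_sum: "(\<And>n. n \<in> A \<Longrightarrow> h n \<in> S) \<Longrightarrow> g (sum h A) = sum (\<lambda>n. g (h n)) A"
  by (induction A rule: infinite_finite_induct)
    (auto simp: lin_map_0 lin_map_add space_on_sum[OF lin_map_spaces(1)])

lemma lin_map_Sum_any:
  assumes "finite {n. h n \<noteq> 0}" "\<And>n. h n \<in> S"
  shows "g (Sum_any h) = Sum_any (\<lambda>n. g (h n))"
proof -
  have "Sum_any (\<lambda>n. g (h n)) = sum (\<lambda>n. g (h n)) {n. h n \<noteq> 0}"
    by (rule Sum_any.expand_superset[OF assms(1)]) (auto simp: lin_map_0)
  then show ?thesis
    by (simp add: Sum_any.expand_set lin_map_sum assms(2))
qed

lemma lin_map_subst_sum:
  assumes "admissible K C" "\<And>m j. C m j \<in> S"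
  shows "g (subst_sum s K C i j) = subst_sum t K (\<lambda>m j. g (C m j)) i j"
proof -
  interpret char0_space s
    using space_on_char0[OF lin_map_spaces(1)] .
  show ?thesis
    unfolding subst_sum_def
    by (subst lin_map_Sum_any)
      (use assms in \<open>auto intro!: admissibleD space_onD(3)[OF lin_map_spaces(1)] simp: lin_map_scale\<close>)
qed

text \<open>Module operators and the components of vertex homomorphisms are moved into residue
  products by this rule, which turns nested products into explicit triple series.\<close>

lemma lin_map_vprod:
  assumes "admissible (bin_fst :: int \<Rightarrow> int \<Rightarrow> 'k) A" "admissible (bin_diff :: int \<Rightarrow> int \<Rightarrow> 'k) B"
    and "\<And>m j. A m j \<in> S" "\<And>m j. B m j \<in> S"
  shows "g (vprod s A B i j) = vprod t (\<lambda>m j. g (A m j)) (\<lambda>m j. g (B m j)) i j"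
  unfolding vprod_def
  by (simp add: lin_map_diff lin_map_subst_sum assms space_on_subst_sum[OF lin_map_spaces(1)])

lemma lin_map_mult_minus_pow:
  assumes "\<And>m j. C m j \<in> S"
  shows "(mult_minus ^^ k) (\<lambda>m j. g (C m j)) = (\<lambda>m j. g ((mult_minus ^^ k) C m j))"
proof (induction k)
  case (Suc k)
  show ?case
    unfolding funpow.simps o_def Suc.IH
    unfolding mult_minus_def
    by (intro ext) (simp only: lin_map_diff space_on_mult_minus_pow[OF lin_map_spaces(1) assms, unfolded mult_minus_def])
qed simp

end

section \<open>Skew-symmetric substitution\<close>

text \<open>For G(t, w), the series skew s G is G(- z, x + z), its indices being the exponents of z
  and x.\<close>

definition skew :: "('k::field_char_0 \<Rightarrow> 'm::ab_group_add \<Rightarrow> 'm) \<Rightarrow> (int \<Rightarrow> int \<Rightarrow> 'm) \<Rightarrow> int \<Rightarrow> int \<Rightarrow> 'm" where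
  "skew s G i j = subst_sum s bin_fst (\<lambda>w t. s ((- 1) powi t) (G t w)) j i"

context char0_space
begin

lemma admissible_skew:
  assumes "\<And>t w. t < T \<Longrightarrow> G t w = 0"
  shows "admissible (bin_fst :: int \<Rightarrow> int \<Rightarrow> 'k) (\<lambda>w t. s ((- 1) powi t) (G t w))"
  by (rule admissible_fst[of T]) (simp add: assms)

lemma skew_shift1:
  assumes "\<And>t w. t < T \<Longrightarrow> G t w = 0"
  shows "skew s (shift1 G) = (\<lambda>i j. - shift1 (skew s G) i j)"
proof (intro ext)
  fix i j
  have "s ((- 1) powi t) (G (t - 1) w) = - s ((- 1) powi (t - 1)) (G (t - 1) w)" for t w
    by (simp add: power_int_diff)
  then have "(\<lambda>w t. s ((- 1) powi t) (shift1 G t w)) = (\<lambda>w t. - shift2 (\<lambda>w t. s ((- 1) powi t) (G t w)) w t)"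
    by (simp add: shift1_def shift2_def)
  then show "skew s (shift1 G) i j = - shift1 (skew s G) i j"
    using admissible_skew[of T G, OF assms]
    by (simp add: skew_def subst_sum_uminus admissible_shift2 subst_sum_shift2 shift1_def)
qed

lemma skew_shift2:
  assumes "\<And>t w. t < T \<Longrightarrow> G t w = 0"
  shows "skew s (shift2 G) = mult_plus (skew s G)"
proof (intro ext)
  fix i j
  have "(\<lambda>w t. s ((- 1) powi t) (shift2 G t w)) = shift1 (\<lambda>w t. s ((- 1) powi t) (G t w))"
    by (simp add: shift1_def shift2_def)
  then show "skew s (shift2 G) i j = mult_plus (skew s G) i j"
    using subst_sum_shift1[OF binomial_kernel_fst admissible_skew[of T G, OF assms]]
    by (simp add: skew_def mult_plus_def)
qed

lemma skew_add:
  assumes "\<And>t w. t < T \<Longrightarrow> G t w = 0" "\<And>t w. t < T \<Longrightarrow> H t w = 0"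
  shows "skew s (\<lambda>t w. G t w + H t w) i j = skew s G i j + skew s H i j"
  using subst_sum_add[OF admissible_skew[of T G, OF assms(1)] admissible_skew[of T H, OF assms(2)]]
  by (simp add: skew_def scale_right_distrib)

text \<open>With t = - z and w = x + z, the factor t + w becomes x.\<close>

lemma skew_mult_plus:
  assumes "\<And>t w. t < T \<Longrightarrow> G t w = 0"
  shows "skew s (mult_plus G) = shift2 (skew s G)"
proof (intro ext)
  fix i j
  have "skew s (mult_plus G) i j = skew s (shift1 G) i j + skew s (shift2 G) i j"
    using skew_add[of T "shift1 G" "shift2 G" i j] assms
    by (simp add: mult_plus_def shift1_def shift2_def)
  also have "\<dots> = shift2 (skew s G) i j"
    using skew_shift1[of T G, OF assms] skew_shift2[of T G, OF assms]
    by (simp add: mult_plus_def shift1_def shift2_def)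
  finally show "skew s (mult_plus G) i j = shift2 (skew s G) i j" .
qed

lemma subst_sum_delta:
  "subst_sum s bin_fst (\<lambda>m j. if m = 0 \<and> j = 0 then c else 0) = (\<lambda>m j. if m = 0 \<and> j = 0 then c else 0)"
proof (intro ext)
  fix i j
  have "subst_sum s bin_fst (\<lambda>m j. if m = 0 \<and> j = 0 then c else 0) i j =
      s (bin_fst i 0) (if i + j = 0 then c else 0)"
    unfolding subst_sum_def by (subst Sum_any.expand_superset[of "{0}"]) auto
  also have "\<dots> = (if i = 0 \<and> j = 0 then c else 0)"
    by (cases "i = 0") (auto simp: bin_fst_def gbinomial_0_left)
  finally show "subst_sum s bin_fst (\<lambda>m j. if m = 0 \<and> j = 0 then c else 0) i j =
    (if i = 0 \<and> j = 0 then c else 0)" .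
qed

lemma skew_delta:
  "skew s (\<lambda>m j. if m = 0 \<and> j = 0 then c else 0) = (\<lambda>m j. if m = 0 \<and> j = 0 then c else 0)"
proof -
  have "s ((- 1) powi t) (if t = 0 \<and> w = 0 then c else 0) = (if w = 0 \<and> t = 0 then c else 0)" for t w :: int
    by auto
  then have "skew s (\<lambda>m j. if m = 0 \<and> j = 0 then c else 0) =
      (\<lambda>i j. subst_sum s bin_fst (\<lambda>w t. if w = 0 \<and> t = 0 then c else 0) j i)"
    unfolding skew_def by simp
  then show ?thesis
    by (simp add: subst_sum_delta fun_eq_iff)
qed

lemma subst_sum_degree_cong:
  assumes "\<And>m l. m + l = i + j \<Longrightarrow> C m l = C' m l"
  shows "subst_sum s K C i j = subst_sum s K C' i j"
  using assms by (simp add: subst_sum_def)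

text \<open>C(z + x, x) arises from C by first replacing x by t + w, where w is the first variable, and
  then t by - z and w by x + z.\<close>

lemma subst_sum_eq_skew:
  assumes "\<And>m j. m < 0 \<or> j < 0 \<Longrightarrow> C m j = 0"
  shows "subst_sum s bin_fst C i j = skew s (subst_sum s bin_fst (\<lambda>j m. C m j)) i j"
proof -
  let ?S = "subst_sum s bin_fst"
  let ?nonneg = "\<lambda>C. \<forall>m j. m < 0 \<or> j < 0 \<longrightarrow> C m j = (0 :: 'm)"
  let ?Q = "\<lambda>C. skew s (?S (\<lambda>j m. C m j))"
  have adm: "admissible (bin_fst :: int \<Rightarrow> int \<Rightarrow> 'k) C" "admissible (bin_fst :: int \<Rightarrow> int \<Rightarrow> 'k) (\<lambda>j m. C m j)"
    if "?nonneg C" for C :: "int \<Rightarrow> int \<Rightarrow> 'm"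
    using that by (auto intro!: admissible_fst[of 0])
  have low: "?S (\<lambda>j m. C m j) t w = 0" if "?nonneg C" "t < 0" for C t w
    using that(2) by (intro subst_sum_eq_0) (metis bin_fst_eq_0' linorder_not_le that(1))
  \<comment> \<open>Both substitutions preserve the total degree, so a coefficient sees only the
    entries of \<open>C\<close> of its own degree. This makes an induction on the degree
    possible.\<close>
  have Q_cong: "?Q C i j = ?Q C' i j" if "\<And>m l. m + l = i + j \<Longrightarrow> C m l = C' m l" for C C' i j
    unfolding skew_def
    by (intro subst_sum_degree_cong arg_cong[where f = "s _"]) (simp add: that add.commute)
  have Q_add: "?Q (\<lambda>m j. C m j + C' m j) i j = ?Q C i j + ?Q C' i j" if "?nonneg C" "?nonneg C'" for C C' i j
  proof -
    have "?S (\<lambda>j m. C m j + C' m j) = (\<lambda>i j. ?S (\<lambda>j m. C m j) i j + ?S (\<lambda>j m. C' m j) i j)"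
      by (intro ext subst_sum_add adm that)
    then show ?thesis
      using skew_add[of 0 "?S (\<lambda>j m. C m j)" "?S (\<lambda>j m. C' m j)" i j] low that by simp
  qed
  have Q_shift1: "?Q (shift1 C) = mult_plus (?Q C)" if "?nonneg C" for C
  proof -
    have "?S (\<lambda>j m. shift1 C m j) = shift2 (?S (\<lambda>j m. C m j))"
      using subst_sum_shift2[of bin_fst "\<lambda>j m. C m j"] by (simp add: shift1_def shift2_def fun_eq_iff)
    then show ?thesis
      using skew_shift2[of 0 "?S (\<lambda>j m. C m j)"] low[OF that] by simp
  qed
  have Q_shift2: "?Q (shift2 C) = shift2 (?Q C)" if "?nonneg C" for C
  proof -
    have "?S (\<lambda>j m. shift2 C m j) = mult_plus (?S (\<lambda>j m. C m j))"
      using subst_sum_mult_plus[OF binomial_kernel_fst adm(2)[OF that]] by (simp add: shift1_def shift2_def)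
    then show ?thesis
      using skew_mult_plus[of 0 "?S (\<lambda>j m. C m j)"] low[OF that] by simp
  qed
  \<comment> \<open>Both sides turn the first variable into z + x and the second into x, and both
    fix constants; the induction on the degree extends this to all polynomials.\<close>
  have "?S C i j = ?Q C i j" if "?nonneg C" for C
    using that
  proof (induction "nat (i + j)" arbitrary: C i j)
    case 0
    \<comment> \<open>In degree at most 0 the constant term is the only entry that can be
      nonzero.\<close>
    define C0 where "C0 = (\<lambda>(m::int) (j::int). if m = 0 \<and> j = 0 then C 0 0 else 0)"
    have C: "C m l = C0 m l" if "m + l = i + j" for m l
      using 0 that by (cases "m < 0"; cases "l < 0"; cases "m = 0 \<and> l = 0") (auto simp: C0_def)
    have "?S C0 = C0"
      unfolding C0_def by (rule subst_sum_delta)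
    moreover have "(\<lambda>j m. C0 m j) = C0"
      by (auto simp: C0_def fun_eq_iff)
    moreover have "skew s C0 = C0"
      unfolding C0_def by (rule skew_delta)
    ultimately have "?S C0 i j = ?Q C0 i j"
      by simp
    then show ?case
      using subst_sum_degree_cong[of i j C C0, OF C] Q_cong[of i j C C0, OF C] by simp
  next
    case (Suc d)
    \<comment> \<open>In positive degree a polynomial is the first variable times C1 plus the second
      times C2. All terms divisible by the first variable go to C1 and the pure powers of the second
      to C2, so nothing is counted twice.\<close>
    define C1 where "C1 = (\<lambda>m j. if 0 \<le> m then C (m + 1) j else 0)"
    define C2 where "C2 = (\<lambda>(m::int) j. if m = 0 \<and> 0 \<le> j then C 0 (j + 1) else 0)"
    have nonneg: "?nonneg C1" "?nonneg C2" "?nonneg (shift1 C1)" "?nonneg (shift2 C2)"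
      using Suc.prems by (auto simp: C1_def C2_def shift1_def shift2_def)
    have C: "C m l = shift1 C1 m l + shift2 C2 m l" if "m + l = i + j" for m l
      using Suc.prems Suc.hyps(2) that by (cases "m < 0"; cases "l < 0"; cases "m = 0") (auto simp: C1_def C2_def shift1_def shift2_def)
    have IH: "?S C i' j' = ?Q C i' j'" if "?nonneg C" "i' + j' = i + j - 1" for C i' j'
      using Suc.hyps(2) that by (intro Suc.hyps(1)) auto
    have "?S C i j = ?S (\<lambda>m j. shift1 C1 m j + shift2 C2 m j) i j"
      by (rule subst_sum_degree_cong) (rule C)
    also have "\<dots> = ?S C1 (i - 1) j + ?S C1 i (j - 1) + ?S C2 i (j - 1)"
      by (simp add: subst_sum_add adm nonneg subst_sum_shift1 binomial_kernel_fst subst_sum_shift2)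
    also have "\<dots> = ?Q C1 (i - 1) j + ?Q C1 i (j - 1) + ?Q C2 i (j - 1)"
      using nonneg(1,2) by (simp only: IH)
    also have "\<dots> = ?Q (shift1 C1) i j + ?Q (shift2 C2) i j"
      by (simp only: Q_shift1[OF nonneg(1)] Q_shift2[OF nonneg(2)]) (simp add: mult_plus_def shift2_def)
    also have "\<dots> = ?Q (\<lambda>m j. shift1 C1 m j + shift2 C2 m j) i j"
      by (rule Q_add[OF nonneg(3,4), symmetric])
    also have "\<dots> = ?Q C i j"
      by (rule Q_cong) (rule C[symmetric])
    finally show ?case .
  qed
  then show ?thesis
    using assms by simp
qed

end

section \<open>Iterated operators and lower bounds on exponents\<close>

lemma funpow_invariant: "(\<And>C. P C \<Longrightarrow> P (f C)) \<Longrightarrow> P C \<Longrightarrow> P ((f ^^ n) C)"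
  by (induction n) auto

lemma funpow_intertwine:
  assumes "\<And>C. P C \<Longrightarrow> P (f C)" "\<And>C. P C \<Longrightarrow> h (f C) = g (h C)" "P C"
  shows "h ((f ^^ n) C) = (g ^^ n) (h C)"
proof (induction n)
  case (Suc n)
  show ?case
    using assms(2)[OF funpow_invariant[of P f C n, OF assms(1,3)]] Suc by simp
qed simp

lemma funpow_commute:
  assumes "\<And>C. f (g C) = g (f C)"
  shows "(f ^^ n) ((g ^^ m) C) = (g ^^ m) ((f ^^ n) C)"
proof -
  have "(f ^^ n) (g C) = g ((f ^^ n) C)" for C
    by (induction n) (simp_all add: assms)
  then show ?thesis
    by (intro funpow_intertwine[where P = "\<lambda>_. True" and h = "f ^^ n" and f = g and g = g]) simp_all
qed

lemma funpow_eq_mono: "(f ^^ l) x = (f ^^ l) y \<Longrightarrow> l \<le> n \<Longrightarrow> (f ^^ n) x = (f ^^ n) y" for f :: "'a \<Rightarrow> 'a"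
proof -
  assume eq: "(f ^^ l) x = (f ^^ l) y" and "l \<le> n"
  then obtain d where "n = d + l"
    using le_Suc_ex add.commute by metis
  then show ?thesis
    using eq by (simp add: funpow_add)
qed

definition low1 :: "(int \<Rightarrow> int \<Rightarrow> 'm::zero) \<Rightarrow> bool" where
  "low1 C \<longleftrightarrow> (\<exists>M. \<forall>m<M. \<forall>j. C m j = 0)"

definition low2 :: "(int \<Rightarrow> int \<Rightarrow> 'm::zero) \<Rightarrow> bool" where
  "low2 C \<longleftrightarrow> (\<exists>J. \<forall>m. \<forall>j<J. C m j = 0)"

lemma low1_ops:
  fixes C :: "int \<Rightarrow> int \<Rightarrow> 'm::ab_group_add"
  assumes "low1 C"
  shows "low1 (shift1 C)" "low1 (shift2 C)" "low1 (mult_plus C)" "low1 (mult_minus C)"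
proof -
  obtain M where M: "\<And>m j. m < M \<Longrightarrow> C m j = 0"
    using assms by (auto simp: low1_def)
  show "low1 (shift1 C)" "low1 (shift2 C)" "low1 (mult_plus C)" "low1 (mult_minus C)"
    unfolding low1_def shift1_def shift2_def mult_plus_def mult_minus_def
    by (intro exI[of _ M] allI impI; simp add: M)+
qed

lemma low2_ops:
  fixes C :: "int \<Rightarrow> int \<Rightarrow> 'm::ab_group_add"
  assumes "low2 C"
  shows "low2 (shift1 C)" "low2 (shift2 C)" "low2 (mult_plus C)" "low2 (mult_minus C)"
proof -
  obtain J where J: "\<And>m j. j < J \<Longrightarrow> C m j = 0"
    using assms by (auto simp: low2_def)
  show "low2 (shift1 C)" "low2 (shift2 C)" "low2 (mult_plus C)" "low2 (mult_minus C)"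
    unfolding low2_def shift1_def shift2_def mult_plus_def mult_minus_def
    by (intro exI[of _ J] allI impI; simp add: J)+
qed

lemma shift1_pow: "(shift1 ^^ l) C m j = C (m - int l) j"
  by (induction l arbitrary: m) (simp_all add: shift1_def algebra_simps)

lemma shift2_pow: "(shift2 ^^ l) C m j = C m (j - int l)"
  by (induction l arbitrary: j) (simp_all add: shift2_def algebra_simps)

lemma shift_pow_inj: "(shift1 ^^ l) ((shift2 ^^ p) F) = (shift1 ^^ l) ((shift2 ^^ p) G) \<Longrightarrow> F = G"
proof (intro ext)
  fix m j
  assume "(shift1 ^^ l) ((shift2 ^^ p) F) = (shift1 ^^ l) ((shift2 ^^ p) G)"
  from fun_cong[OF fun_cong[OF this], of "m + int l" "j + int p"] show "F m j = G m j"
    by (simp add: shift1_pow shift2_pow)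
qed

lemma shift_commutes:
  fixes C :: "int \<Rightarrow> int \<Rightarrow> 'm::ab_group_add"
  shows "shift1 (shift2 C) = shift2 (shift1 C)"
    "mult_plus (shift1 C) = shift1 (mult_plus C)" "mult_plus (shift2 C) = shift2 (mult_plus C)"
    "mult_minus (shift1 C) = shift1 (mult_minus C)" "mult_minus (shift2 C) = shift2 (mult_minus C)"
    "mult_plus (mult_minus C) = mult_minus (mult_plus C)"
  by (simp_all add: shift1_def shift2_def mult_plus_def mult_minus_def fun_eq_iff)

lemma mult_minus_low2:
  fixes C :: "int \<Rightarrow> int \<Rightarrow> 'm::ab_group_add"
  assumes "\<And>m j. j < J \<Longrightarrow> C m j = 0" "j < J"
  shows "(mult_minus ^^ k) C m j = 0"
  using assms(2) by (induction k arbitrary: m j) (simp_all add: assms(1) mult_minus_def)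

lemma mult_minus_low1:
  fixes C :: "int \<Rightarrow> int \<Rightarrow> 'm::ab_group_add"
  assumes "\<And>m j. m < J \<Longrightarrow> C m j = 0" "m < J"
  shows "(mult_minus ^^ k) C m j = 0"
  using assms(2) by (induction k arbitrary: m j) (simp_all add: assms(1) mult_minus_def)

lemma mult_plus_low1:
  fixes C :: "int \<Rightarrow> int \<Rightarrow> 'm::ab_group_add"
  assumes "\<And>m j. m < J \<Longrightarrow> C m j = 0" "m < J"
  shows "(mult_plus ^^ k) C m j = 0"
  using assms(2) by (induction k arbitrary: m j) (simp_all add: assms(1) mult_plus_def)

text \<open>Exchanging the variables negates w - y; squares make the sign disappear. This is the
  source of the exponent 2 * k in the locality statement.\<close>

lemma mult_minus_transpose:
  fixes C :: "int \<Rightarrow> int \<Rightarrow> 'm::ab_group_add"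
  shows "(\<lambda>j m. ((mult_minus ^^ 2) ^^ k) C m j) = ((mult_minus ^^ 2) ^^ k) (\<lambda>j m. C m j)"
  by (rule funpow_intertwine[where P = "\<lambda>_. True" and h = "\<lambda>C j m. C m j"])
    (simp_all add: mult_minus_def numeral_2_eq_2 fun_eq_iff)

context char0_space
begin

lemma low2_admissible: "low2 C \<Longrightarrow> admissible (bin_fst :: int \<Rightarrow> int \<Rightarrow> 'k) C"
  unfolding low2_def by (elim exE, rule admissible_fst) auto

lemma low1_admissible: "low1 C \<Longrightarrow> admissible (bin_diff :: int \<Rightarrow> int \<Rightarrow> 'k) C"
  unfolding low1_def by (elim exE, rule admissible_diff) auto

lemma subst_sum_pow:
  fixes C :: "int \<Rightarrow> int \<Rightarrow> 'm"
  assumes "low2 C"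
  shows "subst_sum s bin_fst ((shift1 ^^ l) C) = (mult_plus ^^ l) (subst_sum s bin_fst C)"
    "subst_sum s bin_fst ((shift2 ^^ l) C) = (shift2 ^^ l) (subst_sum s bin_fst C)"
    "subst_sum s bin_fst ((mult_minus ^^ l) C) = (shift1 ^^ l) (subst_sum s bin_fst C)"
proof -
  show "subst_sum s bin_fst ((shift1 ^^ l) C) = (mult_plus ^^ l) (subst_sum s bin_fst C)"
    by (rule funpow_intertwine[where P = low2])
      (simp_all add: assms low2_ops subst_sum_mult_plus binomial_kernel_fst low2_admissible)
  show "subst_sum s bin_fst ((shift2 ^^ l) C) = (shift2 ^^ l) (subst_sum s bin_fst C)"
    by (rule funpow_intertwine[where P = low2])
      (auto simp: assms low2_ops subst_sum_shift2 fun_eq_iff, simp add: shift2_def)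
  show "subst_sum s bin_fst ((mult_minus ^^ l) C) = (shift1 ^^ l) (subst_sum s bin_fst C)"
    by (rule funpow_intertwine[where P = low2])
      (auto simp: assms low2_ops subst_sum_mult_minus binomial_kernel_fst low2_admissible fun_eq_iff,
       simp add: shift1_def)
qed

text \<open>The third rule concerns squares because t = - z contributes a sign to each single
  \<open>shift1\<close>.\<close>

lemma skew_pow:
  assumes "low1 G"
  shows "skew s ((shift2 ^^ l) G) = (mult_plus ^^ l) (skew s G)"
    "skew s ((mult_plus ^^ l) G) = (shift2 ^^ l) (skew s G)"
    "skew s (((shift1 ^^ 2) ^^ l) G) = ((shift1 ^^ 2) ^^ l) (skew s G)"
proof -
  have *: "skew s (shift2 G) = mult_plus (skew s G)" "skew s (mult_plus G) = shift2 (skew s G)"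
    "skew s (shift1 G) = (\<lambda>i j. - shift1 (skew s G) i j)" if G: "low1 G" for G
  proof -
    obtain T where T: "\<And>t w. t < T \<Longrightarrow> G t w = 0"
      using G by (auto simp: low1_def)
    show "skew s (shift2 G) = mult_plus (skew s G)" "skew s (mult_plus G) = shift2 (skew s G)"
      "skew s (shift1 G) = (\<lambda>i j. - shift1 (skew s G) i j)"
      by (rule skew_shift2[of T G, OF T] skew_mult_plus[of T G, OF T] skew_shift1[of T G, OF T]; assumption)+
  qed
  show "skew s ((shift2 ^^ l) G) = (mult_plus ^^ l) (skew s G)"
    by (rule funpow_intertwine[where P = low1]) (simp_all add: assms low1_ops *)
  show "skew s ((mult_plus ^^ l) G) = (shift2 ^^ l) (skew s G)"
    by (rule funpow_intertwine[where P = low1]) (simp_all add: assms low1_ops *)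
  show "skew s (((shift1 ^^ 2) ^^ l) G) = ((shift1 ^^ 2) ^^ l) (skew s G)"
    by (rule funpow_intertwine[where P = low1])
      (simp_all add: assms low1_ops * numeral_2_eq_2, simp add: shift1_def)
qed

text \<open>Weak associativity in both orders together with skew-symmetry yields commutativity: both sides
  are obtained from the same regular series by an invertible substitution.\<close>

lemma locality_from_associativity:
  fixes A B \<Phi> \<Psi> :: "int \<Rightarrow> int \<Rightarrow> 'm"
  assumes A: "low2 A" and B: "low1 B"
    and assoc1: "\<exists>l. (mult_plus ^^ l) \<Phi> = (mult_plus ^^ l) (subst_sum s bin_fst A)"
    and assoc2: "\<exists>l. (mult_plus ^^ l) \<Psi> = (mult_plus ^^ l) (subst_sum s bin_fst (\<lambda>j m. B m j))"
    and skew: "\<Phi> = skew s \<Psi>" and \<Psi>: "\<And>i j. i < - int k \<Longrightarrow> \<Psi> i j = 0"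
  shows "(mult_minus ^^ (2 * k)) A = (mult_minus ^^ (2 * k)) B"
proof -
  let ?S = "subst_sum s bin_fst" and ?mm = "\<lambda>C. ((mult_minus ^^ 2) ^^ k) C"
    and ?t = "\<lambda>C. ((shift1 ^^ 2) ^^ k) C"
  obtain J M l1 p1 where J: "\<And>m j. j < J \<Longrightarrow> A m j = 0" and M: "\<And>m j. m < M \<Longrightarrow> B m j = 0"
    and l1: "(mult_plus ^^ l1) \<Phi> = (mult_plus ^^ l1) (?S A)"
    and p1: "(mult_plus ^^ p1) \<Psi> = (mult_plus ^^ p1) (?S (\<lambda>j m. B m j))"
    using A B assoc1 assoc2 unfolding low1_def low2_def by blast
  \<comment> \<open>The exponents are enlarged beyond what associativity asks for, so that w^l
    \<open>B\<close> has no negative powers of w and y^p \<open>A\<close> none of y.\<close>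
  define l where "l = max l1 (nat (- M))"
  define p where "p = max p1 (nat (- J))"
  have l: "(mult_plus ^^ l) \<Phi> = (mult_plus ^^ l) (?S A)"
    by (rule funpow_eq_mono[OF l1]) (simp add: l_def)
  have p: "(mult_plus ^^ p) \<Psi> = (mult_plus ^^ p) (?S (\<lambda>j m. B m j))"
    by (rule funpow_eq_mono[OF p1]) (simp add: p_def)
  define C1 where "C1 = (shift1 ^^ l) ((shift2 ^^ p) (?mm A))"
  define C2 where "C2 = (shift1 ^^ l) ((shift2 ^^ p) (?mm B))"
  \<comment> \<open>The common image (z + x)^l z^(2k) x^p \<Phi>; both C1 and C2 will be seen to map
    to it.\<close>
  define F where "F = (mult_plus ^^ l) (?t ((shift2 ^^ p) \<Phi>))"
  have mm: "?mm = (mult_minus ^^ (2 * k))" "?t = (shift1 ^^ (2 * k))"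
    by (simp_all add: funpow_mult)
  have low2_mm: "low2 (?mm C)" "low2 ((shift2 ^^ n) C)" if "low2 C" for C :: "int \<Rightarrow> int \<Rightarrow> 'm" and n
    using that unfolding mm by (auto intro: funpow_invariant[where P = low2] low2_ops)
  have "?S C1 = (mult_plus ^^ l) ((shift2 ^^ p) (?t (?S A)))"
    unfolding C1_def mm
    by (simp add: subst_sum_pow low2_mm[unfolded mm] A)
  also have "\<dots> = (shift2 ^^ p) (?t ((mult_plus ^^ l) (?S A)))"
    unfolding mm by (simp only: funpow_commute[of mult_plus shift2, OF shift_commutes(3)]
        funpow_commute[of mult_plus shift1, OF shift_commutes(2)])
  also have "\<dots> = F"
    unfolding mm F_def l[symmetric] by (simp only: funpow_commute[of mult_plus shift2, OF shift_commutes(3)]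
        funpow_commute[of mult_plus shift1, OF shift_commutes(2)]
        funpow_commute[of shift1 shift2, OF shift_commutes(1)])
  finally have SC1: "?S C1 = F" .
  \<comment> \<open>For C2 the other order is used: with y = t + w, associativity identifies the
    substituted series with w^l t^(2k) (t + w)^p \<Psi>.\<close>
  define G where "G = (shift2 ^^ l) (?t ((mult_plus ^^ p) \<Psi>))"
  have low2_BT: "low2 (\<lambda>j m. B m j)"
    using B by (auto simp: low1_def low2_def)
  have C2T: "(\<lambda>j m. C2 m j) = (shift2 ^^ l) ((shift1 ^^ p) (?mm (\<lambda>j m. B m j)))"
    unfolding C2_def mult_minus_transpose[of k B, symmetric] fun_eq_iff
    by (simp only: shift1_pow shift2_pow simp_thms)
  have SC2T: "?S (\<lambda>j m. C2 m j) = G"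
  proof -
    have low: "low2 ((shift1 ^^ n) C)" if "low2 C" for C :: "int \<Rightarrow> int \<Rightarrow> 'm" and n
      using that by (auto intro: funpow_invariant[where P = low2] low2_ops)
    have "?S (\<lambda>j m. C2 m j) = (shift2 ^^ l) ((mult_plus ^^ p) (?t (?S (\<lambda>j m. B m j))))"
      unfolding C2T mm by (simp add: subst_sum_pow low2_mm[unfolded mm] low low2_BT)
    also have "\<dots> = G"
      unfolding G_def p mm by (simp only: funpow_commute[of mult_plus shift1, OF shift_commutes(2)])
    finally show ?thesis .
  qed
  have C2T_low: "C2 m j = 0" if "m < 0" for m j
  proof -
    have "m - int l < M"
      using that by (auto simp: l_def)
    then show ?thesis
      unfolding C2_def mm by (simp add: shift1_pow shift2_pow mult_minus_low1[of M B] M)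
  qed
  \<comment> \<open>The factor t^(2k) outweighs the pole of \<Psi> in t, whose order is at most
    k.\<close>
  have G_low: "G t w = 0" if "t < 0" for t w
  proof -
    have "t - int (2 * k) < - int k"
      using that by simp
    then show ?thesis
      unfolding G_def mm by (simp add: shift1_pow shift2_pow mult_plus_low1[of "- int k" \<Psi>] \<Psi>)
  qed
  \<comment> \<open>That C2 has no negative powers of y cannot be read off from its definition. It
    follows from the same property of G in t, since the triangular substitution cannot hide negative
    powers.\<close>
  have C2_low: "C2 m j = 0" if "j < 0" for m j
    using subst_sum_fst_inj[of "\<lambda>i. i < 0" 0 "\<lambda>j m. C2 m j" j m] bin_fst_eq_0' C2T_low G_low SC2T that
    by (metis linorder_not_le)
  have "low1 \<Psi>"
    using \<Psi> by (auto simp: low1_def)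
  then have low1_\<Psi>: "low1 ((mult_plus ^^ n) \<Psi>)" "low1 (?t ((mult_plus ^^ n) \<Psi>))" for n
    unfolding mm by (auto intro!: funpow_invariant[where P = low1] low1_ops)
  \<comment> \<open>C2 is now free of negative powers of both variables, as the polynomial identity
    for \<open>skew\<close> requires.\<close>
  have "?S C2 = skew s G"
    by (intro ext, subst SC2T[symmetric], rule subst_sum_eq_skew) (use C2T_low C2_low in blast)
  also have "\<dots> = F"
    unfolding G_def F_def skew by (simp add: skew_pow low1_\<Psi> \<open>low1 \<Psi>\<close>)
  finally have SC2: "?S C2 = F" .
  have C1_low: "C1 m j = 0" if "j < 0" for m j
  proof -
    have "j - int p < J"
      using that by (auto simp: p_def)
    then show ?thesis
      unfolding C1_def mm by (simp add: shift1_pow shift2_pow mult_minus_low2[of J A] J)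
  qed
  \<comment> \<open>C1 and C2 have the same image F, and the substitution is injective on series
    with nonnegative powers of y.\<close>
  have "C1 m j - C2 m j = 0" for m j
  proof (rule subst_sum_fst_inj[of "\<lambda>_. True" 0])
    fix i j
    have "admissible (bin_fst :: int \<Rightarrow> int \<Rightarrow> 'k) C1" "admissible (bin_fst :: int \<Rightarrow> int \<Rightarrow> 'k) C2"
      by (rule admissible_fst[of 0], simp add: C1_low C2_low)+
    then show "?S (\<lambda>m j. C1 m j - C2 m j) i j = 0"
      by (simp add: subst_sum_minus SC1 SC2)
  qed (simp_all add: C1_low C2_low)
  then have "C1 = C2"
    by (simp add: fun_eq_iff)
  then have "?mm A = ?mm B"
    unfolding C1_def C2_def by (rule shift_pow_inj)
  then show ?thesis
    by (simp only: mm)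
qed

end

section \<open>Locality in modules\<close>

lemma vmodule_space: "vmodule V M \<Longrightarrow> space_on (carrier M) (smult M)"
  by (simp add: vmodule_def)

lemma vmodule_lin_map_D: "vmodule V M \<Longrightarrow> lin_map (carrier M) (smult M) (carrier M) (smult M) (D M)"
  by (simp add: vmodule_def lin_map_def)

lemma vmodule_act_closed: "vmodule V M \<Longrightarrow> a \<in> carrier V \<Longrightarrow> u \<in> carrier M \<Longrightarrow> act M a u n \<in> carrier M"
  by (simp add: vmodule_def laurent_def)

lemma vmodule_act_low:
  assumes "vmodule V M" "a \<in> carrier V" "u \<in> carrier M"
  obtains N where "\<And>n. n < N \<Longrightarrow> act M a u n = 0"
proof -
  have "laurent (carrier M) (act M a u)"
    using assms by (simp add: vmodule_def)
  then show ?thesis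
    using that by (auto simp: laurent_def)
qed

lemma vmodule_lin_map_act:
  "vmodule V M \<Longrightarrow> a \<in> carrier V \<Longrightarrow>
     lin_map (carrier M) (smult M) (carrier M) (smult M) (\<lambda>u. act M a u n)"
  unfolding lin_map_def
  by (auto simp: vmodule_act_closed) (auto simp: vmodule_def linear_on_def scale_series_def)

lemma vmodule_lin_map_alg:
  "vmodule V V \<Longrightarrow> vmodule V M \<Longrightarrow> u \<in> carrier M \<Longrightarrow>
     lin_map (carrier V) (smult V) (carrier M) (smult M) (\<lambda>a. act M a u n)"
  unfolding lin_map_def
  by (auto simp: vmodule_act_closed) (auto simp: vmodule_def linear_on_def scale_series_def)

lemma vmodule_act_D:
  "vmodule V M \<Longrightarrow> a \<in> carrier V \<Longrightarrow> u \<in> carrier M \<Longrightarrow>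
     act M (D V a) u n = smult M (of_int (n + 1)) (act M a u (n + 1))"
  by (simp add: vmodule_def deriv_series_def)

lemma vmodule_D_closed: "vmodule V M \<Longrightarrow> u \<in> carrier M \<Longrightarrow> D M u \<in> carrier M"
  by (auto simp: vmodule_def)

lemma vmodule_D_act:
  "vmodule V M \<Longrightarrow> a \<in> carrier V \<Longrightarrow> u \<in> carrier M \<Longrightarrow>
     D M (act M a u n) = act M (D V a) u n + act M a (D M u) n"
  by (simp add: vmodule_def)

lemma apply_at_sum_eq:
  assumes "vector_space s"
  shows "apply_at_sum s T h i j = subst_sum s bin_fst (\<lambda>m n. T (h n) m) i j"
proof -
  interpret vector_space s
    by fact
  have "subst_sum s bin_fst (\<lambda>m n. T (h n) m) i j =
      Sum_any (\<lambda>n. s (bin_fst i (i + j - n)) (T (h n) (i + j - n)))"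
    unfolding subst_sum_def
    by (rule Sum_any.reindex_cong[of "\<lambda>n. i + j - n"]) (auto intro!: o_bij[of "\<lambda>n. i + j - n"])
  moreover have "expand_sum s (T (h n)) i (j - n) = s (bin_fst i (i + j - n)) (T (h n) (i + j - n))" for n
    by (simp add: expand_sum_def bin_fst_def add_diff_eq)
  ultimately show ?thesis
    by (simp add: apply_at_sum_def)
qed

context
  fixes V :: "('k::field_char_0, 'v::ab_group_add) valg" and M :: "('k, 'v, 'm::ab_group_add) vmod"
  assumes V: "vertex_algebra V" and M: "vmodule V M"
begin

lemma vertex_algebra_module: "vmodule V V"
  using V by (simp add: vertex_algebra_def)

text \<open>The r-th power of the derivation acts as the r-th derivative in x, which contributes r!
  times a binomial coefficient; the factorial cancels against that of the exponential.\<close>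

lemma act_D_pow:
  assumes c: "c \<in> carrier V" and u: "u \<in> carrier M"
  shows "(D V ^^ r) c \<in> carrier V \<and>
    act M ((D V ^^ r) c) u j = smult M (fact r * bin_fst j (j + int r)) (act M c u (j + int r))"
proof (induction r arbitrary: j)
  case 0
  interpret vector_space "smult M"
    using space_onD(6)[OF vmodule_space[OF M]] .
  show ?case
    by (simp add: c)
next
  case (Suc r)
  interpret vector_space "smult M"
    using space_onD(6)[OF vmodule_space[OF M]] .
  define m where "m = j + 1 + int r"
  have "of_int (j + 1) * bin_fst (j + 1) m = (of_int (m - j) * bin_fst j m :: 'k)"
    using kernel_absorb[OF binomial_kernel_fst, of m j, where 'a = 'k]
      kernel_absorb'[OF binomial_kernel_fst, of m j, where 'a = 'k] by simp
  then have "of_int (j + 1) * (fact r * bin_fst (j + 1) m) = (fact (Suc r) * bin_fst j m :: 'k)"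
    by (simp add: m_def algebra_simps)
  moreover have "act M ((D V ^^ Suc r) c) u j =
      smult M (of_int (j + 1)) (smult M (fact r * bin_fst (j + 1) m) (act M c u m))"
    using vmodule_act_D[OF M, of "(D V ^^ r) c" u j] Suc.IH[of "j + 1"] u by (simp add: m_def)
  ultimately have "act M ((D V ^^ Suc r) c) u j = smult M (fact (Suc r) * bin_fst j m) (act M c u m)"
    by simp
  moreover have "j + int (Suc r) = m"
    by (simp add: m_def)
  moreover have "(D V ^^ Suc r) c \<in> carrier V"
    using vmodule_D_closed[OF vertex_algebra_module] Suc.IH[of 0] by simp
  ultimately show ?case
    by simp
qed

lemma exp_D_closed: "c \<in> carrier V \<Longrightarrow> exp_D V c r \<in> carrier V"
proof -
  assume c: "c \<in> carrier V"
  have "(D V ^^ n) c \<in> carrier V" for n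
    by (induction n) (auto simp: c vmodule_D_closed[OF vertex_algebra_module])
  then show ?thesis
    using space_onD(1,3)[OF vmodule_space[OF vertex_algebra_module]] by (simp add: exp_D_def)
qed

text \<open>Taylor's formula (e^(z d) c)_x u = c_(x + z) u, read at the coefficient of z^r
  x^j.\<close>

lemma act_exp_D:
  assumes c: "c \<in> carrier V" and u: "u \<in> carrier M"
  shows "act M (exp_D V c r) u j = smult M (bin_fst j (j + r)) (act M c u (j + r))"
proof -
  interpret vector_space "smult M"
    using space_onD(6)[OF vmodule_space[OF M]] .
  note lin = vmodule_lin_map_alg[OF vertex_algebra_module M u, of j]
  show ?thesis
  proof (cases "0 \<le> r")
    case True
    have "(1 / fact (nat r)) * (fact (nat r) * bin_fst j (j + r)) = (bin_fst j (j + r) :: 'k)"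
      by simp
    then show ?thesis
      using act_D_pow[OF c u, of "nat r" j] lin_map_scale[OF lin, of "(D V ^^ nat r) c" "1 / fact (nat r)"] True
      by (simp add: exp_D_def)
  next
    case False
    then show ?thesis
      using lin_map_0[OF lin] by (simp add: exp_D_def bin_fst_eq_0)
  qed
qed

text \<open>Skew-symmetry of V and Taylor's formula give (a_z b)_x u = (e^(z d) b_(-z) a)_x u =
  (b_(-z) a)_(x + z) u.\<close>

lemma act_skew:
  assumes a: "a \<in> carrier V" and b: "b \<in> carrier V" and u: "u \<in> carrier M"
  shows "(\<lambda>i j. act M (act V a b i) u j) = skew (smult M) (\<lambda>n r. act M (act V b a n) u r)"
proof (intro ext)
  fix i j
  interpret vector_space "smult M"
    using space_onD(6)[OF vmodule_space[OF M]] .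
  interpret V: vector_space "smult V"
    using space_onD(6)[OF vmodule_space[OF vertex_algebra_module]] .
  note lin = vmodule_lin_map_alg[OF vertex_algebra_module M u, of j]
  let ?c = "\<lambda>n. smult V ((- 1) powi n) (act V b a n)"
  have c: "?c n \<in> carrier V" for n
    by (intro space_onD(3)[OF vmodule_space[OF vertex_algebra_module]] vmodule_act_closed[OF vertex_algebra_module] a b)
  obtain N where N: "\<And>n. n < N \<Longrightarrow> act V b a n = 0"
    using vmodule_act_low[OF vertex_algebra_module b a] by blast
  have "{n. exp_D V (?c n) (i - n) \<noteq> 0} \<subseteq> {N..i}"
  proof
    fix n assume n: "n \<in> {n. exp_D V (?c n) (i - n) \<noteq> 0}"
    have "(D V ^^ r) 0 = 0" for r
      by (induction r) (simp_all add: lin_map_0[OF vmodule_lin_map_D[OF vertex_algebra_module]])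
    then have "\<not> n < N" "n \<le> i"
      using n by (auto simp: exp_D_def N split: if_splits)
    then show "n \<in> {N..i}"
      by simp
  qed
  then have fin: "finite {n. exp_D V (?c n) (i - n) \<noteq> 0}"
    by (rule finite_subset) simp
  have "act V a b i = Sum_any (\<lambda>n. exp_D V (?c n) (i - n))"
    using V a b unfolding vertex_algebra_def by blast
  then have "act M (act V a b i) u j = Sum_any (\<lambda>n. act M (exp_D V (?c n) (i - n)) u j)"
    using lin_map_Sum_any[OF lin fin exp_D_closed[OF c]] by metis
  also have "\<dots> = Sum_any (\<lambda>n. smult M (bin_fst j (j + (i - n)))
      (smult M ((- 1) powi n) (act M (act V b a n) u (j + (i - n)))))"
    unfolding act_exp_D[OF c u]
      lin_map_scale[OF vmodule_lin_map_alg[OF vertex_algebra_module M u]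
        vmodule_act_closed[OF vertex_algebra_module b a]] ..
  also have "\<dots> = skew (smult M) (\<lambda>n r. act M (act V b a n) u r) i j"
    unfolding skew_def subst_sum_def
    by (rule Sum_any.reindex_cong[of "\<lambda>m. j + i - m", symmetric])
      (auto intro!: o_bij[of "\<lambda>m. j + i - m"] simp: fun_eq_iff add_diff_eq)
  finally show "act M (act V a b i) u j = skew (smult M) (\<lambda>n r. act M (act V b a n) u r) i j" .
qed

lemma low2_act_act:
  assumes "a \<in> carrier V" "b \<in> carrier V" "u \<in> carrier M"
  shows "low2 (\<lambda>m j. act M a (act M b u j) m)"
proof -
  obtain N where "\<And>n. n < N \<Longrightarrow> act M b u n = 0"
    using vmodule_act_low[OF M assms(2,3)] by blast
  then show ?thesis
    using lin_map_0[OF vmodule_lin_map_act[OF M assms(1)]] by (auto simp: low2_def intro!: exI[of _ N])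
qed

lemma low1_act_act:
  assumes "a \<in> carrier V" "b \<in> carrier V" "u \<in> carrier M"
  shows "low1 (\<lambda>m j. act M b (act M a u m) j)"
  using low2_act_act[OF assms(2,1,3)] by (auto simp: low1_def low2_def)

lemma weak_assoc_subst:
  assumes "a \<in> carrier V" "b \<in> carrier V" "u \<in> carrier M"
  shows "\<exists>l. (mult_plus ^^ l) (\<lambda>i j. act M (act V a b i) u j) =
    (mult_plus ^^ l) (subst_sum (smult M) bin_fst (\<lambda>m j. act M a (act M b u j) m))"
proof -
  have "apply_at_sum (smult M) (act M a) (act M b u) =
      subst_sum (smult M) bin_fst (\<lambda>m j. act M a (act M b u j) m)"
    by (intro ext apply_at_sum_eq space_onD(6)[OF vmodule_space[OF M]])
  moreover have "weak_assoc V M a b u"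
    using M assms by (simp add: vmodule_def)
  ultimately show ?thesis
    by (simp add: weak_assoc_def)
qed

text \<open>The exponent comes from the pole order of b_z a in V and is therefore the same for all
  u, although the exponents of weak associativity vary with u.\<close>

lemma module_locality:
  assumes a: "a \<in> carrier V" and b: "b \<in> carrier V"
  shows "\<exists>k. \<forall>u\<in>carrier M. (mult_minus ^^ k) (\<lambda>m j. act M a (act M b u j) m) =
    (mult_minus ^^ k) (\<lambda>m j. act M b (act M a u m) j)"
proof -
  interpret char0_space "smult M"
    using space_on_char0[OF vmodule_space[OF M]] .
  obtain N where N: "\<And>n. n < N \<Longrightarrow> act V b a n = 0"
    using vmodule_act_low[OF vertex_algebra_module b a] by blast
  have "(mult_minus ^^ (2 * nat (- N))) (\<lambda>m j. act M a (act M b u j) m) =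
    (mult_minus ^^ (2 * nat (- N))) (\<lambda>m j. act M b (act M a u m) j)" if u: "u \<in> carrier M" for u
  proof (rule locality_from_associativity)
    show "act M (act V b a i) u j = 0" if "i < - int (nat (- N))" for i j
      using that N[of i] lin_map_0[OF vmodule_lin_map_alg[OF vertex_algebra_module M u]]
      by (auto split: if_splits)
    show "(\<lambda>i j. act M (act V a b i) u j) = skew (smult M) (\<lambda>i j. act M (act V b a i) u j)"
      by (rule act_skew[OF a b u])
  qed (fact low2_act_act[OF a b u] low1_act_act[OF a b u] weak_assoc_subst[OF a b u] weak_assoc_subst[OF b a u])+
  then show ?thesis
    by blast
qed

text \<open>The iterate formula, which is weak associativity without an auxiliary power of z + x. A
  high power of z + x kills the \<open>bin_diff\<close> term and makes the other term equal to (a_z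
  b)_x u; it can be cancelled because both sides are truncated in z. So V acts on its modules by the
  same residue product that defines the action on Vhom.\<close>

lemma module_associator:
  assumes a: "a \<in> carrier V" and b: "b \<in> carrier V" and u: "u \<in> carrier M"
  shows "act M (act V a b i) u j =
    vprod (smult M) (\<lambda>m j. act M a (act M b u j) m) (\<lambda>m j. act M b (act M a u m) j) i j"
proof -
  interpret char0_space "smult M"
    using space_on_char0[OF vmodule_space[OF M]] .
  define A where "A = (\<lambda>m j. act M a (act M b u j) m)"
  define B where "B = (\<lambda>m j. act M b (act M a u m) j)"
  define \<Phi> where "\<Phi> = (\<lambda>i j. act M (act V a b i) u j)"
  have adm: "adm2 TYPE('k) A B"
    using low2_admissible[OF low2_act_act[OF a b u]] low1_admissible[OF low1_act_act[OF a b u]]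
    by (simp add: A_def B_def)
  obtain k where k: "(mult_minus ^^ k) A = (mult_minus ^^ k) B"
    using module_locality[OF a b] u unfolding A_def B_def by blast
  obtain l1 where l1: "(mult_plus ^^ l1) \<Phi> = (mult_plus ^^ l1) (subst_sum (smult M) bin_fst A)"
    using weak_assoc_subst[OF a b u] unfolding A_def \<Phi>_def by blast
  obtain L where L: "\<And>m j. m < L \<Longrightarrow> B m j = 0"
    using low1_act_act[OF a b u] unfolding B_def low1_def by blast
  obtain N where N: "\<And>n. n < N \<Longrightarrow> act V a b n = 0"
    using vmodule_act_low[OF vertex_algebra_module a b] by blast
  \<comment> \<open>Large enough both for weak associativity and for w^l \<open>B\<close> to have no
    negative powers of w.\<close>
  define l where "l = max l1 (nat (- L))"
  have shift: "(mult_plus ^^ l) (subst_sum (smult M) bin_diff B) =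
      subst_sum (smult M) bin_diff ((shift1 ^^ l) B)"
    by (rule funpow_intertwine[where P = low1, symmetric])
      (simp_all add: low1_ops subst_sum_mult_plus binomial_kernel_diff low1_admissible low1_act_act[OF a b u, folded B_def])
  have "(shift1 ^^ l) B m j = 0" if "m < 0" for m j
    using that L by (simp add: shift1_pow l_def)
  then have zero: "(mult_plus ^^ l) (subst_sum (smult M) bin_diff B) = (\<lambda>i j. 0)"
    unfolding shift by (intro ext subst_sum_diff_nonneg)
  have minus: "(mult_plus ^^ n) (\<lambda>i j. F i j - G i j) = (\<lambda>i j. (mult_plus ^^ n) F i j - (mult_plus ^^ n) G i j)"
    for n and F G :: "int \<Rightarrow> int \<Rightarrow> 'm"
    by (induction n) (simp_all add: mult_plus_def fun_eq_iff)
  have "vprod (smult M) A B = (\<lambda>i j. subst_sum (smult M) bin_fst A i j - subst_sum (smult M) bin_diff B i j)"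
    by (simp add: vprod_def fun_eq_iff)
  then have "(mult_plus ^^ l) (vprod (smult M) A B) = (mult_plus ^^ l) (subst_sum (smult M) bin_fst A)"
    by (simp add: minus zero)
  also have "\<dots> = (mult_plus ^^ l) \<Phi>"
    by (rule funpow_eq_mono[OF l1[symmetric]]) (simp add: l_def)
  finally have "vprod (smult M) A B = \<Phi>"
  proof (rule mult_plus_pow_inj)
    \<comment> \<open>Below N the left factor a_z b vanishes, and below -k the residue product
      vanishes by locality.\<close>
    fix i j assume i: "i < min N (- int k)"
    then have "\<Phi> i j = 0"
      using N[of i] lin_map_0[OF vmodule_lin_map_alg[OF vertex_algebra_module M u]] by (simp add: \<Phi>_def)
    then show "vprod (smult M) A B i j = \<Phi> i j"
      using vprod_eq_0[OF adm k, of i j] i by simp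
  qed
  then show ?thesis
    by (simp add: A_def B_def \<Phi>_def fun_eq_iff)
qed

end

section \<open>Triple series and Dong's lemma\<close>

definition mult_minus12 :: "(int \<Rightarrow> int \<Rightarrow> int \<Rightarrow> 'm::ab_group_add) \<Rightarrow> int \<Rightarrow> int \<Rightarrow> int \<Rightarrow> 'm" where
  "mult_minus12 X = (\<lambda>p q r. X (p - 1) q r - X p (q - 1) r)"

definition mult_minus13 :: "(int \<Rightarrow> int \<Rightarrow> int \<Rightarrow> 'm::ab_group_add) \<Rightarrow> int \<Rightarrow> int \<Rightarrow> int \<Rightarrow> 'm" where
  "mult_minus13 X = (\<lambda>p q r. X (p - 1) q r - X p q (r - 1))"

definition mult_minus23 :: "(int \<Rightarrow> int \<Rightarrow> int \<Rightarrow> 'm::ab_group_add) \<Rightarrow> int \<Rightarrow> int \<Rightarrow> int \<Rightarrow> 'm" where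
  "mult_minus23 X = (\<lambda>p q r. X p (q - 1) r - X p q (r - 1))"

lemmas mult_minus3_defs = mult_minus12_def mult_minus13_def mult_minus23_def

lemma mult_minus12_pow: "(\<lambda>p q. (mult_minus12 ^^ k) X p q r) = (mult_minus ^^ k) (\<lambda>p q. X p q r)"
  by (rule funpow_intertwine[where P = "\<lambda>_. True" and h = "\<lambda>X p q. X p q r"])
    (simp_all add: mult_minus12_def mult_minus_def)

lemma mult_minus13_pow: "(\<lambda>p r. (mult_minus13 ^^ k) X p q r) = (mult_minus ^^ k) (\<lambda>p r. X p q r)"
  by (rule funpow_intertwine[where P = "\<lambda>_. True" and h = "\<lambda>X p r. X p q r"])
    (simp_all add: mult_minus13_def mult_minus_def)

lemma mult_minus23_pow: "(mult_minus23 ^^ k) X p = (mult_minus ^^ k) (X p)"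
  by (rule funpow_intertwine[where P = "\<lambda>_. True" and h = "\<lambda>X. X p"])
    (simp_all add: mult_minus23_def mult_minus_def)

lemma mult_minus12_pow_eq:
  "(\<And>r. (mult_minus ^^ k) (\<lambda>p q. X p q r) = (mult_minus ^^ k) (\<lambda>p q. Y p q r)) \<Longrightarrow>
     (mult_minus12 ^^ k) X = (mult_minus12 ^^ k) Y"
  unfolding mult_minus12_pow[symmetric] by (simp add: fun_eq_iff)

lemma mult_minus13_pow_eq:
  "(\<And>q. (mult_minus ^^ k) (\<lambda>p r. X p q r) = (mult_minus ^^ k) (\<lambda>p r. Y p q r)) \<Longrightarrow>
     (mult_minus13 ^^ k) X = (mult_minus13 ^^ k) Y"
  unfolding mult_minus13_pow[symmetric] by (simp add: fun_eq_iff)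

lemma mult_minus23_pow_eq:
  "(\<And>p. (mult_minus ^^ k) (X p) = (mult_minus ^^ k) (Y p)) \<Longrightarrow> (mult_minus23 ^^ k) X = (mult_minus23 ^^ k) Y"
  unfolding mult_minus23_pow[symmetric] by (simp add: fun_eq_iff)

lemma mult_minus3_commutes:
  "mult_minus12 (mult_minus13 X) = mult_minus13 (mult_minus12 X)"
  "mult_minus12 (mult_minus23 X) = mult_minus23 (mult_minus12 X)"
  "mult_minus13 (mult_minus23 X) = mult_minus23 (mult_minus13 X)"
  by (simp_all add: mult_minus3_defs fun_eq_iff)

lemma funpow_additive:
  fixes f :: "'a::ab_group_add \<Rightarrow> 'a"
  assumes "\<And>x y. f (x - y) = f x - f y"
  shows "(f ^^ n) (x - y) = (f ^^ n) x - (f ^^ n) y" "(f ^^ n) (x + y) = (f ^^ n) x + (f ^^ n) y" "(f ^^ n) 0 = 0"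
proof -
  show *: "(f ^^ n) (x - y) = (f ^^ n) x - (f ^^ n) y" for x y
    by (induction n) (simp_all add: assms)
  show 0: "(f ^^ n) 0 = 0"
    using *[of 0 0] by simp
  show "(f ^^ n) (x + y) = (f ^^ n) x + (f ^^ n) y"
    using *[of x "- y"] *[of 0 y] by (simp add: 0)
qed

lemma mult_minus_diff: "mult_minus (F - G) = mult_minus F - mult_minus G"
  by (simp add: mult_minus_def fun_eq_iff)

lemma mult_minus12_diff: "mult_minus12 (X - Y) = mult_minus12 X - mult_minus12 Y"
  by (simp add: mult_minus12_def fun_eq_iff)

lemma mult_minus13_diff: "mult_minus13 (X - Y) = mult_minus13 X - mult_minus13 Y"
  by (simp add: mult_minus13_def fun_eq_iff)

lemma mult_minus23_diff: "mult_minus23 (X - Y) = mult_minus23 X - mult_minus23 Y"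
  by (simp add: mult_minus23_def fun_eq_iff)

lemmas mult_minus_pow_additive = funpow_additive[of mult_minus, OF mult_minus_diff]
lemmas mult_minus12_pow_additive = funpow_additive[of mult_minus12, OF mult_minus12_diff]
lemmas mult_minus13_pow_additive = funpow_additive[of mult_minus13, OF mult_minus13_diff]
lemmas mult_minus23_pow_additive = funpow_additive[of mult_minus23, OF mult_minus23_diff]

text \<open>Exchanging the variables changes both sides by the same sign (-1)^k.\<close>

lemma mult_minus_pow_flip:
  fixes F G :: "int \<Rightarrow> int \<Rightarrow> 'm::ab_group_add"
  assumes "(mult_minus ^^ k) F = (mult_minus ^^ k) G"
  shows "(mult_minus ^^ k) (\<lambda>i j. F j i) = (mult_minus ^^ k) (\<lambda>i j. G j i)"
proof -
  have *: "(mult_minus ^^ k) (\<lambda>i j. F j i) i j = (if even k then (mult_minus ^^ k) F j i else - (mult_minus ^^ k) F j i)"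
    for F :: "int \<Rightarrow> int \<Rightarrow> 'm" and i j
    by (induction k arbitrary: i j) (auto simp: mult_minus_def)
  show ?thesis
    by (intro ext) (use *[of F] *[of G] assms in presburger)
qed

text \<open>Think of \<gamma> = \<alpha> - \<beta>: every term of the binomial expansion of \<gamma>^(a + b) contains \<alpha>^a or
  \<beta>^b.\<close>

lemma funpow_binomial_vanish:
  fixes \<alpha> \<beta> \<gamma> :: "'x \<Rightarrow> 'x"
  assumes \<alpha>: "\<And>X. P X \<Longrightarrow> P (\<alpha> X)" and \<beta>: "\<And>X. P X \<Longrightarrow> P (\<beta> X)"
    and \<gamma>: "\<And>X. P (\<alpha> X) \<Longrightarrow> P (\<beta> X) \<Longrightarrow> P (\<gamma> X)"
    and commute: "\<And>X. \<alpha> (\<beta> X) = \<beta> (\<alpha> X)" "\<And>X. \<gamma> (\<alpha> X) = \<alpha> (\<gamma> X)" "\<And>X. \<gamma> (\<beta> X) = \<beta> (\<gamma> X)"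
  shows "P ((\<alpha> ^^ a) X) \<Longrightarrow> P ((\<beta> ^^ b) X) \<Longrightarrow> P ((\<gamma> ^^ (a + b)) X)"
proof (induction "a + b" arbitrary: a b X)
  case 0
  then show ?case
    by simp
next
  case (Suc n)
  have P: "P ((\<gamma> ^^ m) X)" if "P X" for m
    by (rule funpow_invariant[of P]) (auto intro: \<alpha> \<beta> \<gamma> that)
  show ?case
  proof (cases "a = 0 \<or> b = 0")
    case True
    then show ?thesis
      using Suc.prems P by auto
  next
    case False
    then obtain a' b' where ab: "a = Suc a'" "b = Suc b'"
      by (meson not0_implies_Suc)
    \<comment> \<open>One factor of \<gamma> is split off. The remaining n factors are handled by
      induction on \<alpha> X, which lacks one \<alpha> less, and on \<beta> X, which lacks one
      \<beta> less; the hypothesis on \<gamma> recombines the results.\<close>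
    have "P ((\<gamma> ^^ (a' + b)) (\<alpha> X))"
    proof (rule Suc.hyps(1))
      show "P ((\<alpha> ^^ a') (\<alpha> X))"
        using Suc.prems(1) by (simp add: ab funpow_swap1)
      have "(\<beta> ^^ b) (\<alpha> X) = \<alpha> ((\<beta> ^^ b) X)"
        using funpow_commute[of \<beta> \<alpha> b 1 X] commute(1) by simp
      then show "P ((\<beta> ^^ b) (\<alpha> X))"
        using Suc.prems(2) \<alpha> by simp
    qed (use Suc.hyps(2) ab in simp)
    moreover have "P ((\<gamma> ^^ (a + b')) (\<beta> X))"
    proof (rule Suc.hyps(1))
      show "P ((\<beta> ^^ b') (\<beta> X))"
        using Suc.prems(2) by (simp add: ab funpow_swap1)
      have "(\<alpha> ^^ a) (\<beta> X) = \<beta> ((\<alpha> ^^ a) X)"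
        using funpow_commute[of \<alpha> \<beta> a 1 X] commute(1) by simp
      then show "P ((\<alpha> ^^ a) (\<beta> X))"
        using Suc.prems(1) \<beta> by simp
    qed (use Suc.hyps(2) ab in simp)
    moreover have "(\<gamma> ^^ n) (\<alpha> X) = \<alpha> ((\<gamma> ^^ n) X)" "(\<gamma> ^^ n) (\<beta> X) = \<beta> ((\<gamma> ^^ n) X)"
      using funpow_commute[of \<gamma> \<alpha> n 1 X] funpow_commute[of \<gamma> \<beta> n 1 X] commute by simp_all
    moreover have "a' + b = n" "a + b' = n"
      using Suc.hyps(2) ab by auto
    ultimately have "P (\<gamma> ((\<gamma> ^^ n) X))"
      by (intro \<gamma>) simp_all
    then show ?thesis
      by (simp add: Suc.hyps(2)[symmetric])
  qed
qed

context char0_space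
begin

text \<open>Dong's lemma, for A = [c(v), a(w) b(y)] and B = [c(v), b(y) a(w)] with exponents in the order
  w, y, v.\<close>

lemma dong_vprod:
  fixes A B :: "int \<Rightarrow> int \<Rightarrow> int \<Rightarrow> 'm"
  assumes adm: "\<And>r. adm2 TYPE('k) (\<lambda>p q. A p q r) (\<lambda>p q. B p q r)"
    and k: "(mult_minus12 ^^ k) A = (mult_minus12 ^^ k) B"
    and A: "(mult_minus13 ^^ k1) ((mult_minus23 ^^ k2) A) = 0"
    and B: "(mult_minus13 ^^ k1) ((mult_minus23 ^^ k2) B) = 0"
  shows "(mult_minus ^^ (k1 + nat (n + int k + 1) + k2))
    (\<lambda>q r. vprod s (\<lambda>p q. A p q r) (\<lambda>p q. B p q r) n q) = 0"
proof -
  \<comment> \<open>A boolean indexes the two regions, True for \<open>A\<close> and False for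
    \<open>B\<close>, so that one operator acts on the pair.\<close>
  define lift where "lift = (\<lambda>(f :: (int \<Rightarrow> int \<Rightarrow> int \<Rightarrow> 'm) \<Rightarrow> int \<Rightarrow> int \<Rightarrow> int \<Rightarrow> 'm) (X :: bool \<Rightarrow> int \<Rightarrow> int \<Rightarrow> int \<Rightarrow> 'm) t. f (X t))"
  define vp where "vp = (\<lambda>X n q (r::int). vprod s (\<lambda>p q. X True p q r) (\<lambda>p q. X False p q r) n q)"
  define ad where "ad = (\<lambda>X :: bool \<Rightarrow> int \<Rightarrow> int \<Rightarrow> int \<Rightarrow> 'm.
    \<forall>r. adm2 TYPE('k) (\<lambda>p q. X True p q r) (\<lambda>p q. X False p q r))"
  \<comment> \<open>All exponents up to n are included because multiplication by w - y replaces the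
    coefficient of z^n' by that of z^(n' - 1); a downward closed range is stable under this.\<close>
  define P where "P = (\<lambda>X. ad X \<and> (\<forall>n'\<le>n. \<forall>q r. vp X n' q r = 0))"
  \<comment> \<open>The three operators are multiplication by w - v, w - y and y - v, whence
    \<gamma> = \<alpha> - \<beta>.\<close>
  define \<alpha> where "\<alpha> = lift mult_minus13"
  define \<beta> where "\<beta> = lift mult_minus12"
  define \<gamma> where "\<gamma> = lift mult_minus23"
  have lift_pow: "(lift f ^^ n) X = (\<lambda>t. (f ^^ n) (X t))" for f n X
    by (induction n) (simp_all add: lift_def)
  have slices:
    "(\<lambda>p q. mult_minus12 Y p q r) = mult_minus (\<lambda>p q. Y p q r)"
    "(\<lambda>p q. mult_minus13 Y p q r) = (\<lambda>p q. shift1 (\<lambda>p q. Y p q r) p q - Y p q (r - 1))"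
    "(\<lambda>p q. mult_minus23 Y p q r) = (\<lambda>p q. shift2 (\<lambda>p q. Y p q r) p q - Y p q (r - 1))"
    for Y :: "int \<Rightarrow> int \<Rightarrow> int \<Rightarrow> 'm" and r
    by (simp_all add: mult_minus3_defs mult_minus_def shift1_def shift2_def)
  have ad: "ad (\<alpha> X)" "ad (\<beta> X)" "ad (\<gamma> X)" if "ad X" for X
  proof -
    have *: "adm2 TYPE('k) (\<lambda>p q. X True p q r) (\<lambda>p q. X False p q r)" for r
      using that by (simp add: ad_def)
    show "ad (\<alpha> X)" "ad (\<beta> X)" "ad (\<gamma> X)"
      unfolding ad_def \<alpha>_def \<beta>_def \<gamma>_def lift_def slices
      by (intro allI adm2_minus[OF adm2_shift1[OF *] *] adm2_mult_minus[OF *] adm2_minus[OF adm2_shift2[OF *] *])+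
  qed
  have vp: "vp (\<beta> X) n q r = vp X (n - 1) q r"
    "vp (\<alpha> X) n q r = vp X (n - 1) q r + vp X n (q - 1) r - vp X n q (r - 1)"
    "vp (\<gamma> X) n q r = vp X n (q - 1) r - vp X n q (r - 1)" if "ad X" for X n q r
  proof -
    have *: "adm2 TYPE('k) (\<lambda>p q. X True p q r) (\<lambda>p q. X False p q r)" for r
      using that by (simp add: ad_def)
    show "vp (\<beta> X) n q r = vp X (n - 1) q r"
      "vp (\<alpha> X) n q r = vp X (n - 1) q r + vp X n (q - 1) r - vp X n q (r - 1)"
      "vp (\<gamma> X) n q r = vp X n (q - 1) r - vp X n q (r - 1)"
      unfolding vp_def \<alpha>_def \<beta>_def \<gamma>_def lift_def slices
      by (simp_all add: vprod_mult_minus[OF *] vprod_minus[OF adm2_shift1[OF *] *]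
          vprod_minus[OF adm2_shift2[OF *] *] vprod_shift1[OF *] vprod_shift2)
  qed
  define X0 where "X0 = (\<lambda>t. if t then A else B)"
  define X where "X = (\<gamma> ^^ k2) X0"
  have ad_X0: "ad X0"
    using adm by (simp add: ad_def X0_def)
  have ad_X: "ad X"
    unfolding X_def by (rule funpow_invariant[of ad]) (auto intro: ad ad_X0)
  have "P ((\<gamma> ^^ (k1 + nat (n + int k + 1))) X)"
  proof (rule funpow_binomial_vanish[of P \<alpha> \<beta>])
    show "P (\<alpha> X)" "P (\<beta> X)" if "P X" for X
      using that by (auto simp: P_def ad vp)
    show "P (\<gamma> X)" if "P (\<alpha> X)" "P (\<beta> X)" for X
    proof -
      have *: "\<gamma> X = (\<lambda>t p q r. \<alpha> X t p q r - \<beta> X t p q r)"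
        by (simp add: \<alpha>_def \<beta>_def \<gamma>_def lift_def mult_minus3_defs)
      have adm': "adm2 TYPE('k) (\<lambda>p q. \<alpha> X True p q r) (\<lambda>p q. \<alpha> X False p q r)"
        "adm2 TYPE('k) (\<lambda>p q. \<beta> X True p q r) (\<lambda>p q. \<beta> X False p q r)" for r
        using that by (simp_all add: P_def ad_def)
      have "ad (\<gamma> X)"
        unfolding * ad_def by (intro allI adm2_minus[OF adm'])
      moreover have "vp (\<gamma> X) n' q r = vp (\<alpha> X) n' q r - vp (\<beta> X) n' q r" for n' q r
        unfolding * vp_def by (rule vprod_minus[OF adm'])
      ultimately show ?thesis
        using that by (simp add: P_def)
    qed
    show "\<alpha> (\<beta> X) = \<beta> (\<alpha> X)" "\<gamma> (\<alpha> X) = \<alpha> (\<gamma> X)" "\<gamma> (\<beta> X) = \<beta> (\<gamma> X)" for X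
      by (simp_all add: \<alpha>_def \<beta>_def \<gamma>_def lift_def mult_minus3_commutes)
    have "(\<alpha> ^^ k1) X = (\<lambda>t. 0)"
      using A B by (auto simp: \<alpha>_def \<gamma>_def X_def X0_def lift_pow fun_eq_iff)
    then show "P ((\<alpha> ^^ k1) X)"
      by (simp add: P_def ad_def vp_def admissible_def vprod_def subst_sum_eq_0)
    have "(mult_minus12 ^^ k) ((mult_minus23 ^^ k2) A) = (mult_minus12 ^^ k) ((mult_minus23 ^^ k2) B)"
      by (simp add: funpow_commute[of mult_minus12 mult_minus23, OF mult_minus3_commutes(2)] k)
    then have X_eq: "(mult_minus ^^ k) (\<lambda>p q. X True p q r) = (mult_minus ^^ k) (\<lambda>p q. X False p q r)" for r
      unfolding mult_minus12_pow[symmetric] X_def \<gamma>_def X0_def lift_pow by simp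
    have pow: "vp ((\<beta> ^^ l) X) n' q r = vp X (n' - int l) q r \<and> ad ((\<beta> ^^ l) X)" for l n' q r
      by (induction l arbitrary: n') (auto simp: ad_X vp ad algebra_simps)
    have "vp X n' q r = 0" if "n' < - int k" for n' q r
      using ad_X that unfolding vp_def ad_def by (intro vprod_eq_0[OF _ X_eq]) auto
    \<comment> \<open>This many factors w - y push every exponent up to n below -k, where the
      residue product vanishes.\<close>
    then show "P ((\<beta> ^^ nat (n + int k + 1)) X)"
      using pow by (auto simp: P_def)
  qed
  then have zero: "vp ((\<gamma> ^^ (k1 + nat (n + int k + 1) + k2)) X0) n q r = 0" for q r
    by (simp add: P_def X_def funpow_add)
  have "(\<lambda>X. vp X n) ((\<gamma> ^^ l) X0) = (mult_minus ^^ l) (vp X0 n)" for l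
    by (rule funpow_intertwine[of ad]) (auto simp: ad ad_X0 vp fun_eq_iff mult_minus_def)
  then show ?thesis
    using zero by (simp add: vp_def X0_def fun_eq_iff)
qed

end

section \<open>The action on vertex homomorphisms\<close>

lemma vertex_homs_outside: "f \<in> vertex_homs V M N \<Longrightarrow> u \<notin> carrier M \<Longrightarrow> f u = 0"
  by (simp add: vertex_homs_def)

lemma vertex_homs_closed: "f \<in> vertex_homs V M N \<Longrightarrow> u \<in> carrier M \<Longrightarrow> f u j \<in> carrier N"
  by (simp add: vertex_homs_def laurent_def)

lemma vertex_homs_low:
  assumes "f \<in> vertex_homs V M N" "u \<in> carrier M"
  obtains J where "\<And>j. j < J \<Longrightarrow> f u j = 0"
proof -
  have "laurent (carrier N) (f u)"
    using assms by (simp add: vertex_homs_def)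
  then show ?thesis
    using that by (auto simp: laurent_def)
qed

lemma vertex_homs_lin_map:
  "vmodule V M \<Longrightarrow> vmodule V N \<Longrightarrow> f \<in> vertex_homs V M N \<Longrightarrow>
     lin_map (carrier M) (smult M) (carrier N) (smult N) (\<lambda>u. f u j)"
  unfolding lin_map_def
  by (auto simp: vertex_homs_closed vmodule_space)
    (auto simp: vertex_homs_def linear_on_def scale_series_def)

lemma vertex_homs_D:
  "f \<in> vertex_homs V M N \<Longrightarrow> u \<in> carrier M \<Longrightarrow>
     f (D M u) j = D N (f u j) - smult N (of_int (j + 1)) (f u (j + 1))"
  by (simp add: vertex_homs_def deriv_series_def)

lemma vertex_homs_locality:
  assumes "f \<in> vertex_homs V M N" "a \<in> carrier V"
  obtains k where "\<And>u. u \<in> carrier M \<Longrightarrow> (mult_minus ^^ k) (\<lambda>m j. act N a (f u j) m) =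
    (mult_minus ^^ k) (\<lambda>m j. f (act M a u m) j)"
proof -
  have "\<exists>k. \<forall>u\<in>carrier M. (mult_minus ^^ k) (\<lambda>m j. act N a (f u j) m) =
    (mult_minus ^^ k) (\<lambda>m j. f (act M a u m) j)"
    using assms unfolding vertex_homs_def by blast
  then show ?thesis
    using that by blast
qed

context
  fixes V :: "('k::field_char_0, 'v::ab_group_add) valg"
    and M :: "('k, 'v, 'm::ab_group_add) vmod" and N :: "('k, 'v, 'n::ab_group_add) vmod"
  assumes V: "vertex_algebra V" and M: "vmodule V M" and N: "vmodule V N"
begin

interpretation char0_space "smult N"
  using space_on_char0[OF vmodule_space[OF N]] .

context
  fixes f :: "'m \<Rightarrow> int \<Rightarrow> 'n" and a :: 'v and u :: 'm
  assumes f: "f \<in> vertex_homs V M N" and a: "a \<in> carrier V" and u: "u \<in> carrier M"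
begin

lemma act_hom_closed: "act N a (f u j) m \<in> carrier N" "f (act M a u m) j \<in> carrier N"
  by (intro vmodule_act_closed[OF N a] vertex_homs_closed[OF f] u vmodule_act_closed[OF M a])+

lemma low2_act_hom: "low2 (\<lambda>m j. act N a (f u j) m)"
proof -
  obtain J where "\<And>j. j < J \<Longrightarrow> f u j = 0"
    using vertex_homs_low[OF f u] by blast
  then show ?thesis
    using lin_map_0[OF vmodule_lin_map_act[OF N a]] unfolding low2_def
    by (intro exI[of _ J]) simp
qed

lemma low1_hom_act: "low1 (\<lambda>m j. f (act M a u m) j)"
proof -
  obtain L where "\<And>m. m < L \<Longrightarrow> act M a u m = 0"
    using vmodule_act_low[OF M a u] by blast
  then show ?thesis
    using lin_map_0[OF vertex_homs_lin_map[OF M N f]] unfolding low1_def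
    by (intro exI[of _ L]) simp
qed

lemma hom_act_low: "\<exists>J. \<forall>j<J. f (act M a u m) j = 0"
  using vertex_homs_low[OF f vmodule_act_closed[OF M a u]] by metis

lemma adm2_hom: "adm2 TYPE('k) (\<lambda>m j. act N a (f u j) m) (\<lambda>m j. f (act M a u m) j)"
  using low2_admissible[OF low2_act_hom] low1_admissible[OF low1_hom_act] by blast

text \<open>Linearity of f pulls the binomial coefficients out of its argument, and the difference
  of the expansions of a_(z + y) u and a_(y + z) u becomes the kernel
  \<open>bin_diff\<close>.\<close>

lemma Vhom_act:
  "act (Vhom V M N) a f i u j = vprod (smult N) (\<lambda>m j. act N a (f u j) m) (\<lambda>m j. f (act M a u m) j) i j"
proof -
  interpret M: vector_space "smult M"
    using space_onD(6)[OF vmodule_space[OF M]] .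
  have *: "expand_sum (smult M) (act M a u) i n - expand_sum (smult M) (act M a u) n i =
      smult M (bin_diff i (i + n)) (act M a u (i + n))" for n
    by (auto simp: expand_sum_def bin_diff_def bin_fst_def bin_snd_def M.scale_left_diff_distrib add.commute[of n i])
  have "Sum_any (\<lambda>n. f (expand_sum (smult M) (act M a u) i n - expand_sum (smult M) (act M a u) n i) (j - n)) =
      Sum_any (\<lambda>n. smult N (bin_diff i (i + n)) (f (act M a u (i + n)) (j - n)))"
    unfolding * by (simp add: lin_map_scale[OF vertex_homs_lin_map[OF M N f] vmodule_act_closed[OF M a u]])
  also have "\<dots> = subst_sum (smult N) bin_diff (\<lambda>m j. f (act M a u m) j) i j"
    unfolding subst_sum_def
    by (rule Sum_any.reindex_cong[of "\<lambda>n. n + i", symmetric])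
      (auto intro!: o_bij[of "\<lambda>n. n - i"] simp: fun_eq_iff algebra_simps)
  finally show ?thesis
    using u by (simp add: Vhom_def vprod_def apply_at_sum_eq[OF vector_space_axioms])
qed

end

lemma Vhom_act_outside: "u \<notin> carrier M \<Longrightarrow> act (Vhom V M N) a f i u = 0"
  by (simp add: Vhom_def zero_fun_def)

lemma Vhom_act_closed:
  assumes f: "f \<in> vertex_homs V M N" and a: "a \<in> carrier V" and u: "u \<in> carrier M"
  shows "act (Vhom V M N) a f n u j \<in> carrier N"
  unfolding Vhom_act[OF assms]
  by (rule space_on_vprod[OF vmodule_space[OF N]]) (simp_all add: act_hom_closed assms)

text \<open>In either order of a(w) and f(y), replacing u by \<open>D M u\<close> amounts to
  applying d - d/dw - d/dy. After w = z + y the sum d/dw + d/dy is d/dy by the chain rule.\<close>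

lemma Vhom_act_D:
  assumes f: "f \<in> vertex_homs V M N" and a: "a \<in> carrier V" and u: "u \<in> carrier M"
  shows "act (Vhom V M N) a f n (D M u) j = D N (act (Vhom V M N) a f n u j) -
    smult N (of_int (j + 1)) (act (Vhom V M N) a f n u (j + 1))"
proof -
  note lin = vmodule_lin_map_D[OF N]
  note Nact = vmodule_lin_map_act[OF N a]
  note flin = vertex_homs_lin_map[OF M N f]
  define A where "A = (\<lambda>m j. act N a (f u j) m)"
  define B where "B = (\<lambda>m j. f (act M a u m) j)"
  have adm: "adm2 TYPE('k) A B"
    unfolding A_def B_def by (rule adm2_hom[OF assms])
  have closed: "A m j \<in> carrier N" "B m j \<in> carrier N" for m j
    using act_hom_closed[OF assms] by (simp_all add: A_def B_def)
  let ?A = "\<lambda>m j. deriv1 (smult N) A m j + deriv2 (smult N) A m j"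
  let ?B = "\<lambda>m j. deriv1 (smult N) B m j + deriv2 (smult N) B m j"
  have A: "act N a (f (D M u) j) m = D N (A m j) - ?A m j" for m j
  proof -
    have "act N a (f (D M u) j) m = act N a (D N (f u j)) m - smult N (of_int (j + 1)) (A m (j + 1))"
      unfolding vertex_homs_D[OF f u] A_def
      using vertex_homs_closed[OF f u]
      by (simp only: lin_map_diff[OF Nact] lin_map_scale[OF Nact] vmodule_D_closed[OF N]
          space_onD(3)[OF vmodule_space[OF N]])
    moreover have "D N (A m j) = smult N (of_int (m + 1)) (A (m + 1) j) + act N a (D N (f u j)) m"
      using vmodule_D_act[OF N a vertex_homs_closed[OF f u], of j m]
        vmodule_act_D[OF N a vertex_homs_closed[OF f u], of j m] by (simp add: A_def)
    ultimately show ?thesis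
      by (simp add: deriv1_def deriv2_def)
  qed
  have B: "f (act M a (D M u) m) j = D N (B m j) - ?B m j" for m j
  proof -
    have "act M a (D M u) m = D M (act M a u m) - smult M (of_int (m + 1)) (act M a u (m + 1))"
      using vmodule_D_act[OF M a u, of m] vmodule_act_D[OF M a u, of m] by simp
    then have "f (act M a (D M u) m) j = f (D M (act M a u m)) j - smult N (of_int (m + 1)) (B (m + 1) j)"
      unfolding B_def
      by (simp only: lin_map_diff[OF flin] lin_map_scale[OF flin] vmodule_act_closed[OF M a u]
          vmodule_D_closed[OF M] space_onD(3)[OF vmodule_space[OF M]])
    then show ?thesis
      unfolding vertex_homs_D[OF f vmodule_act_closed[OF M a u]]
      by (simp add: deriv1_def deriv2_def B_def)
  qed
  have adm1: "adm2 TYPE('k) (deriv1 (smult N) A) (deriv1 (smult N) B)"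
      and adm2: "adm2 TYPE('k) (deriv2 (smult N) A) (deriv2 (smult N) B)"
    using adm by (simp_all add: admissible_deriv1 admissible_deriv2 binomial_kernels)
  have admD: "adm2 TYPE('k) (\<lambda>m j. D N (A m j)) (\<lambda>m j. D N (B m j))"
    using adm by (auto intro: admissible_subset simp: lin_map_0[OF lin])
  have "act (Vhom V M N) a f n (D M u) j = vprod (smult N) (\<lambda>m j. D N (A m j) - ?A m j) (\<lambda>m j. D N (B m j) - ?B m j) n j"
    unfolding Vhom_act[OF f a vmodule_D_closed[OF M u]] A B ..
  also have "\<dots> = vprod (smult N) (\<lambda>m j. D N (A m j)) (\<lambda>m j. D N (B m j)) n j - vprod (smult N) ?A ?B n j"
    by (rule vprod_minus[OF admD adm2_add[OF adm1 adm2]])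
  also have "vprod (smult N) ?A ?B n j = smult N (of_int (j + 1)) (vprod (smult N) A B n (j + 1))"
    unfolding vprod_add[OF adm1 adm2] by (rule vprod_deriv2[OF adm])
  also have "vprod (smult N) (\<lambda>m j. D N (A m j)) (\<lambda>m j. D N (B m j)) n j = D N (vprod (smult N) A B n j)"
    by (rule lin_map_vprod[OF lin, symmetric]) (use adm closed in auto)
  finally show ?thesis
    unfolding Vhom_act[OF assms] A_def B_def .
qed

lemma Vhom_act_locality:
  assumes f: "f \<in> vertex_homs V M N" and a: "a \<in> carrier V" and b: "b \<in> carrier V"
  shows "\<exists>k. \<forall>u\<in>carrier M. (mult_minus ^^ k) (\<lambda>i j. act N b (act (Vhom V M N) a f n u j) i) =
    (mult_minus ^^ k) (\<lambda>i j. act (Vhom V M N) a f n (act M b u i) j)"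
proof -
  obtain k where k: "\<And>u. u \<in> carrier M \<Longrightarrow> (mult_minus ^^ k) (\<lambda>m j. act N a (f u j) m) =
      (mult_minus ^^ k) (\<lambda>m j. f (act M a u m) j)"
    using vertex_homs_locality[OF f a] by blast
  obtain k2 where "\<And>u. u \<in> carrier M \<Longrightarrow> (mult_minus ^^ k2) (\<lambda>m j. act N b (f u j) m) =
      (mult_minus ^^ k2) (\<lambda>m j. f (act M b u m) j)"
    using vertex_homs_locality[OF f b] by blast
  \<comment> \<open>The exponents are to be ordered w, y, v, in which the variable of f precedes
    that of b.\<close>
  from mult_minus_pow_flip[OF this]
  have k2: "\<And>u. u \<in> carrier M \<Longrightarrow> (mult_minus ^^ k2) (\<lambda>q r. act N b (f u q) r) =
      (mult_minus ^^ k2) (\<lambda>q r. f (act M b u r) q)" .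
  obtain kM where kM: "\<And>u. u \<in> carrier M \<Longrightarrow> (mult_minus ^^ kM) (\<lambda>m j. act M a (act M b u j) m) =
      (mult_minus ^^ kM) (\<lambda>m j. act M b (act M a u m) j)"
    using module_locality[OF V M a b] by blast
  obtain kN where kN: "\<And>u. u \<in> carrier N \<Longrightarrow> (mult_minus ^^ kN) (\<lambda>m j. act N a (act N b u j) m) =
      (mult_minus ^^ kN) (\<lambda>m j. act N b (act N a u m) j)"
    using module_locality[OF V N a b] by blast
  \<comment> \<open>The operators a and b have to be exchanged in N, to the left of f, and in M, to
    the right of it.\<close>
  define k1 where "k1 = max kM kN"
  have k1: "u \<in> carrier M \<Longrightarrow> (mult_minus ^^ k1) (\<lambda>m j. act M a (act M b u j) m) =
      (mult_minus ^^ k1) (\<lambda>m j. act M b (act M a u m) j)"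
    "v \<in> carrier N \<Longrightarrow> (mult_minus ^^ k1) (\<lambda>m j. act N a (act N b v j) m) =
      (mult_minus ^^ k1) (\<lambda>m j. act N b (act N a v m) j)" for u v
    using funpow_eq_mono[OF kM, of u k1] funpow_eq_mono[OF kN, of v k1] by (simp_all add: k1_def)
  let ?K = "k1 + nat (n + int k + 1) + k2"
  have "(mult_minus ^^ ?K) (\<lambda>i j. act N b (act (Vhom V M N) a f n u j) i) =
    (mult_minus ^^ ?K) (\<lambda>i j. act (Vhom V M N) a f n (act M b u i) j)" if u: "u \<in> carrier M" for u
  proof -
    note cM = vmodule_act_closed[OF M] and cN = vmodule_act_closed[OF N] and cf = vertex_homs_closed[OF f]
    note Na = vmodule_lin_map_act[OF N a] and Nb = vmodule_lin_map_act[OF N b]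
      and flin = vertex_homs_lin_map[OF M N f]
    \<comment> \<open>From left to right the operators are b a f, a f b, a b f in A1, A2, A3 and b f
      a, f a b, f b a in B1, B2, B3; p, q, r belong to a, f, b. So A1 - A2 and B1 - B2 are the
      commutators of b with a f and with f a.\<close>
    define A1 where "A1 = (\<lambda>p q r. act N b (act N a (f u q) p) r)"
    define A2 where "A2 = (\<lambda>p q r. act N a (f (act M b u r) q) p)"
    define A3 where "A3 = (\<lambda>p q r. act N a (act N b (f u q) r) p)"
    define B1 where "B1 = (\<lambda>p q r. act N b (f (act M a u p) q) r)"
    define B2 where "B2 = (\<lambda>p q r. f (act M a (act M b u r) p) q)"
    define B3 where "B3 = (\<lambda>p q r. f (act M b (act M a u p) r) q)"
    have adm1: "adm2 TYPE('k) (\<lambda>p q. A1 p q r) (\<lambda>p q. B1 p q r)" for r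
      using adm2_hom[OF f a u] unfolding A1_def B1_def
      by (auto intro: admissible_subset simp: lin_map_0[OF Nb])
    have adm2: "adm2 TYPE('k) (\<lambda>p q. A2 p q r) (\<lambda>p q. B2 p q r)" for r
      using adm2_hom[OF f a cM[OF b u]] unfolding A2_def B2_def by blast
    have "(mult_minus12 ^^ k) A1 = (mult_minus12 ^^ k) B1"
    proof (rule mult_minus12_pow_eq)
      fix r
      show "(mult_minus ^^ k) (\<lambda>p q. A1 p q r) = (mult_minus ^^ k) (\<lambda>p q. B1 p q r)"
        unfolding A1_def B1_def
        by (subst (1 2) lin_map_mult_minus_pow[OF Nb]) (use k[OF u] in \<open>auto intro: cN cf a cM u\<close>)
    qed
    moreover have "(mult_minus12 ^^ k) A2 = (mult_minus12 ^^ k) B2"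
      unfolding A2_def B2_def by (intro mult_minus12_pow_eq k cM b u)
    ultimately have 12: "(mult_minus12 ^^ k) (A1 - A2) = (mult_minus12 ^^ k) (B1 - B2)"
      by (simp only: mult_minus12_pow_additive)
    note commute = funpow_commute[of mult_minus13 mult_minus23 k1 k2, OF mult_minus3_commutes(3)]
    \<comment> \<open>b is carried across one operator at a time: past a at the cost of (w - v)^k1,
      then past f at the cost of (y - v)^k2.\<close>
    have "(mult_minus13 ^^ k1) A1 = (mult_minus13 ^^ k1) A3"
      unfolding A1_def A3_def by (intro mult_minus13_pow_eq k1(2)[symmetric] cf u)
    moreover have "(mult_minus23 ^^ k2) A3 = (mult_minus23 ^^ k2) A2"
    proof (rule mult_minus23_pow_eq)
      fix p
      show "(mult_minus ^^ k2) (A3 p) = (mult_minus ^^ k2) (A2 p)"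
        unfolding A3_def A2_def
        by (subst (1 2) lin_map_mult_minus_pow[OF Na]) (use k2[OF u] in \<open>auto intro: cN cf b cM u\<close>)
    qed
    ultimately have "(mult_minus13 ^^ k1) ((mult_minus23 ^^ k2) A1) = (mult_minus13 ^^ k1) ((mult_minus23 ^^ k2) A2)"
      using commute[of A1] commute[of A3] by simp
    then have A: "(mult_minus13 ^^ k1) ((mult_minus23 ^^ k2) (A1 - A2)) = 0"
      by (simp only: mult_minus23_pow_additive mult_minus13_pow_additive diff_self)
    have "(mult_minus23 ^^ k2) B1 = (mult_minus23 ^^ k2) B3"
      unfolding B1_def B3_def by (intro mult_minus23_pow_eq k2 cM a u)
    moreover have "(mult_minus13 ^^ k1) B3 = (mult_minus13 ^^ k1) B2"
    proof (rule mult_minus13_pow_eq)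
      fix q
      show "(mult_minus ^^ k1) (\<lambda>p r. B3 p q r) = (mult_minus ^^ k1) (\<lambda>p r. B2 p q r)"
        unfolding B3_def B2_def
        by (subst (1 2) lin_map_mult_minus_pow[OF flin]) (use k1(1)[OF u] in \<open>auto intro: cM a b u\<close>)
    qed
    ultimately have "(mult_minus13 ^^ k1) ((mult_minus23 ^^ k2) B1) = (mult_minus13 ^^ k1) ((mult_minus23 ^^ k2) B2)"
      using commute[of B2] commute[of B3] by simp
    then have B: "(mult_minus13 ^^ k1) ((mult_minus23 ^^ k2) (B1 - B2)) = 0"
      by (simp only: mult_minus23_pow_additive mult_minus13_pow_additive diff_self)
    have adm: "adm2 TYPE('k) (\<lambda>p q. (A1 - A2) p q r) (\<lambda>p q. (B1 - B2) p q r)" for r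
      using adm2_minus[OF adm1 adm2] by simp
    have "vprod (smult N) (\<lambda>p q. (A1 - A2) p q r) (\<lambda>p q. (B1 - B2) p q r) n q =
        act N b (act (Vhom V M N) a f n u q) r - act (Vhom V M N) a f n (act M b u r) q" for q r
    proof -
      have "vprod (smult N) (\<lambda>p q. (A1 - A2) p q r) (\<lambda>p q. (B1 - B2) p q r) n q =
          vprod (smult N) (\<lambda>p q. A1 p q r) (\<lambda>p q. B1 p q r) n q - vprod (smult N) (\<lambda>p q. A2 p q r) (\<lambda>p q. B2 p q r) n q"
        using vprod_minus[OF adm1 adm2] by simp
      moreover have "vprod (smult N) (\<lambda>p q. A1 p q r) (\<lambda>p q. B1 p q r) n q = act N b (act (Vhom V M N) a f n u q) r"
        unfolding Vhom_act[OF f a u] A1_def B1_def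
        by (rule lin_map_vprod[OF Nb, symmetric]) (use adm2_hom[OF f a u] act_hom_closed[OF f a u] in auto)
      moreover have "vprod (smult N) (\<lambda>p q. A2 p q r) (\<lambda>p q. B2 p q r) n q = act (Vhom V M N) a f n (act M b u r) q"
        unfolding Vhom_act[OF f a cM[OF b u]] A2_def B2_def ..
      ultimately show ?thesis
        by simp
    qed
    then have "(mult_minus ^^ ?K) (\<lambda>q r. act N b (act (Vhom V M N) a f n u q) r - act (Vhom V M N) a f n (act M b u r) q) = 0"
      using dong_vprod[OF adm 12 A B, of n] by simp
    then have "(mult_minus ^^ ?K) ((\<lambda>q r. act N b (act (Vhom V M N) a f n u q) r) -
        (\<lambda>q r. act (Vhom V M N) a f n (act M b u r) q)) = 0"
      by (simp add: fun_diff_def)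
    then have "(mult_minus ^^ ?K) (\<lambda>q r. act N b (act (Vhom V M N) a f n u q) r) =
        (mult_minus ^^ ?K) (\<lambda>q r. act (Vhom V M N) a f n (act M b u r) q)"
      by (simp only: mult_minus_pow_additive right_minus_eq)
    then show ?thesis
      by (rule mult_minus_pow_flip)
  qed
  then show ?thesis
    by blast
qed

lemma Vhom_act_vertex_hom:
  assumes f: "f \<in> vertex_homs V M N" and a: "a \<in> carrier V"
  shows "act (Vhom V M N) a f n \<in> vertex_homs V M N"
  unfolding vertex_homs_def mem_Collect_eq
proof (intro conjI allI impI ballI)
  show "act (Vhom V M N) a f n u = 0" if "u \<notin> carrier M" for u
    using that by (rule Vhom_act_outside)
  show "laurent (carrier N) (act (Vhom V M N) a f n u)" if u: "u \<in> carrier M" for u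
  proof -
    obtain J where J: "\<And>m j. j < J \<Longrightarrow> act N a (f u j) m = 0"
      using low2_act_hom[OF f a u] by (auto simp: low2_def)
    obtain L where L: "\<And>m j. m < L \<Longrightarrow> f (act M a u m) j = 0"
      using low1_hom_act[OF f a u] by (auto simp: low1_def)
    have "\<exists>J. \<forall>j<J. act (Vhom V M N) a f n u j = 0"
      unfolding Vhom_act[OF f a u] by (rule vprod_low[OF J L hom_act_low[OF f a u]])
    then show ?thesis
      using Vhom_act_closed[OF f a u] by (auto simp: laurent_def)
  qed
  show "linear_on (carrier M) (smult M) (scale_series (smult N)) (act (Vhom V M N) a f n)"
    unfolding linear_on_def
  proof (intro conjI ballI allI ext)
    fix u w j assume u: "u \<in> carrier M" and w: "w \<in> carrier M"
    note uw = space_onD(2)[OF vmodule_space[OF M] u w]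
    have "act N a (f (u + w) j) m = act N a (f u j) m + act N a (f w j) m" for m j
      using u w by (simp add: lin_map_add[OF vertex_homs_lin_map[OF M N f]]
          lin_map_add[OF vmodule_lin_map_act[OF N a]] vertex_homs_closed[OF f])
    moreover have "f (act M a (u + w) m) j = f (act M a u m) j + f (act M a w m) j" for m j
      using u w by (simp add: lin_map_add[OF vertex_homs_lin_map[OF M N f]]
          lin_map_add[OF vmodule_lin_map_act[OF M a]] vmodule_act_closed[OF M a])
    ultimately show "act (Vhom V M N) a f n (u + w) j = (act (Vhom V M N) a f n u + act (Vhom V M N) a f n w) j"
      using vprod_add[OF adm2_hom[OF f a u] adm2_hom[OF f a w]]
      by (simp add: Vhom_act[OF f a uw] Vhom_act[OF f a u] Vhom_act[OF f a w])
  next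
    fix c u j assume u: "u \<in> carrier M"
    note cu = space_onD(3)[OF vmodule_space[OF M] u, of c]
    have "act N a (f (smult M c u) j) m = smult N c (act N a (f u j) m)" for m j
      using u by (simp add: lin_map_scale[OF vertex_homs_lin_map[OF M N f]]
          lin_map_scale[OF vmodule_lin_map_act[OF N a]] vertex_homs_closed[OF f])
    moreover have "f (act M a (smult M c u) m) j = smult N c (f (act M a u m) j)" for m j
      using u by (simp add: lin_map_scale[OF vertex_homs_lin_map[OF M N f]]
          lin_map_scale[OF vmodule_lin_map_act[OF M a]] vmodule_act_closed[OF M a])
    ultimately show "act (Vhom V M N) a f n (smult M c u) j = scale_series (smult N) c (act (Vhom V M N) a f n u) j"
      using vprod_scale[OF adm2_hom[OF f a u]]
      by (simp add: Vhom_act[OF f a cu] Vhom_act[OF f a u] scale_series_def)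
  qed
  show "act (Vhom V M N) a f n (D M u) j = D N (act (Vhom V M N) a f n u j) -
      deriv_series (smult N) (act (Vhom V M N) a f n u) j" if "u \<in> carrier M" for u j
    using Vhom_act_D[OF f a that] by (simp add: deriv_series_def)
  show "\<exists>k. \<forall>u\<in>carrier M. (mult_minus ^^ k) (\<lambda>i j. act N b (act (Vhom V M N) a f n u j) i) =
      (mult_minus ^^ k) (\<lambda>i j. act (Vhom V M N) a f n (act M b u i) j)" if "b \<in> carrier V" for b
    by (rule Vhom_act_locality[OF f a that])
qed

end

section \<open>Associativity for iterated products\<close>

text \<open>The support condition of a product of operators applied to a vector, with the variables
  listed from the innermost operator outwards: the first exponent is bounded below, and for each of
  its values so is the second.\<close>

definition iter_low :: "(int \<Rightarrow> int \<Rightarrow> int \<Rightarrow> 'm::zero) \<Rightarrow> bool" where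
  "iter_low X \<longleftrightarrow> (\<exists>J. \<forall>p<J. \<forall>q r. X p q r = 0) \<and> (\<forall>p. \<exists>J. \<forall>q<J. \<forall>r. X p q r = 0)"

lemma iter_low_shift:
  assumes "iter_low X"
  shows "iter_low (\<lambda>p q r. X (p - 1) q r)" "iter_low (\<lambda>p q r. X p (q - 1) r)" "iter_low (\<lambda>p q r. X p q (r - 1))"
proof -
  obtain P where P: "\<And>p q r. p < P \<Longrightarrow> X p q r = 0"
    using assms unfolding iter_low_def by blast
  have J: "\<exists>J. \<forall>q<J. \<forall>r. X p q r = 0" for p
    using assms by (simp add: iter_low_def)
  show "iter_low (\<lambda>p q r. X (p - 1) q r)"
    unfolding iter_low_def using J by (intro conjI exI[of _ "P + 1"]) (auto simp: P)
  show "iter_low (\<lambda>p q r. X p (q - 1) r)"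
    unfolding iter_low_def
  proof (intro conjI allI)
    show "\<exists>J. \<forall>p<J. \<forall>q r. X p (q - 1) r = 0"
      using P by blast
    fix p
    obtain J where "\<And>q r. q < J \<Longrightarrow> X p q r = 0"
      using J[of p] by blast
    then show "\<exists>J. \<forall>q<J. \<forall>r. X p (q - 1) r = 0"
      by (intro exI[of _ J]) simp
  qed
  show "iter_low (\<lambda>p q r. X p q (r - 1))"
    unfolding iter_low_def using J P by (intro conjI) blast+
qed

lemma iter_low_diff:
  fixes X Y :: "int \<Rightarrow> int \<Rightarrow> int \<Rightarrow> 'm::ab_group_add"
  assumes "iter_low X" "iter_low Y"
  shows "iter_low (\<lambda>p q r. X p q r - Y p q r)"
proof -
  obtain P P' where P: "\<And>p q r. p < P \<Longrightarrow> X p q r = 0" "\<And>p q r. p < P' \<Longrightarrow> Y p q r = 0"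
    using assms unfolding iter_low_def by metis
  obtain J J' where J: "\<And>p q r. q < J p \<Longrightarrow> X p q r = 0" "\<And>p q r. q < J' p \<Longrightarrow> Y p q r = 0"
    using assms unfolding iter_low_def by metis
  show ?thesis
    unfolding iter_low_def
  proof (intro conjI allI)
    show "\<exists>J. \<forall>p<J. \<forall>q r. X p q r - Y p q r = 0"
      by (intro exI[of _ "min P P'"]) (simp add: P)
    show "\<exists>J. \<forall>q<J. \<forall>r. X p q r - Y p q r = 0" for p
      by (intro exI[of _ "min (J p) (J' p)"]) (simp add: J)
  qed
qed

text \<open>Only the finitely many p from P to B need separate bounds.\<close>

lemma uniform_low:
  fixes \<Phi> :: "int \<Rightarrow> int \<Rightarrow> bool"
  assumes "\<And>p j. p < P \<Longrightarrow> \<Phi> p j" "\<And>p. \<exists>J. \<forall>j<J. \<Phi> p j"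
  shows "\<exists>J. \<forall>p<B. \<forall>j<J. \<Phi> p j"
proof -
  obtain J where J: "\<And>p j. j < J p \<Longrightarrow> \<Phi> p j"
    using assms(2) by metis
  have "\<Phi> p j" if "p < B" "j < Min (J ` {P..B})" for p j
  proof (cases "p < P")
    case False
    then have "Min (J ` {P..B}) \<le> J p"
      using that(1) by (intro Min_le) auto
    then show ?thesis
      using that(2) by (intro J) auto
  qed (rule assms(1))
  then show ?thesis
    by blast
qed

text \<open>The components X True True, X True False, X False True and X False False of a quadruple have the
  regions of expansion of a(p) b(q) f(y), b(q) f(y) a(p), a(p) f(y) b(q) and f(y) b(q) a(p).\<close>

definition good_quad :: "(bool \<Rightarrow> bool \<Rightarrow> int \<Rightarrow> int \<Rightarrow> int \<Rightarrow> 'm::ab_group_add) \<Rightarrow> bool" where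
  "good_quad X \<longleftrightarrow>
     iter_low (\<lambda>r q p. X True True p q r) \<and> iter_low (\<lambda>p r q. X True False p q r) \<and>
     iter_low (\<lambda>q r p. X False True p q r) \<and> iter_low (\<lambda>p q r. X False False p q r)"

text \<open>One power of q - y exchanges b(q) and f(y), both with a(p) to their left and with a(p)
  to their right.\<close>

definition local_quad :: "(bool \<Rightarrow> bool \<Rightarrow> int \<Rightarrow> int \<Rightarrow> int \<Rightarrow> 'm::ab_group_add) \<Rightarrow> bool" where
  "local_quad X \<longleftrightarrow> (\<exists>k. (mult_minus23 ^^ k) (X True True) = (mult_minus23 ^^ k) (X False True) \<and>
     (mult_minus23 ^^ k) (X True False) = (mult_minus23 ^^ k) (X False False))"

definition map_quad :: "('x \<Rightarrow> 'y) \<Rightarrow> (bool \<Rightarrow> bool \<Rightarrow> 'x) \<Rightarrow> bool \<Rightarrow> bool \<Rightarrow> 'y" where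
  "map_quad f X = (\<lambda>b c. f (X b c))"

lemma map_quad_pow:
  fixes f :: "'x \<Rightarrow> 'x"
  shows "(map_quad f ^^ n) X = (\<lambda>b c. (f ^^ n) (X b c))"
  by (induction n) (simp_all add: map_quad_def)

lemma good_quad_mult_minus:
  assumes "good_quad X"
  shows "good_quad (map_quad mult_minus12 X)" "good_quad (map_quad mult_minus13 X)"
proof -
  have X: "iter_low (\<lambda>r q p. X True True p q r)" "iter_low (\<lambda>p r q. X True False p q r)"
    "iter_low (\<lambda>q r p. X False True p q r)" "iter_low (\<lambda>p q r. X False False p q r)"
    using assms by (auto simp: good_quad_def)
  note sh = X[THEN iter_low_shift(1)] X[THEN iter_low_shift(2)] X[THEN iter_low_shift(3)]
  show "good_quad (map_quad mult_minus12 X)" "good_quad (map_quad mult_minus13 X)"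
    unfolding good_quad_def map_quad_def mult_minus3_defs
    by (intro conjI iter_low_diff; fact sh)+
qed

lemma good_quad_low:
  assumes "good_quad X"
  shows "\<exists>J. \<forall>r<J. \<forall>q p. X True True p q r = 0" "\<exists>J. \<forall>q<J. \<forall>p. X True True p q r = 0"
    "\<exists>J. \<forall>p<J. \<forall>r q. X True False p q r = 0" "\<exists>J. \<forall>r<J. \<forall>q. X True False p q r = 0"
    "\<exists>J. \<forall>q<J. \<forall>r p. X False True p q r = 0" "\<exists>J. \<forall>r<J. \<forall>p. X False True p q r = 0"
    "\<exists>J. \<forall>p<J. \<forall>q r. X False False p q r = 0" "\<exists>J. \<forall>q<J. \<forall>r. X False False p q r = 0"
  using assms by (simp_all add: good_quad_def iter_low_def)

text \<open>The nesting of (a_z b)_x f: the inner product pairs p with q and yields the exponent i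
  of z, the outer one pairs the result with r and yields the exponent j of x.\<close>

definition prod_left ::
  "('k::field_char_0 \<Rightarrow> 'm::ab_group_add \<Rightarrow> 'm) \<Rightarrow> (bool \<Rightarrow> bool \<Rightarrow> int \<Rightarrow> int \<Rightarrow> int \<Rightarrow> 'm) \<Rightarrow> int \<Rightarrow> int \<Rightarrow> int \<Rightarrow> 'm" where
  "prod_left s X i j r =
     vprod s (\<lambda>q r. vprod s (\<lambda>p q. X True True p q r) (\<lambda>p q. X True False p q r) i q)
       (\<lambda>q r. vprod s (\<lambda>p q. X False True p q r) (\<lambda>p q. X False False p q r) i q) j r"

text \<open>The nesting of a_m (b_n f): the inner product pairs q with r and yields j, the outer one
  pairs p with r and yields i.\<close>

definition prod_right ::
  "('k::field_char_0 \<Rightarrow> 'm::ab_group_add \<Rightarrow> 'm) \<Rightarrow> (bool \<Rightarrow> bool \<Rightarrow> int \<Rightarrow> int \<Rightarrow> int \<Rightarrow> 'm) \<Rightarrow> int \<Rightarrow> int \<Rightarrow> int \<Rightarrow> 'm" where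
  "prod_right s X i j r =
     vprod s (\<lambda>p r. vprod s (X True True p) (X False True p) j r)
       (\<lambda>p r. vprod s (X True False p) (X False False p) j r) i r"

context char0_space
begin

text \<open>For M \<le> m < 0 the second exponent i + j - m is at most i + j - M, hence below J. The
  bound is explicit so as to be uniform in further parameters of the series.\<close>

lemma subst_sum_diff_low':
  assumes "\<And>m j. m < M \<Longrightarrow> B m j = 0" "\<And>m j. m < 0 \<Longrightarrow> j < J \<Longrightarrow> B m j = 0" "j < J - i + M"
  shows "subst_sum s bin_diff B i j = 0"
proof (rule subst_sum_eq_0)
  fix m
  show "bin_diff i m = (0 :: 'k) \<or> B m (i + j - m) = 0"
    using assms(1)[of m] assms(2)[of m "i + j - m"] assms(3) bin_diff_eq_0[of m i, where 'k = 'k]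
    by (cases "m < M"; cases "m < 0") auto
qed

lemma vprod_zero: "(\<And>m j. A m j = 0) \<Longrightarrow> (\<And>m j. B m j = 0) \<Longrightarrow> vprod s A B i j = 0"
  by (simp add: vprod_def subst_sum_eq_0)

text \<open>Finiteness for the left nesting alone. Besides good quadruples it covers the orders abf,
  baf, fab, fba, which have different regions in the two middle components.\<close>

definition adm_quad_left :: "(bool \<Rightarrow> bool \<Rightarrow> int \<Rightarrow> int \<Rightarrow> int \<Rightarrow> 'm) \<Rightarrow> bool" where
  "adm_quad_left X \<longleftrightarrow>
     (\<forall>b r. adm2 TYPE('k) (\<lambda>p q. X b True p q r) (\<lambda>p q. X b False p q r)) \<and>
     (\<forall>i. adm2 TYPE('k) (\<lambda>q r. vprod s (\<lambda>p q. X True True p q r) (\<lambda>p q. X True False p q r) i q)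
       (\<lambda>q r. vprod s (\<lambda>p q. X False True p q r) (\<lambda>p q. X False False p q r) i q))"

lemma good_quad_adm_left:
  assumes "good_quad X"
  shows "adm_quad_left X"
proof -
  note low = good_quad_low[OF assms]
  obtain R P Q P' where RPQ:
    "\<forall>r<R. \<forall>q p. X True True p q r = 0" "\<forall>p<P. \<forall>r q. X True False p q r = 0"
    "\<forall>q<Q. \<forall>r p. X False True p q r = 0" "\<forall>p<P'. \<forall>q r. X False False p q r = 0"
    using low(1,3,5,7) by (elim exE)
  have X: "r < R \<Longrightarrow> X True True p q r = 0" "p < P \<Longrightarrow> X True False p q r = 0"
    "q < Q \<Longrightarrow> X False True p q r = 0" "p < P' \<Longrightarrow> X False False p q r = 0" for p q r
    using RPQ by simp_all
  have "adm2 TYPE('k) (\<lambda>p q. X b True p q r) (\<lambda>p q. X b False p q r)" for b r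
  proof -
    obtain J where "\<And>p q. q < J \<Longrightarrow> X True True p q r = 0"
      using low(2)[of r] by auto
    then show ?thesis
      by (cases b) (auto intro: admissible_fst[of J] admissible_fst[of Q] admissible_diff[of P] admissible_diff[of P'] simp: X)
  qed
  moreover have "adm2 TYPE('k) (\<lambda>q r. vprod s (\<lambda>p q. X True True p q r) (\<lambda>p q. X True False p q r) i q)
       (\<lambda>q r. vprod s (\<lambda>p q. X False True p q r) (\<lambda>p q. X False False p q r) i q)" for i
  proof
    obtain R' where "\<forall>p<0. \<forall>r<R'. \<forall>q. X True False p q r = 0"
      using uniform_low[of P "\<lambda>p r. \<forall>q. X True False p q r = 0" 0] X(2) low(4) by auto
    then have R': "p < 0 \<Longrightarrow> r < R' \<Longrightarrow> X True False p q r = 0" for p q r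
      by simp
    show "admissible (bin_fst :: int \<Rightarrow> int \<Rightarrow> 'k)
        (\<lambda>q r. vprod s (\<lambda>p q. X True True p q r) (\<lambda>p q. X True False p q r) i q)"
    proof (rule admissible_fst[of "min R R'"])
      fix q r assume "r < min R R'"
      then show "vprod s (\<lambda>p q. X True True p q r) (\<lambda>p q. X True False p q r) i q = 0"
        \<comment> \<open>For r < R' the second series vanishes at negative p for every q; the bound
          inserted here is merely the least one that admits the given q.\<close>
        by (simp add: vprod_def X(1) R' subst_sum_eq_0 subst_sum_diff_low'[of P _ "q + 1 + i - P" q i] X(2))
    qed
    obtain Q' where "\<forall>p<0. \<forall>q<Q'. \<forall>r. X False False p q r = 0"
      using uniform_low[of P' "\<lambda>p q. \<forall>r. X False False p q r = 0" 0] X(4) low(8) by auto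
    then have Q': "p < 0 \<Longrightarrow> q < Q' \<Longrightarrow> X False False p q r = 0" for p q r
      by simp
    show "admissible (bin_diff :: int \<Rightarrow> int \<Rightarrow> 'k)
        (\<lambda>q r. vprod s (\<lambda>p q. X False True p q r) (\<lambda>p q. X False False p q r) i q)"
    proof (rule admissible_diff[of "min Q (Q' - i + P')"])
      fix q r assume q: "q < min Q (Q' - i + P')"
      have "subst_sum s bin_fst (\<lambda>p q. X False True p q r) i q = 0"
        using q by (intro subst_sum_fst_low[of Q]) (simp_all add: X(3))
      moreover have "subst_sum s bin_diff (\<lambda>p q. X False False p q r) i q = 0"
        using q by (intro subst_sum_diff_low'[of P' _ Q']) (simp_all add: X(4) Q')
      ultimately show "vprod s (\<lambda>p q. X False True p q r) (\<lambda>p q. X False False p q r) i q = 0"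
        by (simp add: vprod_def)
    qed
  qed
  ultimately show ?thesis
    by (simp add: adm_quad_left_def)
qed

lemma good_quad_adm_right:
  assumes "good_quad X"
  shows "adm2 TYPE('k) (X True c p) (X False c p)"
    "adm2 TYPE('k) (\<lambda>p r. vprod s (X True True p) (X False True p) j r)
       (\<lambda>p r. vprod s (X True False p) (X False False p) j r)"
proof -
  note low = good_quad_low[OF assms]
  obtain R P Q P' where RPQ:
    "\<forall>r<R. \<forall>q p. X True True p q r = 0" "\<forall>p<P. \<forall>r q. X True False p q r = 0"
    "\<forall>q<Q. \<forall>r p. X False True p q r = 0" "\<forall>p<P'. \<forall>q r. X False False p q r = 0"
    using low(1,3,5,7) by (elim exE)
  have X: "r < R \<Longrightarrow> X True True p q r = 0" "p < P \<Longrightarrow> X True False p q r = 0"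
    "q < Q \<Longrightarrow> X False True p q r = 0" "p < P' \<Longrightarrow> X False False p q r = 0" for p q r
    using RPQ by simp_all
  obtain J J' where "\<forall>r<J. \<forall>q. X True False p q r = 0" "\<forall>q<J'. \<forall>r. X False False p q r = 0"
    using low(4)[of p] low(8)[of p] by (elim exE)
  then show "adm2 TYPE('k) (X True c p) (X False c p)"
    by (cases c) (auto intro: admissible_fst[of R] admissible_fst[of J] admissible_diff[of Q] admissible_diff[of J'] simp: X)
  obtain R' where "\<forall>q<0. \<forall>r<R'. \<forall>p. X False True p q r = 0"
    using uniform_low[of Q "\<lambda>q r. \<forall>p. X False True p q r = 0" 0] X(3) low(6) by auto
  then have R': "q < 0 \<Longrightarrow> r < R' \<Longrightarrow> X False True p q r = 0" for p q r
    by simp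
  have "vprod s (X True True p) (X False True p) j r = 0" if r: "r < min R (R' - j + Q)" for p r
  proof -
    have "subst_sum s bin_fst (X True True p) j r = 0"
      using r by (intro subst_sum_fst_low[of R]) (simp_all add: X(1))
    moreover have "subst_sum s bin_diff (X False True p) j r = 0"
      using r by (intro subst_sum_diff_low'[of Q _ R']) (simp_all add: X(3) R')
    ultimately show ?thesis
      by (simp add: vprod_def)
  qed
  moreover have "vprod s (X True False p) (X False False p) j r = 0" if "p < min P P'" for p r
    using that by (intro vprod_zero) (simp_all add: X)
  ultimately show "adm2 TYPE('k) (\<lambda>p r. vprod s (X True True p) (X False True p) j r)
       (\<lambda>p r. vprod s (X True False p) (X False False p) j r)"
    by (intro conjI admissible_fst[of "min R (R' - j + Q)"] admissible_diff[of "min P P'"])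
qed

lemma prod_left_mult_minus12:
  assumes "adm_quad_left X"
  shows "prod_left s (map_quad mult_minus12 X) i j r = prod_left s X (i - 1) j r"
proof -
  have *: "adm2 TYPE('k) (\<lambda>p q. X b True p q r) (\<lambda>p q. X b False p q r)" for b r
    using assms by (simp add: adm_quad_left_def)
  have "(\<lambda>p q. map_quad mult_minus12 X b c p q r) = mult_minus (\<lambda>p q. X b c p q r)" for b c r
    by (simp add: map_quad_def mult_minus12_def mult_minus_def)
  then show ?thesis
    by (simp add: prod_left_def vprod_mult_minus[OF *])
qed

text \<open>p - r is the sum of p - q, which the inner product turns into z, and q - r, which the
  outer product turns into x. So p - r acts as z + x.\<close>

lemma prod_left_mult_minus13:
  assumes "adm_quad_left X"
  shows "prod_left s (map_quad mult_minus13 X) i j r = prod_left s X (i - 1) j r + prod_left s X i (j - 1) r"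
    and "adm_quad_left (map_quad mult_minus13 X)"
proof -
  define U where "U = (\<lambda>b i q r. vprod s (\<lambda>p q. X b True p q r) (\<lambda>p q. X b False p q r) i q)"
  have inner: "adm2 TYPE('k) (\<lambda>p q. X b True p q r) (\<lambda>p q. X b False p q r)" for b r
    using assms by (simp add: adm_quad_left_def)
  have outer: "adm2 TYPE('k) (U True i) (U False i)" for i
    using assms by (simp add: adm_quad_left_def U_def)
  have slice: "(\<lambda>p q. map_quad mult_minus13 X b c p q r) =
      (\<lambda>p q. shift1 (\<lambda>p q. X b c p q r) p q - X b c p q (r - 1))" for b c r
    by (simp add: map_quad_def mult_minus13_def shift1_def)
  have U': "vprod s (\<lambda>p q. map_quad mult_minus13 X b True p q r) (\<lambda>p q. map_quad mult_minus13 X b False p q r) i q =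
      U b (i - 1) q r + mult_minus (U b i) q r" for b i q r
    unfolding slice vprod_minus[OF adm2_shift1[OF inner] inner] vprod_shift1[OF inner]
    by (simp add: U_def mult_minus_def)
  show "prod_left s (map_quad mult_minus13 X) i j r = prod_left s X (i - 1) j r + prod_left s X i (j - 1) r"
    unfolding prod_left_def U' vprod_add[OF outer adm2_mult_minus[OF outer]] vprod_mult_minus[OF outer]
    by (simp add: U_def)
  show "adm_quad_left (map_quad mult_minus13 X)"
    unfolding adm_quad_left_def U' unfolding slice
    using adm2_minus[OF adm2_shift1[OF inner] inner] adm2_add[OF outer adm2_mult_minus[OF outer]]
    by blast
qed

lemma prod_left_mult_minus13_pow:
  assumes "adm_quad_left X"
  shows "(mult_plus ^^ l) (\<lambda>i j. prod_left s X i j r) = (\<lambda>i j. prod_left s ((map_quad mult_minus13 ^^ l) X) i j r)"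
  by (rule funpow_intertwine[of adm_quad_left _ "\<lambda>X i j. prod_left s X i j r", symmetric])
    (simp_all add: assms prod_left_mult_minus13 mult_plus_def)

text \<open>Here p - r becomes the variable of the outer product, and p - q = (p - r) - (q - r) the
  outer variable minus the inner one.\<close>

lemma prod_right_mult_minus:
  assumes "good_quad X"
  shows "prod_right s (map_quad mult_minus13 X) i j r = prod_right s X (i - 1) j r"
    and "prod_right s (map_quad mult_minus12 X) i j r = prod_right s X (i - 1) j r - prod_right s X i (j - 1) r"
proof -
  define U where "U = (\<lambda>c j p r. vprod s (X True c p) (X False c p) j r)"
  note inner = good_quad_adm_right(1)[OF assms]
  have outer: "adm2 TYPE('k) (U True j) (U False j)" for j
    using good_quad_adm_right(2)[OF assms] by (simp add: U_def)
  have slice: "map_quad mult_minus13 X b c p = (\<lambda>q r. X b c (p - 1) q r - shift2 (X b c p) q r)"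
    "map_quad mult_minus12 X b c p = (\<lambda>q r. X b c (p - 1) q r - shift1 (X b c p) q r)" for b c p
    by (simp_all add: map_quad_def mult_minus3_defs shift1_def shift2_def)
  have U13: "vprod s (map_quad mult_minus13 X True c p) (map_quad mult_minus13 X False c p) j r =
      mult_minus (U c j) p r" for c j p r
    unfolding slice vprod_minus[OF inner adm2_shift2[OF inner]] vprod_shift2
    by (simp add: U_def mult_minus_def)
  have U12: "vprod s (map_quad mult_minus12 X True c p) (map_quad mult_minus12 X False c p) j r =
      mult_minus (U c j) p r - U c (j - 1) p r" for c j p r
    unfolding slice vprod_minus[OF inner adm2_shift1[OF inner]] vprod_shift1[OF inner]
    by (simp add: U_def mult_minus_def)
  show "prod_right s (map_quad mult_minus13 X) i j r = prod_right s X (i - 1) j r"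
    unfolding prod_right_def U13 using vprod_mult_minus[OF outer] by (simp add: U_def)
  show "prod_right s (map_quad mult_minus12 X) i j r = prod_right s X (i - 1) j r - prod_right s X i (j - 1) r"
    unfolding prod_right_def U12 vprod_minus[OF adm2_mult_minus[OF outer] outer] vprod_mult_minus[OF outer]
    by (simp add: U_def)
qed

lemma prod_right_mult_minus13_pow:
  assumes "good_quad X"
  shows "(\<lambda>i j. prod_right s ((map_quad mult_minus13 ^^ l) X) i j r) = (shift1 ^^ l) (\<lambda>i j. prod_right s X i j r)"
  by (rule funpow_intertwine[of good_quad _ "\<lambda>X i j. prod_right s X i j r"])
    (simp_all add: assms prod_right_mult_minus good_quad_mult_minus shift1_def)

text \<open>Locality of b and f truncates the inner product at -k independently of p and r. This
  bound makes the substitution of z + x into the outer variable a finite sum.\<close>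

lemma prod_right_low:
  assumes "good_quad X" "local_quad X"
  shows "\<exists>J. \<forall>j<J. \<forall>i r. prod_right s X i j r = 0"
proof -
  obtain k where k: "(mult_minus23 ^^ k) (X True c) = (mult_minus23 ^^ k) (X False c)" for c
    using assms(2) unfolding local_quad_def by (metis (full_types))
  have "vprod s (X True c p) (X False c p) j r = 0" if "j < - int k" for j c p r
  proof (rule vprod_eq_0[OF good_quad_adm_right(1)[OF assms(1)] _ that])
    show "(mult_minus ^^ k) (X True c p) = (mult_minus ^^ k) (X False c p)"
      unfolding mult_minus23_pow[symmetric] k ..
  qed
  note zero = this
  have "prod_right s X i j r = 0" if "j < - int k" for i j r
    unfolding prod_right_def by (rule vprod_zero) (simp_all add: zero that)
  then show ?thesis
    by blast
qed

end

text \<open>Division by p - q, expanded for large p and for large q, respectively.\<close>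

definition divide_above :: "(int \<Rightarrow> int \<Rightarrow> int \<Rightarrow> 'm::ab_group_add) \<Rightarrow> int \<Rightarrow> int \<Rightarrow> int \<Rightarrow> 'm" where
  "divide_above X p q r = Sum_any (\<lambda>t. if p < t then X t (p + q + 1 - t) r else 0)"

definition divide_below :: "(int \<Rightarrow> int \<Rightarrow> int \<Rightarrow> 'm::ab_group_add) \<Rightarrow> int \<Rightarrow> int \<Rightarrow> int \<Rightarrow> 'm" where
  "divide_below X p q r = - Sum_any (\<lambda>t. if t \<le> p then X t (p + q + 1 - t) r else 0)"

lemma Sum_any_eq_0: "(\<And>n. g n = 0) \<Longrightarrow> Sum_any g = 0"
  by simp

lemma mult_minus12_divide_above:
  assumes "\<And>r. \<exists>J. \<forall>q<J. \<forall>p. X p q r = 0"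
  shows "mult_minus12 (divide_above X) = X"
proof (intro ext)
  fix p q r
  obtain J where J: "\<And>p q. q < J \<Longrightarrow> X p q r = 0"
    using assms[of r] by auto
  let ?h = "\<lambda>t. if p < t then X t (p + q - t) r else 0"
  have fin: "finite {t. ?h t \<noteq> 0}"
    by (rule finite_subset[of _ "{p..p + q - J}"]) (use J in \<open>auto simp: not_less[symmetric]\<close>)
  have "divide_above X (p - 1) q r = Sum_any (\<lambda>t. ?h t + (if t = p then X t (p + q - t) r else 0))"
    unfolding divide_above_def by (intro Sum_any.cong) auto
  also have "\<dots> = Sum_any ?h + X p q r"
    by (subst Sum_any.distrib[OF fin]) (auto intro: finite_subset[of _ "{p}"])
  also have "Sum_any ?h = divide_above X p (q - 1) r"
    unfolding divide_above_def by (intro Sum_any.cong) auto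
  finally show "mult_minus12 (divide_above X) p q r = X p q r"
    by (simp add: mult_minus12_def)
qed

lemma mult_minus12_divide_below:
  assumes "\<And>p q r. p < P \<Longrightarrow> X p q r = 0"
  shows "mult_minus12 (divide_below X) = X"
proof (intro ext)
  fix p q r
  let ?h = "\<lambda>t. if t \<le> p - 1 then X t (p + q - t) r else 0"
  have fin: "finite {t. ?h t \<noteq> 0}"
    by (rule finite_subset[of _ "{P..p}"]) (use assms in \<open>auto simp: not_less[symmetric]\<close>)
  have "- divide_below X p (q - 1) r = Sum_any (\<lambda>t. ?h t + (if t = p then X t (p + q - t) r else 0))"
    unfolding divide_below_def minus_minus by (intro Sum_any.cong) auto
  also have "\<dots> = Sum_any ?h + X p q r"
    by (subst Sum_any.distrib[OF fin]) (auto intro: finite_subset[of _ "{p}"])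
  also have "Sum_any ?h = - divide_below X (p - 1) q r"
    unfolding divide_below_def minus_minus by (intro Sum_any.cong) auto
  finally show "mult_minus12 (divide_below X) p q r = X p q r"
    by (simp add: mult_minus12_def algebra_simps)
qed

text \<open>Such a series is constant along each line p + q = const, and small q on that line gives
  zeros. So division by p - q is unique in this region.\<close>

lemma mult_minus12_eq_0_above:
  assumes "mult_minus12 Z = 0" "\<And>r. \<exists>J. \<forall>q<J. \<forall>p. Z p q r = 0"
  shows "Z = 0"
proof (intro ext)
  fix p q r
  obtain J where J: "\<And>p q. q < J \<Longrightarrow> Z p q r = 0"
    using assms(2)[of r] by auto
  have step: "Z p q r = Z (p + 1) (q - 1) r" for p q
    using fun_cong[OF fun_cong[OF fun_cong[OF assms(1), of "p + 1"], of q], of r]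
    by (simp add: mult_minus12_def)
  have "Z p q r = Z (p + int n) (q - int n) r" for n
    by (induction n) (auto simp: step[of "p + int n" "q - int n" for n] algebra_simps)
  from this[of "nat (q - J + 1)"] show "Z p q r = 0 p q r"
    by (simp add: J)
qed

lemma mult_minus12_eq_0_below:
  assumes "mult_minus12 Z = 0" "\<And>p q r. p < P \<Longrightarrow> Z p q r = 0"
  shows "Z = 0"
proof (intro ext)
  fix p q r
  have step: "Z p q r = Z (p - 1) (q + 1) r" for p q
    using fun_cong[OF fun_cong[OF fun_cong[OF assms(1), of p], of "q + 1"], of r]
    by (simp add: mult_minus12_def)
  have "Z p q r = Z (p - int n) (q + int n) r" for n
    by (induction n) (auto simp: step[of "p - int n" "q + int n" for n] algebra_simps)
  from this[of "nat (p - P + 1)"] show "Z p q r = 0 p q r"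
    by (simp add: assms(2))
qed

lemma low_mult_minus23_pow:
  fixes X :: "int \<Rightarrow> int \<Rightarrow> int \<Rightarrow> 'm::ab_group_add"
  shows "(\<And>r. \<exists>J. \<forall>q<J. \<forall>p. X p q r = 0) \<Longrightarrow> \<exists>J. \<forall>q<J. \<forall>p. (mult_minus23 ^^ k) X p q r = 0"
    and "(\<And>p q r. p < P \<Longrightarrow> X p q r = 0) \<Longrightarrow> p < P \<Longrightarrow> (mult_minus23 ^^ k) X p q r = 0"
proof -
  assume X: "\<And>r. \<exists>J. \<forall>q<J. \<forall>p. X p q r = 0"
  show "\<exists>J. \<forall>q<J. \<forall>p. (mult_minus23 ^^ k) X p q r = 0"
  proof (induction k arbitrary: r)
    case (Suc k)
    obtain J J' where "\<forall>q<J. \<forall>p. (mult_minus23 ^^ k) X p q r = 0" "\<forall>q<J'. \<forall>p. (mult_minus23 ^^ k) X p q (r - 1) = 0"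
      using Suc[of r] Suc[of "r - 1"] by (elim exE)
    then show ?case
      by (intro exI[of _ "min J J'"]) (simp add: mult_minus23_def[of "(mult_minus23 ^^ k) X"])
  qed (simp add: X)
next
  assume "\<And>p q r. p < P \<Longrightarrow> X p q r = 0" "p < P"
  then show "(mult_minus23 ^^ k) X p q r = 0"
    by (induction k arbitrary: q r) (simp_all add: mult_minus23_def[of "(mult_minus23 ^^ _) X"])
qed

text \<open>The second boolean tells whether a stands to the left of b. If so, exponents of q are
  bounded below uniformly in p and the quotient for large p exists; otherwise p is bounded below and
  the other one is taken. Components compared by \<open>local_quad\<close> share this boolean and
  thus the direction of division, which is why locality survives.\<close>

lemma good_quad_divide:
  assumes good: "good_quad X" and local: "local_quad X"
  obtains Y where "good_quad Y" "local_quad Y" "map_quad mult_minus12 Y = X"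
proof -
  note low = good_quad_low[OF good]
  obtain R P Q P' where RPQ:
    "\<forall>r<R. \<forall>q p. X True True p q r = 0" "\<forall>p<P. \<forall>r q. X True False p q r = 0"
    "\<forall>q<Q. \<forall>r p. X False True p q r = 0" "\<forall>p<P'. \<forall>q r. X False False p q r = 0"
    using low(1,3,5,7) by (elim exE)
  have X: "r < R \<Longrightarrow> X True True p q r = 0" "p < P \<Longrightarrow> X True False p q r = 0"
    "q < Q \<Longrightarrow> X False True p q r = 0" "p < P' \<Longrightarrow> X False False p q r = 0" for p q r
    using RPQ by simp_all
  define Y where "Y = (\<lambda>b c. if c then divide_above (X b c) else divide_below (X b c))"
  have div: "map_quad mult_minus12 Y = X"
  proof (intro ext)
    fix b c p q r
    have "mult_minus12 (divide_above (X b True)) = X b True"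
    proof (rule mult_minus12_divide_above)
      show "\<exists>J. \<forall>q<J. \<forall>p. X b True p q r = 0" for r
        using low(2)[of r] X(3) by (cases b) auto
    qed
    moreover have "mult_minus12 (divide_below (X b False)) = X b False"
      by (cases b) (auto intro: mult_minus12_divide_below X(2,4))
    ultimately show "map_quad mult_minus12 Y b c p q r = X b c p q r"
      by (cases c) (simp_all add: map_quad_def Y_def)
  qed
  have Y1: "iter_low (\<lambda>r q p. Y True True p q r)"
    unfolding iter_low_def
  proof (intro conjI allI)
    show "\<exists>J. \<forall>r<J. \<forall>q p. Y True True p q r = 0"
      by (intro exI[of _ R]) (auto simp: Y_def divide_above_def X(1) intro!: Sum_any_eq_0)
    fix r
    obtain J where "\<forall>q<J. \<forall>p. X True True p q r = 0"
      using low(2)[of r] ..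
    then show "\<exists>J. \<forall>q<J. \<forall>p. Y True True p q r = 0"
      by (intro exI[of _ J]) (auto simp: Y_def divide_above_def intro!: Sum_any_eq_0)
  qed
  have Y2: "iter_low (\<lambda>p r q. Y True False p q r)"
    unfolding iter_low_def
  proof (intro conjI allI)
    show "\<exists>J. \<forall>p<J. \<forall>r q. Y True False p q r = 0"
      by (intro exI[of _ P]) (auto simp: Y_def divide_below_def X(2) intro!: Sum_any_eq_0)
    fix p
    obtain J where "\<forall>t<p + 1. \<forall>r<J. \<forall>q. X True False t q r = 0"
      using uniform_low[of P "\<lambda>p r. \<forall>q. X True False p q r = 0" "p + 1"] X(2) low(4) by auto
    then show "\<exists>J. \<forall>r<J. \<forall>q. Y True False p q r = 0"
      by (intro exI[of _ J]) (auto simp: Y_def divide_below_def intro!: Sum_any_eq_0)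
  qed
  have Y3: "iter_low (\<lambda>q r p. Y False True p q r)"
    unfolding iter_low_def
  proof (intro conjI allI)
    show "\<exists>J. \<forall>q<J. \<forall>r p. Y False True p q r = 0"
      by (intro exI[of _ Q]) (auto simp: Y_def divide_above_def X(3) intro!: Sum_any_eq_0)
    fix q
    \<comment> \<open>The summands have second index at most q, so a bound uniform over indices
      below q + 1 is needed.\<close>
    obtain J where "\<forall>t<q + 1. \<forall>r<J. \<forall>p. X False True p t r = 0"
      using uniform_low[of Q "\<lambda>q r. \<forall>p. X False True p q r = 0" "q + 1"] X(3) low(6) by auto
    then show "\<exists>J. \<forall>r<J. \<forall>p. Y False True p q r = 0"
      by (intro exI[of _ J]) (auto simp: Y_def divide_above_def intro!: Sum_any_eq_0)
  qed
  have Y4: "iter_low (\<lambda>p q r. Y False False p q r)"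
    unfolding iter_low_def
  proof (intro conjI allI)
    show "\<exists>J. \<forall>p<J. \<forall>q r. Y False False p q r = 0"
      by (intro exI[of _ P']) (auto simp: Y_def divide_below_def X(4) intro!: Sum_any_eq_0)
    fix p
    obtain J where J: "\<forall>t<p + 1. \<forall>q<J. \<forall>r. X False False t q r = 0"
      using uniform_low[of P' "\<lambda>p q. \<forall>r. X False False p q r = 0" "p + 1"] X(4) low(8) by auto
    \<comment> \<open>From P' \<le> t the second index is at most p + q + 1 - P', which is below J
      for the stated q.\<close>
    have "X False False t (p + q + 1 - t) r = 0" if "t \<le> p" "q < J - p - 1 + P'" for t q r
      using X(4)[of t] J that by (cases "t < P'") auto
    then show "\<exists>J. \<forall>q<J. \<forall>r. Y False False p q r = 0"
      by (intro exI[of _ "J - p - 1 + P'"]) (auto simp: Y_def divide_below_def intro!: Sum_any_eq_0)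
  qed
  have good_Y: "good_quad Y"
    using Y1 Y2 Y3 Y4 by (simp add: good_quad_def)
  obtain k where k: "(mult_minus23 ^^ k) (X True c) = (mult_minus23 ^^ k) (X False c)" for c
    using local unfolding local_quad_def by (metis (full_types))
  \<comment> \<open>Multiplication by p - q sends this difference to the one known to vanish for
    \<open>X\<close>; injectivity of p - q in the respective region then finishes.\<close>
  have zero: "mult_minus12 ((mult_minus23 ^^ k) (Y True c - Y False c)) = 0" for c
  proof -
    have "mult_minus12 (Y b c) = X b c" for b
      using div by (auto simp: map_quad_def fun_eq_iff)
    moreover have "mult_minus12 ((mult_minus23 ^^ k) Z) = (mult_minus23 ^^ k) (mult_minus12 Z)"
      for Z :: "int \<Rightarrow> int \<Rightarrow> int \<Rightarrow> 'a"
      using funpow_commute[of mult_minus12 mult_minus23 1 k Z] by (simp add: mult_minus3_commutes)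
    ultimately show ?thesis
      by (simp only: mult_minus12_diff mult_minus23_pow_additive k diff_self)
  qed
  have "(mult_minus23 ^^ k) (Y True c - Y False c) = 0" for c
  proof (cases c)
    case True
    have "\<exists>J. \<forall>q<J. \<forall>p. (Y True True - Y False True) p q r = 0" for r
    proof -
      obtain J J' where "\<forall>q<J. \<forall>p. Y True True p q r = 0" "\<forall>q<J'. \<forall>r p. Y False True p q r = 0"
        using good_quad_low(2)[OF good_Y, of r] good_quad_low(5)[OF good_Y] by (elim exE)
      then show ?thesis
        by (intro exI[of _ "min J J'"]) simp
    qed
    from mult_minus12_eq_0_above[OF zero low_mult_minus23_pow(1)[OF this]] show ?thesis
      using True by (simp only:)
  next
    case False
    obtain P1 P2 where P12: "\<forall>p<P1. \<forall>r q. Y True False p q r = 0" "\<forall>p<P2. \<forall>q r. Y False False p q r = 0"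
      using good_quad_low(3,7)[OF good_Y] by (elim exE)
    then have "(Y True False - Y False False) p q r = 0" if "p < min P1 P2" for p q r
      using that by simp
    from mult_minus12_eq_0_below[OF zero low_mult_minus23_pow(2)[OF this]] show ?thesis
      using False by (simp only:)
  qed
  then have "local_quad Y"
    unfolding local_quad_def by (auto simp: mult_minus23_pow_additive intro!: exI[of _ k])
  then show ?thesis
    using that good_Y div by blast
qed

lemma local_quad_mult_minus:
  assumes "local_quad X"
  shows "local_quad (map_quad mult_minus12 X)" "local_quad (map_quad mult_minus13 X)"
proof -
  obtain k where k: "(mult_minus23 ^^ k) (X True c) = (mult_minus23 ^^ k) (X False c)" for c
    using assms unfolding local_quad_def by (metis (full_types))
  have "(mult_minus23 ^^ k) (mult_minus12 Z) = mult_minus12 ((mult_minus23 ^^ k) Z)"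
    "(mult_minus23 ^^ k) (mult_minus13 Z) = mult_minus13 ((mult_minus23 ^^ k) Z)"
      for Z :: "int \<Rightarrow> int \<Rightarrow> int \<Rightarrow> 'a"
    using funpow_commute[of mult_minus12 mult_minus23 1 k Z] funpow_commute[of mult_minus13 mult_minus23 1 k Z]
    by (simp_all add: mult_minus3_commutes)
  then show "local_quad (map_quad mult_minus12 X)" "local_quad (map_quad mult_minus13 X)"
    unfolding local_quad_def map_quad_def by (auto simp: k intro!: exI[of _ k])
qed

context char0_space
begin

text \<open>Multiplying and dividing X by p - q shifts the exponent of z in both directions, which reduces
  the identity to the residue in z, where both sides are commutators.\<close>

theorem prod_left_eq_prod_right:
  assumes "good_quad X" "local_quad X"
  shows "prod_left s X i j r = subst_sum s bin_fst (\<lambda>m n. prod_right s X m n r) i j"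
proof -
  \<comment> \<open>Substituting z + x for the outer and x for the inner variable turns their
    difference, that is p - q, into z, in accordance with the left nesting.\<close>
  have shift: "subst_sum s bin_fst (\<lambda>m n. prod_right s (map_quad mult_minus12 X) m n r) i j =
      subst_sum s bin_fst (\<lambda>m n. prod_right s X m n r) (i - 1) j"
    if "good_quad X" "local_quad X" for X i j
  proof -
    obtain J where "\<forall>j<J. \<forall>i r. prod_right s X i j r = 0"
      using prod_right_low[OF \<open>good_quad X\<close> \<open>local_quad X\<close>] ..
    then have "admissible (bin_fst :: int \<Rightarrow> int \<Rightarrow> 'k) (\<lambda>m n. prod_right s X m n r)"
      by (intro admissible_fst[of J]) simp
    moreover have "(\<lambda>m n. prod_right s (map_quad mult_minus12 X) m n r) = mult_minus (\<lambda>m n. prod_right s X m n r)"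
      by (simp add: prod_right_mult_minus[OF \<open>good_quad X\<close>] mult_minus_def)
    ultimately show ?thesis
      by (simp add: subst_sum_mult_minus binomial_kernel_fst)
  qed
  have "\<forall>X j. good_quad X \<longrightarrow> local_quad X \<longrightarrow>
    prod_left s X i j r = subst_sum s bin_fst (\<lambda>m n. prod_right s X m n r) i j"
  proof (induction i rule: int_induct[of _ "- 1"])
    case base
    show ?case
    proof (intro allI impI)
      fix X :: "bool \<Rightarrow> bool \<Rightarrow> int \<Rightarrow> int \<Rightarrow> int \<Rightarrow> 'm" and j
      assume X: "good_quad X" "local_quad X"
      have "prod_left s X (- 1) j r = vprod s (X True True (- 1)) (X False True (- 1)) j r -
          vprod s (X True False (- 1)) (X False False (- 1)) j r"
        unfolding prod_left_def vprod_minus1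
        by (rule vprod_minus[OF good_quad_adm_right(1)[OF X(1)] good_quad_adm_right(1)[OF X(1)]])
      then show "prod_left s X (- 1) j r = subst_sum s bin_fst (\<lambda>m n. prod_right s X m n r) (- 1) j"
        by (simp add: subst_sum_minus1 prod_right_def vprod_minus1)
    qed
  next
    case (step1 i)
    show ?case
    proof (intro allI impI)
      fix X :: "bool \<Rightarrow> bool \<Rightarrow> int \<Rightarrow> int \<Rightarrow> int \<Rightarrow> 'm" and j
      assume "good_quad X" "local_quad X"
      \<comment> \<open>To raise the exponent, the coefficient of \<open>X\<close> at i + 1 is read
        as that of its quotient by p - q at i.\<close>
      then obtain Y where Y: "good_quad Y" "local_quad Y" "map_quad mult_minus12 Y = X"
        by (rule good_quad_divide)
      have "prod_left s X (i + 1) j r = prod_left s Y i j r"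
        using prod_left_mult_minus12[OF good_quad_adm_left[OF Y(1)], of "i + 1" j r] by (simp add: Y(3))
      also have "\<dots> = subst_sum s bin_fst (\<lambda>m n. prod_right s Y m n r) i j"
        using step1 Y by blast
      also have "\<dots> = subst_sum s bin_fst (\<lambda>m n. prod_right s X m n r) (i + 1) j"
        using shift[OF Y(1,2), of "i + 1" j] by (simp add: Y(3))
      finally show "prod_left s X (i + 1) j r = subst_sum s bin_fst (\<lambda>m n. prod_right s X m n r) (i + 1) j" .
    qed
  next
    case (step2 i)
    show ?case
    proof (intro allI impI)
      fix X :: "bool \<Rightarrow> bool \<Rightarrow> int \<Rightarrow> int \<Rightarrow> int \<Rightarrow> 'm" and j
      assume X: "good_quad X" "local_quad X"
      have "prod_left s X (i - 1) j r = prod_left s (map_quad mult_minus12 X) i j r"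
        by (simp add: prod_left_mult_minus12[OF good_quad_adm_left[OF X(1)]])
      also have "\<dots> = subst_sum s bin_fst (\<lambda>m n. prod_right s (map_quad mult_minus12 X) m n r) i j"
        using step2 good_quad_mult_minus(1)[OF X(1)] local_quad_mult_minus(1)[OF X(2)] by blast
      also have "\<dots> = subst_sum s bin_fst (\<lambda>m n. prod_right s X m n r) (i - 1) j"
        by (rule shift[OF X])
      finally show "prod_left s X (i - 1) j r = subst_sum s bin_fst (\<lambda>m n. prod_right s X m n r) (i - 1) j" .
    qed
  qed
  then show ?thesis
    using assms by blast
qed

end

section \<open>The module of vertex homomorphisms\<close>

text \<open>By the Leibniz rule (w - y) d/dy C = d/dy ((w - y) C) + C, so differentiation costs one
  extra factor w - y.\<close>

lemma mult_minus_pow_deriv2: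
  fixes s :: "'k::field_char_0 \<Rightarrow> 'm::ab_group_add \<Rightarrow> 'm"
  assumes "vector_space s" "(mult_minus ^^ k) F = (mult_minus ^^ k) G"
  shows "(mult_minus ^^ Suc k) (deriv2 s F) = (mult_minus ^^ Suc k) (deriv2 s G)"
proof -
  interpret vector_space s
    by fact
  have leibniz: "mult_minus (deriv2 s C) = deriv2 s (mult_minus C) + C" for C
  proof (intro ext)
    fix m j
    have "s (of_int (j + 1)) (C m j) = s (of_int j) (C m j) + C m j"
      by (simp add: scale_left_distrib)
    then show "mult_minus (deriv2 s C) m j = (deriv2 s (mult_minus C) + C) m j"
      by (simp add: mult_minus_def deriv2_def scale_right_diff_distrib)
  qed
  have zero: "(mult_minus ^^ Suc k) (deriv2 s C) = 0" if "(mult_minus ^^ k) C = 0" for C k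
    using that
  proof (induction k arbitrary: C)
    case 0
    then have "deriv2 s C = 0"
      by (simp add: deriv2_def fun_eq_iff)
    then show ?case
      by (simp add: mult_minus_def fun_eq_iff)
  next
    case (Suc k)
    have "(mult_minus ^^ Suc k) (mult_minus (deriv2 s C)) =
        (mult_minus ^^ Suc k) (deriv2 s (mult_minus C)) + (mult_minus ^^ Suc k) C"
      unfolding leibniz by (rule mult_minus_pow_additive)
    also have "\<dots> = 0"
      using Suc.IH[of "mult_minus C"] Suc.prems by (simp only: funpow_Suc_right o_apply add_0)
    finally show ?case
      by (simp only: funpow_Suc_right o_apply)
  qed
  have "deriv2 s (F - G) = deriv2 s F - deriv2 s G"
    by (simp add: deriv2_def fun_eq_iff scale_right_diff_distrib)
  moreover have "(mult_minus ^^ k) (F - G) = 0"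
    using assms(2) by (simp add: mult_minus_pow_additive)
  ultimately show ?thesis
    using zero[of k "F - G"] by (simp only: mult_minus_pow_additive right_minus_eq)
qed

section \<open>Closure of vertex homomorphisms under push-forward, linear operations and
  differentiation\<close>

lemma Vhom_simps [simp]:
  "carrier (Vhom V M N) = vertex_homs V M N"
  "smult (Vhom V M N) c f u j = smult N c (f u j)"
  "D (Vhom V M N) f u j = smult N (of_int (j + 1)) (f u (j + 1))"
  by (simp_all add: Vhom_def scale_series_def deriv_series_def)

lemma vertex_homsI:
  assumes "\<And>u. u \<notin> carrier M \<Longrightarrow> f u = 0"
    and "\<And>u j. u \<in> carrier M \<Longrightarrow> f u j \<in> carrier N"
    and "\<And>u. u \<in> carrier M \<Longrightarrow> \<exists>J. \<forall>j<J. f u j = 0"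
    and "\<And>u w j. u \<in> carrier M \<Longrightarrow> w \<in> carrier M \<Longrightarrow> f (u + w) j = f u j + f w j"
    and "\<And>c u j. u \<in> carrier M \<Longrightarrow> f (smult M c u) j = smult N c (f u j)"
    and "\<And>u j. u \<in> carrier M \<Longrightarrow> f (D M u) j = D N (f u j) - smult N (of_int (j + 1)) (f u (j + 1))"
    and "\<And>a. a \<in> carrier V \<Longrightarrow> \<exists>k. \<forall>u\<in>carrier M.
        (mult_minus ^^ k) (\<lambda>m j. act N a (f u j) m) = (mult_minus ^^ k) (\<lambda>m j. f (act M a u m) j)"
  shows "f \<in> vertex_homs V M N"
  using assms unfolding vertex_homs_def mem_Collect_eq linear_on_def laurent_def
  by (auto simp: fun_eq_iff scale_series_def deriv_series_def)

lemma vmodule_hom_lin_map: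
  "vmodule V M \<Longrightarrow> vmodule V N \<Longrightarrow> vmodule_hom V M N \<phi> \<Longrightarrow>
     lin_map (carrier M) (smult M) (carrier N) (smult N) \<phi>"
  by (simp add: vmodule_hom_def lin_map_def vmodule_space)

lemma vmodule_hom_act:
  "vmodule_hom V M N \<phi> \<Longrightarrow> a \<in> carrier V \<Longrightarrow> u \<in> carrier M \<Longrightarrow> \<phi> (act M a u n) = act N a (\<phi> u) n"
  by (simp add: vmodule_hom_def)

lemma vmodule_hom_D: "vmodule_hom V M N \<phi> \<Longrightarrow> u \<in> carrier M \<Longrightarrow> \<phi> (D M u) = D N (\<phi> u)"
  by (simp add: vmodule_hom_def)

lemma vertex_homs_push:
  assumes V: "vertex_algebra V" and M: "vmodule V M" and A: "vmodule V A" and B: "vmodule V B"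
    and \<phi>: "vmodule_hom V A B \<phi>" and f: "f \<in> vertex_homs V M A"
  shows "push \<phi> f \<in> vertex_homs V M B"
proof (rule vertex_homsI)
  note lin = vmodule_hom_lin_map[OF A B \<phi>]
  note flin = vertex_homs_lin_map[OF M A f]
  show "push \<phi> f u = 0" if "u \<notin> carrier M" for u
    using vertex_homs_outside[OF f that] by (simp add: push_def fun_eq_iff lin_map_0[OF lin])
  show "push \<phi> f u j \<in> carrier B" if "u \<in> carrier M" for u j
    unfolding push_def by (rule lin_map_closed[OF lin vertex_homs_closed[OF f that]])
  show "\<exists>J. \<forall>j<J. push \<phi> f u j = 0" if u: "u \<in> carrier M" for u
  proof -
    obtain J where "\<And>j. j < J \<Longrightarrow> f u j = 0"
      using vertex_homs_low[OF f u] by blast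
    then show ?thesis
      by (intro exI[of _ J]) (simp add: push_def lin_map_0[OF lin])
  qed
  show "push \<phi> f (u + w) j = push \<phi> f u j + push \<phi> f w j" if "u \<in> carrier M" "w \<in> carrier M" for u w j
    using that f by (simp add: push_def lin_map_add[OF flin] lin_map_add[OF lin] vertex_homs_closed)
  show "push \<phi> f (smult M c u) j = smult B c (push \<phi> f u j)" if "u \<in> carrier M" for c u j
    using that f by (simp add: push_def lin_map_scale[OF flin] lin_map_scale[OF lin] vertex_homs_closed)
  show "push \<phi> f (D M u) j = D B (push \<phi> f u j) - smult B (of_int (j + 1)) (push \<phi> f u (j + 1))"
    if "u \<in> carrier M" for u j
    unfolding push_def vertex_homs_D[OF f that]
    using vertex_homs_closed[OF f that]
    by (simp only: lin_map_diff[OF lin] lin_map_scale[OF lin] vmodule_hom_D[OF \<phi>] vmodule_D_closed[OF A]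
        space_onD(3)[OF vmodule_space[OF A]])
  fix a assume a: "a \<in> carrier V"
  obtain k where k: "\<And>u. u \<in> carrier M \<Longrightarrow>
      (mult_minus ^^ k) (\<lambda>m j. act A a (f u j) m) = (mult_minus ^^ k) (\<lambda>m j. f (act M a u m) j)"
    using vertex_homs_locality[OF f a] by blast
  have "(mult_minus ^^ k) (\<lambda>m j. act B a (push \<phi> f u j) m) = (mult_minus ^^ k) (\<lambda>m j. push \<phi> f (act M a u m) j)"
    if u: "u \<in> carrier M" for u
  proof -
    have "(\<lambda>m j. act B a (push \<phi> f u j) m) = (\<lambda>m j. \<phi> (act A a (f u j) m))"
      using u f by (simp add: push_def vmodule_hom_act[OF \<phi> a] vertex_homs_closed)
    moreover have "(mult_minus ^^ k) (\<lambda>m j. \<phi> (act A a (f u j) m)) = (mult_minus ^^ k) (\<lambda>m j. \<phi> (f (act M a u m) j))"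
      by (subst (1 2) lin_map_mult_minus_pow[OF lin]) (use k[OF u] act_hom_closed[OF V M A f a u] in auto)
    ultimately show ?thesis
      by (simp add: push_def)
  qed
  then show "\<exists>k. \<forall>u\<in>carrier M. (mult_minus ^^ k) (\<lambda>m j. act B a (push \<phi> f u j) m) =
      (mult_minus ^^ k) (\<lambda>m j. push \<phi> f (act M a u m) j)"
    by blast
qed

context
  fixes V :: "('k::field_char_0, 'v::ab_group_add) valg"
    and M :: "('k, 'v, 'm::ab_group_add) vmod" and N :: "('k, 'v, 'n::ab_group_add) vmod"
  assumes V: "vertex_algebra V" and M: "vmodule V M" and N: "vmodule V N"
begin

interpretation char0_space "smult N"
  using space_on_char0[OF vmodule_space[OF N]] .

lemma vector_space_Vhom: "vector_space (smult (Vhom V M N))"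
  by unfold_locales (simp_all add: fun_eq_iff scale_right_distrib scale_left_distrib)

lemma vertex_homs_0: "0 \<in> vertex_homs V M N"
  by (rule vertex_homsI)
    (simp_all add: space_onD(1)[OF vmodule_space[OF N]] lin_map_0[OF vmodule_lin_map_D[OF N]]
      lin_map_0[OF vmodule_lin_map_act[OF N]])

lemma vertex_homs_add:
  assumes f: "f \<in> vertex_homs V M N" and g: "g \<in> vertex_homs V M N"
  shows "f + g \<in> vertex_homs V M N"
proof (rule vertex_homsI)
  note flin = vertex_homs_lin_map[OF M N f] vertex_homs_lin_map[OF M N g]
  show "(f + g) u = 0" if "u \<notin> carrier M" for u
    using vertex_homs_outside[OF f that] vertex_homs_outside[OF g that] by (simp add: fun_eq_iff)
  show "(f + g) u j \<in> carrier N" if "u \<in> carrier M" for u j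
    using that f g by (simp add: vertex_homs_closed space_onD(2)[OF vmodule_space[OF N]])
  show "\<exists>J. \<forall>j<J. (f + g) u j = 0" if u: "u \<in> carrier M" for u
  proof -
    obtain J J' where "\<And>j. j < J \<Longrightarrow> f u j = 0" "\<And>j. j < J' \<Longrightarrow> g u j = 0"
      using vertex_homs_low[OF f u] vertex_homs_low[OF g u] by metis
    then show ?thesis
      by (intro exI[of _ "min J J'"]) simp
  qed
  show "(f + g) (u + w) j = (f + g) u j + (f + g) w j" if "u \<in> carrier M" "w \<in> carrier M" for u w j
    using that by (simp add: lin_map_add[OF flin(1)] lin_map_add[OF flin(2)])
  show "(f + g) (smult M c u) j = smult N c ((f + g) u j)" if "u \<in> carrier M" for c u j
    using that by (simp add: lin_map_scale[OF flin(1)] lin_map_scale[OF flin(2)] scale_right_distrib)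
  show "(f + g) (D M u) j = D N ((f + g) u j) - smult N (of_int (j + 1)) ((f + g) u (j + 1))"
    if "u \<in> carrier M" for u j
    using that f g by (simp add: vertex_homs_D lin_map_add[OF vmodule_lin_map_D[OF N]] vertex_homs_closed
        scale_right_distrib algebra_simps)
  fix a assume a: "a \<in> carrier V"
  obtain k1 k2 where k:
    "\<And>u. u \<in> carrier M \<Longrightarrow> (mult_minus ^^ k1) (\<lambda>m j. act N a (f u j) m) = (mult_minus ^^ k1) (\<lambda>m j. f (act M a u m) j)"
    "\<And>u. u \<in> carrier M \<Longrightarrow> (mult_minus ^^ k2) (\<lambda>m j. act N a (g u j) m) = (mult_minus ^^ k2) (\<lambda>m j. g (act M a u m) j)"
    using vertex_homs_locality[OF f a] vertex_homs_locality[OF g a] by metis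
  define k where "k = max k1 k2"
  have "(mult_minus ^^ k) (\<lambda>m j. act N a ((f + g) u j) m) = (mult_minus ^^ k) (\<lambda>m j. (f + g) (act M a u m) j)"
    if u: "u \<in> carrier M" for u
  proof -
    have "(\<lambda>m j. act N a ((f + g) u j) m) = (\<lambda>m j. act N a (f u j) m) + (\<lambda>m j. act N a (g u j) m)"
      using u f g by (simp add: fun_eq_iff lin_map_add[OF vmodule_lin_map_act[OF N a]] vertex_homs_closed)
    moreover have "(\<lambda>m j. (f + g) (act M a u m) j) = (\<lambda>m j. f (act M a u m) j) + (\<lambda>m j. g (act M a u m) j)"
      by (simp add: fun_eq_iff)
    ultimately show ?thesis
      using funpow_eq_mono[OF k(1)[OF u], of k] funpow_eq_mono[OF k(2)[OF u], of k]
      by (simp only: mult_minus_pow_additive k_def max.cobounded1 max.cobounded2)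
  qed
  then show "\<exists>k. \<forall>u\<in>carrier M. (mult_minus ^^ k) (\<lambda>m j. act N a ((f + g) u j) m) =
      (mult_minus ^^ k) (\<lambda>m j. (f + g) (act M a u m) j)"
    by blast
qed

text \<open>Multiplication by c is a V-endomorphism of N, so this is a case of push-forward.\<close>

lemma vertex_homs_scale:
  assumes f: "f \<in> vertex_homs V M N"
  shows "smult (Vhom V M N) c f \<in> vertex_homs V M N"
proof -
  have "vmodule_hom V N N (smult N c)"
    unfolding vmodule_hom_def linear_on_def
    using space_onD(3)[OF vmodule_space[OF N]]
    by (auto simp: scale_right_distrib lin_map_scale[OF vmodule_lin_map_D[OF N]]
        lin_map_scale[OF vmodule_lin_map_act[OF N]])
  from vertex_homs_push[OF V M N N this f] have "push (smult N c) f \<in> vertex_homs V M N" .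
  moreover have "push (smult N c) f = smult (Vhom V M N) c f"
    by (simp add: push_def fun_eq_iff)
  ultimately show ?thesis
    by simp
qed

lemma vertex_homs_deriv:
  assumes f: "f \<in> vertex_homs V M N"
  shows "D (Vhom V M N) f \<in> vertex_homs V M N"
proof (rule vertex_homsI)
  note flin = vertex_homs_lin_map[OF M N f]
  show "D (Vhom V M N) f u = 0" if "u \<notin> carrier M" for u
    using that f by (simp add: fun_eq_iff vertex_homs_outside)
  show "D (Vhom V M N) f u j \<in> carrier N" if "u \<in> carrier M" for u j
    unfolding Vhom_simps by (rule space_onD(3)[OF vmodule_space[OF N] vertex_homs_closed[OF f that]])
  show "\<exists>J. \<forall>j<J. D (Vhom V M N) f u j = 0" if u: "u \<in> carrier M" for u
  proof -
    obtain J where "\<And>j. j < J \<Longrightarrow> f u j = 0"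
      using vertex_homs_low[OF f u] by blast
    then show ?thesis
      by (intro exI[of _ "J - 1"]) simp
  qed
  show "D (Vhom V M N) f (u + w) j = D (Vhom V M N) f u j + D (Vhom V M N) f w j"
    if "u \<in> carrier M" "w \<in> carrier M" for u w j
    using that by (simp add: lin_map_add[OF flin] scale_right_distrib)
  show "D (Vhom V M N) f (smult M d u) j = smult N d (D (Vhom V M N) f u j)" if "u \<in> carrier M" for d u j
    unfolding Vhom_simps using that by (simp only: lin_map_scale[OF flin] scale_left_commute)
  show "D (Vhom V M N) f (D M u) j = D N (D (Vhom V M N) f u j) -
      smult N (of_int (j + 1)) (D (Vhom V M N) f u (j + 1))" if "u \<in> carrier M" for u j
    unfolding Vhom_simps vertex_homs_D[OF f that]
    using that f by (simp only: lin_map_scale[OF vmodule_lin_map_D[OF N]] vertex_homs_closed scale_right_diff_distrib)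
  fix a assume a: "a \<in> carrier V"
  obtain k where k:
    "\<And>u. u \<in> carrier M \<Longrightarrow> (mult_minus ^^ k) (\<lambda>m j. act N a (f u j) m) = (mult_minus ^^ k) (\<lambda>m j. f (act M a u m) j)"
    using vertex_homs_locality[OF f a] by blast
  have "(mult_minus ^^ Suc k) (\<lambda>m j. act N a (D (Vhom V M N) f u j) m) =
      (mult_minus ^^ Suc k) (\<lambda>m j. D (Vhom V M N) f (act M a u m) j)" if u: "u \<in> carrier M" for u
  proof -
    have "(\<lambda>m j. act N a (D (Vhom V M N) f u j) m) = deriv2 (smult N) (\<lambda>m j. act N a (f u j) m)"
      unfolding Vhom_simps deriv2_def
      using u f by (simp only: lin_map_scale[OF vmodule_lin_map_act[OF N a]] vertex_homs_closed)
    moreover have "(\<lambda>m j. D (Vhom V M N) f (act M a u m) j) = deriv2 (smult N) (\<lambda>m j. f (act M a u m) j)"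
      by (simp add: deriv2_def)
    ultimately show ?thesis
      using mult_minus_pow_deriv2[OF vector_space_axioms k[OF u]] by (simp only:)
  qed
  then show "\<exists>k. \<forall>u\<in>carrier M. (mult_minus ^^ k) (\<lambda>m j. act N a (D (Vhom V M N) f u j) m) =
      (mult_minus ^^ k) (\<lambda>m j. D (Vhom V M N) f (act M a u m) j)"
    by blast
qed

lemma space_on_Vhom: "space_on (vertex_homs V M N) (smult (Vhom V M N))"
proof -
  interpret W: vector_space "smult (Vhom V M N)"
    by (rule vector_space_Vhom)
  show ?thesis
    by (simp add: space_on_def W.vector_space_axioms W.subspace_def vertex_homs_0 vertex_homs_add vertex_homs_scale)
qed

text \<open>The locality exponent does not depend on u, so the series is truncated as a series of
  functions and not merely for each argument.\<close>

lemma Vhom_act_low: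
  assumes f: "f \<in> vertex_homs V M N" and a: "a \<in> carrier V"
  obtains J where "\<And>n. n < J \<Longrightarrow> act (Vhom V M N) a f n = 0"
proof -
  obtain k where k:
    "\<And>u. u \<in> carrier M \<Longrightarrow> (mult_minus ^^ k) (\<lambda>m j. act N a (f u j) m) = (mult_minus ^^ k) (\<lambda>m j. f (act M a u m) j)"
    using vertex_homs_locality[OF f a] by blast
  have "act (Vhom V M N) a f n u j = 0" if "n < - int k" for n u j
  proof (cases "u \<in> carrier M")
    case u: True
    show ?thesis
      unfolding Vhom_act[OF V M N f a u] by (rule vprod_eq_0[OF adm2_hom[OF V M N f a u] k[OF u] that])
  qed (simp add: Vhom_act_outside[OF V M N])
  then show ?thesis
    using that[of "- int k"] by (simp add: fun_eq_iff)
qed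

lemma Vhom_act_add:
  assumes f: "f \<in> vertex_homs V M N" and g: "g \<in> vertex_homs V M N" and a: "a \<in> carrier V"
  shows "act (Vhom V M N) a (f + g) n u j = act (Vhom V M N) a f n u j + act (Vhom V M N) a g n u j"
proof (cases "u \<in> carrier M")
  case u: True
  have "act N a ((f + g) u j) m = act N a (f u j) m + act N a (g u j) m" for m j
    using u f g by (simp add: lin_map_add[OF vmodule_lin_map_act[OF N a]] vertex_homs_closed)
  then show ?thesis
    using vprod_add[OF adm2_hom[OF V M N f a u] adm2_hom[OF V M N g a u]]
    by (simp add: Vhom_act[OF V M N _ a u] vertex_homs_add f g)
qed (simp add: Vhom_act_outside[OF V M N])

lemma Vhom_act_scale:
  assumes f: "f \<in> vertex_homs V M N" and a: "a \<in> carrier V"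
  shows "act (Vhom V M N) a (smult (Vhom V M N) c f) n u j = smult N c (act (Vhom V M N) a f n u j)"
proof (cases "u \<in> carrier M")
  case u: True
  have "act N a (smult N c (f u j)) m = smult N c (act N a (f u j) m)" for m j
    using u f by (simp add: lin_map_scale[OF vmodule_lin_map_act[OF N a]] vertex_homs_closed)
  then show ?thesis
    using vprod_scale[OF adm2_hom[OF V M N f a u]]
    by (simp add: Vhom_act[OF V M N _ a u] vertex_homs_scale f)
qed (simp add: Vhom_act_outside[OF V M N])

lemma Vhom_act_alg_add:
  assumes f: "f \<in> vertex_homs V M N" and a: "a \<in> carrier V" and b: "b \<in> carrier V"
  shows "act (Vhom V M N) (a + b) f n u j = act (Vhom V M N) a f n u j + act (Vhom V M N) b f n u j"
proof (cases "u \<in> carrier M")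
  case u: True
  note VV = vertex_algebra_module[OF V N]
  note ab = space_onD(2)[OF vmodule_space[OF VV] a b]
  have "act N (a + b) (f u j) m = act N a (f u j) m + act N b (f u j) m" for m j
    using a b by (intro lin_map_add[OF vmodule_lin_map_alg[OF VV N]] vertex_homs_closed[OF f u])
  moreover have "f (act M (a + b) u m) j = f (act M a u m) j + f (act M b u m) j" for m j
    using a b u by (simp add: lin_map_add[OF vmodule_lin_map_alg[OF VV M u]]
        lin_map_add[OF vertex_homs_lin_map[OF M N f]] vmodule_act_closed[OF M])
  ultimately show ?thesis
    using vprod_add[OF adm2_hom[OF V M N f a u] adm2_hom[OF V M N f b u]]
    by (simp add: Vhom_act[OF V M N f _ u] ab a b)
qed (simp add: Vhom_act_outside[OF V M N])

lemma Vhom_act_alg_scale: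
  assumes f: "f \<in> vertex_homs V M N" and a: "a \<in> carrier V"
  shows "act (Vhom V M N) (smult V c a) f n u j = smult N c (act (Vhom V M N) a f n u j)"
proof (cases "u \<in> carrier M")
  case u: True
  note VV = vertex_algebra_module[OF V N]
  note ca = space_onD(3)[OF vmodule_space[OF VV] a]
  have "act N (smult V c a) (f u j) m = smult N c (act N a (f u j) m)" for m j
    using a by (intro lin_map_scale[OF vmodule_lin_map_alg[OF VV N]] vertex_homs_closed[OF f u])
  moreover have "f (act M (smult V c a) u m) j = smult N c (f (act M a u m) j)" for m j
    using a u by (simp add: lin_map_scale[OF vmodule_lin_map_alg[OF VV M u]]
        lin_map_scale[OF vertex_homs_lin_map[OF M N f]] vmodule_act_closed[OF M])
  ultimately show ?thesis
    using vprod_scale[OF adm2_hom[OF V M N f a u]]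
    by (simp add: Vhom_act[OF V M N f _ u] ca a)
qed (simp add: Vhom_act_outside[OF V M N])

lemma Vhom_act_vac:
  assumes f: "f \<in> vertex_homs V M N"
  shows "act (Vhom V M N) (vac V) f n u j = (if n = 0 then f u j else 0)"
proof (cases "u \<in> carrier M")
  case u: True
  have vac: "vac V \<in> carrier V"
    using V by (simp add: vertex_algebra_def)
  have "act N (vac V) (f u j) m = (if m = 0 then f u j else 0)" for m j
    using N vertex_homs_closed[OF f u] by (simp add: vmodule_def)
  moreover have "f (act M (vac V) u m) j = (if m = 0 then f u j else 0)" for m j
    using M u lin_map_0[OF vertex_homs_lin_map[OF M N f]] by (simp add: vmodule_def)
  moreover have "subst_sum (smult N) bin_diff (\<lambda>m j. if m = 0 then f u j else 0) n j = 0"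
    by (rule subst_sum_diff_nonneg) simp
  moreover have "subst_sum (smult N) bin_fst (\<lambda>m j. if m = 0 then f u j else 0) n j =
      smult N (bin_fst n 0) (f u (n + j))"
    unfolding subst_sum_def by (subst Sum_any.expand_superset[of "{0}"]) auto
  moreover have "bin_fst n 0 = (if n = 0 then 1 else 0 :: 'k)"
    by (auto simp: bin_fst_def gbinomial_0_left)
  ultimately show ?thesis
    by (simp add: Vhom_act[OF V M N f vac u] vprod_def)
next
  case False
  then show ?thesis
    using f by (simp add: Vhom_act_outside[OF V M N] vertex_homs_outside)
qed

text \<open>The second form leaves the derivative inside the product, ready to be combined with the
  other partial derivative when d is applied to a_z f.\<close>

lemma Vhom_act_alg_D:
  assumes f: "f \<in> vertex_homs V M N" and a: "a \<in> carrier V"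
  shows "act (Vhom V M N) (D V a) f n u j = smult N (of_int (n + 1)) (act (Vhom V M N) a f (n + 1) u j)"
    and "u \<in> carrier M \<Longrightarrow> act (Vhom V M N) (D V a) f n u j =
      vprod (smult N) (deriv1 (smult N) (\<lambda>m j. act N a (f u j) m)) (deriv1 (smult N) (\<lambda>m j. f (act M a u m) j)) n j"
proof -
  note Da = vmodule_D_closed[OF vertex_algebra_module[OF V N] a]
  show *: "act (Vhom V M N) (D V a) f n u j =
      vprod (smult N) (deriv1 (smult N) (\<lambda>m j. act N a (f u j) m)) (deriv1 (smult N) (\<lambda>m j. f (act M a u m) j)) n j"
    if u: "u \<in> carrier M"
  proof -
    have "act N (D V a) (f u j) m = deriv1 (smult N) (\<lambda>m j. act N a (f u j) m) m j" for m j
      unfolding deriv1_def by (rule vmodule_act_D[OF N a vertex_homs_closed[OF f u]])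
    moreover have "f (act M (D V a) u m) j = deriv1 (smult N) (\<lambda>m j. f (act M a u m) j) m j" for m j
      unfolding deriv1_def vmodule_act_D[OF M a u]
      by (rule lin_map_scale[OF vertex_homs_lin_map[OF M N f] vmodule_act_closed[OF M a u]])
    ultimately show ?thesis
      unfolding Vhom_act[OF V M N f Da u] by presburger
  qed
  show "act (Vhom V M N) (D V a) f n u j = smult N (of_int (n + 1)) (act (Vhom V M N) a f (n + 1) u j)"
  proof (cases "u \<in> carrier M")
    case u: True
    show ?thesis
      unfolding *[OF u] Vhom_act[OF V M N f a u] by (rule vprod_deriv1[OF adm2_hom[OF V M N f a u]])
  qed (simp add: Vhom_act_outside[OF V M N])
qed

lemma Vhom_D_act:
  assumes f: "f \<in> vertex_homs V M N" and a: "a \<in> carrier V"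
  shows "D (Vhom V M N) (act (Vhom V M N) a f n) u j =
    act (Vhom V M N) (D V a) f n u j + act (Vhom V M N) a (D (Vhom V M N) f) n u j"
proof (cases "u \<in> carrier M")
  case u: True
  have "act N a (D (Vhom V M N) f u j) m = deriv2 (smult N) (\<lambda>m j. act N a (f u j) m) m j" for m j
    unfolding Vhom_simps deriv2_def by (rule lin_map_scale[OF vmodule_lin_map_act[OF N a] vertex_homs_closed[OF f u]])
  moreover have "D (Vhom V M N) f (act M a u m) j = deriv2 (smult N) (\<lambda>m j. f (act M a u m) j) m j" for m j
    by (simp add: deriv2_def)
  ultimately have "act (Vhom V M N) a (D (Vhom V M N) f) n u j =
      vprod (smult N) (deriv2 (smult N) (\<lambda>m j. act N a (f u j) m)) (deriv2 (smult N) (\<lambda>m j. f (act M a u m) j)) n j"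
    unfolding Vhom_act[OF V M N vertex_homs_deriv[OF f] a u] by presburger
  then show ?thesis
    unfolding Vhom_simps Vhom_act_alg_D(2)[OF f a u] Vhom_act[OF V M N f a u]
    by (simp only: vprod_deriv2[OF adm2_hom[OF V M N f a u]])
qed (simp add: Vhom_act_outside[OF V M N])

end

section \<open>Weak associativity of the action on Vhom\<close>

lemma iter_lowI:
  "(\<And>p q r. p < P \<Longrightarrow> X p q r = 0) \<Longrightarrow> (\<And>p. \<exists>J. \<forall>q<J. \<forall>r. X p q r = 0) \<Longrightarrow> iter_low X"
  unfolding iter_low_def by blast

context
  fixes V :: "('k::field_char_0, 'v::ab_group_add) valg"
    and M :: "('k, 'v, 'm::ab_group_add) vmod" and N :: "('k, 'v, 'n::ab_group_add) vmod"
  assumes V: "vertex_algebra V" and M: "vmodule V M" and N: "vmodule V N"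
begin

interpretation char0_space "smult N"
  using space_on_char0[OF vmodule_space[OF N]] .

text \<open>The exponent is the locality exponent of a and f. The factor (p - r)^l makes the
  quadruples of the two nestings equal, and it acts as (z + x)^l on either side; the identity for
  good local quadruples does the rest.\<close>

lemma Vhom_associativity:
  assumes f: "f \<in> vertex_homs V M N" and a: "a \<in> carrier V" and b: "b \<in> carrier V"
    and l: "\<And>u. u \<in> carrier M \<Longrightarrow>
      (mult_minus ^^ l) (\<lambda>m j. act N a (f u j) m) = (mult_minus ^^ l) (\<lambda>m j. f (act M a u m) j)"
    and u: "u \<in> carrier M"
  shows "(mult_plus ^^ l) (\<lambda>i j. act (Vhom V M N) (act V a b i) f j u r) =
    (mult_plus ^^ l) (subst_sum (smult N) bin_fst (\<lambda>m n. act (Vhom V M N) a (act (Vhom V M N) b f n) m u r))"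
proof -
  note cM = vmodule_act_closed[OF M] and cN = vmodule_act_closed[OF N] and cf = vertex_homs_closed[OF f]
  note Na = vmodule_lin_map_act[OF N a] and Nb = vmodule_lin_map_act[OF N b]
    and Ma = vmodule_lin_map_act[OF M a] and Mb = vmodule_lin_map_act[OF M b]
    and flin = vertex_homs_lin_map[OF M N f]
  note zero = lin_map_0[OF Na] lin_map_0[OF Nb] lin_map_0[OF Ma] lin_map_0[OF Mb] lin_map_0[OF flin]
  \<comment> \<open>The letters give the operators from left to right; p, q, r are the exponents
    belonging to a, b and f.\<close>
  define ABF where "ABF = (\<lambda>p q r. act N a (act N b (f u r) q) p)"
  define BAF where "BAF = (\<lambda>p q r. act N b (act N a (f u r) p) q)"
  define BFA where "BFA = (\<lambda>p q r. act N b (f (act M a u p) r) q)"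
  define AFB where "AFB = (\<lambda>p q r. act N a (f (act M b u q) r) p)"
  define FAB where "FAB = (\<lambda>p q r. f (act M a (act M b u q) p) r)"
  define FBA where "FBA = (\<lambda>p q r. f (act M b (act M a u p) q) r)"
  \<comment> \<open>XL expands the commutator of a and b on either side of f, and XR the commutator
    of b and f on either side of a. They differ in the components with one True and one False, each
    time by an exchange of a and f.\<close>
  define XL where "XL = (\<lambda>b c. if b then if c then ABF else BAF else if c then FAB else FBA)"
  define XR where "XR = (\<lambda>b c. if b then if c then ABF else BFA else if c then AFB else FBA)"
  have ab: "act V a b i \<in> carrier V" for i
    by (rule vmodule_act_closed[OF vertex_algebra_module[OF V N] a b])
  have left1: "act N (act V a b i) (f u r) q = vprod (smult N) (\<lambda>p q. ABF p q r) (\<lambda>p q. BAF p q r) i q" for i q r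
    unfolding ABF_def BAF_def by (rule module_associator[OF V N a b cf[OF u]])
  have admM: "admissible (bin_fst :: int \<Rightarrow> int \<Rightarrow> 'k) (\<lambda>m j. act M a (act M b u j) m)"
    "admissible (bin_diff :: int \<Rightarrow> int \<Rightarrow> 'k) (\<lambda>m j. act M b (act M a u m) j)"
    by (rule low2_admissible[OF low2_act_act[OF V M a b u]] low1_admissible[OF low1_act_act[OF V M a b u]])+
  have left2: "f (act M (act V a b i) u q) r = vprod (smult N) (\<lambda>p q. FAB p q r) (\<lambda>p q. FBA p q r) i q" for i q r
    unfolding FAB_def FBA_def module_associator[OF V M a b u]
    by (rule lin_map_vprod[OF flin admM]) (intro cM a b u)+
  have left: "act (Vhom V M N) (act V a b i) f j u r = prod_left (smult N) XL i j r" for i j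
    unfolding Vhom_act[OF V M N f ab u] left1 left2 prod_left_def by (simp add: XL_def)
  have adm_left: "adm_quad_left XL"
    unfolding adm_quad_left_def
  proof (intro conjI allI)
    fix c r
    have "adm2 TYPE('k) (\<lambda>p q. ABF p q r) (\<lambda>p q. BAF p q r)"
      unfolding ABF_def BAF_def
      using low2_admissible[OF low2_act_act[OF V N a b cf[OF u]]] low1_admissible[OF low1_act_act[OF V N a b cf[OF u]]]
      by blast
    moreover have "adm2 TYPE('k) (\<lambda>p q. FAB p q r) (\<lambda>p q. FBA p q r)"
      unfolding FAB_def FBA_def
      using admissible_subset[OF admM(1), of "\<lambda>p q. f (act M a (act M b u q) p) r"]
        admissible_subset[OF admM(2), of "\<lambda>p q. f (act M b (act M a u p) q) r"] by (simp add: zero)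
    ultimately show "admissible (bin_fst :: int \<Rightarrow> int \<Rightarrow> 'k) (\<lambda>p q. XL c True p q r)"
      "admissible (bin_diff :: int \<Rightarrow> int \<Rightarrow> 'k) (\<lambda>p q. XL c False p q r)"
      by (cases c; simp add: XL_def)+
  next
    fix i
    show "admissible (bin_fst :: int \<Rightarrow> int \<Rightarrow> 'k)
        (\<lambda>q r. vprod (smult N) (\<lambda>p q. XL True True p q r) (\<lambda>p q. XL True False p q r) i q)"
      "admissible (bin_diff :: int \<Rightarrow> int \<Rightarrow> 'k)
        (\<lambda>q r. vprod (smult N) (\<lambda>p q. XL False True p q r) (\<lambda>p q. XL False False p q r) i q)"
      using adm2_hom[OF V M N f ab u, of i] unfolding left1 left2 by (simp_all add: XL_def)
  qed
  have right1: "act N a (act (Vhom V M N) b f n u r) p = vprod (smult N) (ABF p) (AFB p) n r" for p n r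
    unfolding Vhom_act[OF V M N f b u] ABF_def AFB_def
    by (rule lin_map_vprod[OF Na]) (use adm2_hom[OF V M N f b u] act_hom_closed[OF V M N f b u] in auto)
  have right2: "act (Vhom V M N) b f n (act M a u p) r = vprod (smult N) (BFA p) (FBA p) n r" for p n r
    unfolding Vhom_act[OF V M N f b cM[OF a u]] BFA_def FBA_def ..
  have right: "act (Vhom V M N) a (act (Vhom V M N) b f n) m u r = prod_right (smult N) XR m n r" for m n
    unfolding Vhom_act[OF V M N Vhom_act_vertex_hom[OF V M N f b] a u] right1 right2 prod_right_def
    by (simp add: XR_def)
  obtain J La Lb where J: "\<And>j. j < J \<Longrightarrow> f u j = 0" and La: "\<And>j. j < La \<Longrightarrow> act M a u j = 0"
    and Lb: "\<And>j. j < Lb \<Longrightarrow> act M b u j = 0"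
    using vertex_homs_low[OF f u] vmodule_act_low[OF M a u] vmodule_act_low[OF M b u] by metis
  have good: "good_quad XR"
    unfolding good_quad_def XR_def if_True if_False
  proof (intro conjI)
    show "iter_low (\<lambda>r q p. ABF p q r)"
    proof (rule iter_lowI[of J])
      show "\<exists>J. \<forall>q<J. \<forall>p. ABF p q r = 0" for r
        using vmodule_act_low[OF N b cf[OF u], of r] unfolding ABF_def by (metis zero(1))
    qed (simp add: ABF_def J zero)
    show "iter_low (\<lambda>p r q. BFA p q r)"
    proof (rule iter_lowI[of La])
      show "\<exists>J. \<forall>r<J. \<forall>q. BFA p q r = 0" for p
        using vertex_homs_low[OF f cM[OF a u], of p] unfolding BFA_def by (metis zero(2))
    qed (simp add: BFA_def La zero)
    show "iter_low (\<lambda>q r p. AFB p q r)"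
    proof (rule iter_lowI[of Lb])
      show "\<exists>J. \<forall>r<J. \<forall>p. AFB p q r = 0" for q
        using vertex_homs_low[OF f cM[OF b u], of q] unfolding AFB_def by (metis zero(1))
    qed (simp add: AFB_def Lb zero)
    show "iter_low (\<lambda>p q r. FBA p q r)"
    proof (rule iter_lowI[of La])
      show "\<exists>J. \<forall>q<J. \<forall>r. FBA p q r = 0" for p
        using vmodule_act_low[OF M b cM[OF a u], of p] unfolding FBA_def by (metis zero(5))
    qed (simp add: FBA_def La zero)
  qed
  obtain k where k: "\<And>u. u \<in> carrier M \<Longrightarrow>
      (mult_minus ^^ k) (\<lambda>m j. act N b (f u j) m) = (mult_minus ^^ k) (\<lambda>m j. f (act M b u m) j)"
    using vertex_homs_locality[OF f b] by blast
  have local: "local_quad XR"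
  proof -
    have "(mult_minus23 ^^ k) ABF = (mult_minus23 ^^ k) AFB"
    proof (rule mult_minus23_pow_eq)
      fix p
      show "(mult_minus ^^ k) (ABF p) = (mult_minus ^^ k) (AFB p)"
        unfolding ABF_def AFB_def
        by (subst (1 2) lin_map_mult_minus_pow[OF Na]) (use k[OF u] act_hom_closed[OF V M N f b u] in auto)
    qed
    moreover have "(mult_minus23 ^^ k) BFA = (mult_minus23 ^^ k) FBA"
      unfolding BFA_def FBA_def by (intro mult_minus23_pow_eq k cM a u)
    ultimately show ?thesis
      by (auto simp: local_quad_def XR_def)
  qed
  have "(mult_minus13 ^^ l) BAF = (mult_minus13 ^^ l) BFA"
  proof (rule mult_minus13_pow_eq)
    fix q
    show "(mult_minus ^^ l) (\<lambda>p r. BAF p q r) = (mult_minus ^^ l) (\<lambda>p r. BFA p q r)"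
      unfolding BAF_def BFA_def
      by (subst (1 2) lin_map_mult_minus_pow[OF Nb]) (use l[OF u] act_hom_closed[OF V M N f a u] in auto)
  qed
  moreover have "(mult_minus13 ^^ l) FAB = (mult_minus13 ^^ l) AFB"
    unfolding FAB_def AFB_def by (intro mult_minus13_pow_eq l[symmetric] cM b u)
  ultimately have quad: "(map_quad mult_minus13 ^^ l) XL = (map_quad mult_minus13 ^^ l) XR"
    by (auto simp: map_quad_pow XL_def XR_def fun_eq_iff)
  have good': "good_quad ((map_quad mult_minus13 ^^ l) XR)"
    by (rule funpow_invariant[of good_quad]) (auto intro: good_quad_mult_minus good)
  have local': "local_quad ((map_quad mult_minus13 ^^ l) XR)"
    by (rule funpow_invariant[of local_quad]) (auto intro: local_quad_mult_minus local)
  have low: "low2 (\<lambda>m n. prod_right (smult N) XR m n r)"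
    using prod_right_low[OF good local] unfolding low2_def by blast
  have "(mult_plus ^^ l) (\<lambda>i j. prod_left (smult N) XL i j r) =
      (\<lambda>i j. prod_left (smult N) ((map_quad mult_minus13 ^^ l) XR) i j r)"
    unfolding prod_left_mult_minus13_pow[OF adm_left] quad ..
  also have "\<dots> = subst_sum (smult N) bin_fst (\<lambda>m n. prod_right (smult N) ((map_quad mult_minus13 ^^ l) XR) m n r)"
    by (intro ext prod_left_eq_prod_right good' local')
  also have "\<dots> = (mult_plus ^^ l) (subst_sum (smult N) bin_fst (\<lambda>m n. prod_right (smult N) XR m n r))"
    unfolding prod_right_mult_minus13_pow[OF good] by (rule subst_sum_pow(1)[OF low])
  finally show ?thesis
    unfolding left right .
qed

lemma Vhom_weak_assoc:
  assumes f: "f \<in> vertex_homs V M N" and a: "a \<in> carrier V" and b: "b \<in> carrier V"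
  shows "weak_assoc V (Vhom V M N) a b f"
proof -
  let ?W = "Vhom V M N"
  \<comment> \<open>This exponent depends on a and f only, so the identities for the individual u
    assemble into one in Vhom.\<close>
  obtain l where l: "\<And>u. u \<in> carrier M \<Longrightarrow>
      (mult_minus ^^ l) (\<lambda>m j. act N a (f u j) m) = (mult_minus ^^ l) (\<lambda>m j. f (act M a u m) j)"
    using vertex_homs_locality[OF f a] by blast
  have apply_at: "apply_at_sum (smult ?W) (act ?W a) (act ?W b f) =
      subst_sum (smult ?W) bin_fst (\<lambda>m n. act ?W a (act ?W b f n) m)"
    by (intro ext apply_at_sum_eq vector_space_Vhom[OF V M N])
  obtain J where J: "\<And>n. n < J \<Longrightarrow> act ?W b f n = 0"
    using Vhom_act_low[OF V M N f b] by blast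
  have "act ?W a 0 m = 0" for m
  proof -
    have "act ?W a (0 + 0) m u j = act ?W a 0 m u j + act ?W a 0 m u j" for u j
      by (intro Vhom_act_add[OF V M N] vertex_homs_0[OF V M N] a)
    then show ?thesis
      by (simp add: fun_eq_iff)
  qed
  then have adm: "admissible (bin_fst :: int \<Rightarrow> int \<Rightarrow> 'k) (\<lambda>m n. act ?W a (act ?W b f n) m)"
    by (intro admissible_fst[of J]) (simp add: J)
  have eval: "subst_sum (smult ?W) bin_fst (\<lambda>m n. act ?W a (act ?W b f n) m) i j u r =
      subst_sum (smult N) bin_fst (\<lambda>m n. act ?W a (act ?W b f n) m u r) i j" for i j u r
  proof -
    interpret W: vector_space "smult ?W"
      by (rule vector_space_Vhom[OF V M N])
    \<comment> \<open>Evaluation at u and r is linear, hence carries finite sums in the function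
      space to finite sums in N.\<close>
    have "lin_map UNIV (smult ?W) UNIV (smult N) (\<lambda>g. g u r)"
      by (simp add: lin_map_def space_on_def linear_on_def vector_space_axioms W.vector_space_axioms)
    from lin_map_subst_sum[OF this adm] show ?thesis
      by simp
  qed
  have pow_eval: "(mult_plus ^^ n) F i j u r = (mult_plus ^^ n) (\<lambda>i j. F i j u r) i j"
    for n i j u r and F :: "int \<Rightarrow> int \<Rightarrow> 'm \<Rightarrow> int \<Rightarrow> 'n"
    by (induction n arbitrary: i j) (simp_all add: mult_plus_def)
  have "(mult_plus ^^ l) (\<lambda>i j. act ?W (act V a b i) f j) i j u r =
      (mult_plus ^^ l) (subst_sum (smult ?W) bin_fst (\<lambda>m n. act ?W a (act ?W b f n) m)) i j u r" for i j u r
  proof (cases "u \<in> carrier M")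
    case True
    show ?thesis
      unfolding pow_eval eval using Vhom_associativity[OF f a b l True, of r] by (simp add: fun_eq_iff)
  next
    case False
    have "subst_sum (smult N) bin_fst (\<lambda>m n. 0) = (\<lambda>i j. 0 :: 'n)"
      by (intro ext subst_sum_eq_0) simp
    then show ?thesis
      unfolding pow_eval eval by (simp add: Vhom_act_outside[OF V M N False])
  qed
  then show ?thesis
    unfolding weak_assoc_def apply_at by (intro exI[of _ l] ext)
qed

theorem vmodule_Vhom: "vmodule V (Vhom V M N)"
  unfolding vmodule_def
proof (intro conjI ballI allI)
  let ?W = "Vhom V M N"
  show "space_on (carrier ?W) (smult ?W)"
    using space_on_Vhom[OF V M N] by simp
  show "D ?W ` carrier ?W \<subseteq> carrier ?W"
    using vertex_homs_deriv[OF V M N] by auto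
  show "linear_on (carrier ?W) (smult ?W) (smult ?W) (D ?W)"
    by (simp add: linear_on_def fun_eq_iff scale_right_distrib scale_left_commute)
next
  let ?W = "Vhom V M N"
  fix a f assume a: "a \<in> carrier V" and "f \<in> carrier ?W"
  then have f: "f \<in> vertex_homs V M N"
    by simp
  obtain J where "\<And>n. n < J \<Longrightarrow> act ?W a f n = 0"
    using Vhom_act_low[OF V M N f a] by blast
  then show "laurent (carrier ?W) (act ?W a f)"
    using Vhom_act_vertex_hom[OF V M N f a] by (auto simp: laurent_def)
  show "act ?W (D V a) f = deriv_series (smult ?W) (act ?W a f)"
    by (intro ext) (simp add: deriv_series_def Vhom_act_alg_D(1)[OF V M N f a])
  show "D ?W (act ?W a f n) = act ?W (D V a) f n + act ?W a (D ?W f) n" for n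
    using Vhom_D_act[OF V M N f a] by (intro ext) simp
  show "weak_assoc V ?W a b f" if "b \<in> carrier V" for b
    by (rule Vhom_weak_assoc[OF f a that])
next
  let ?W = "Vhom V M N"
  fix a assume a: "a \<in> carrier V"
  show "linear_on (carrier ?W) (smult ?W) (scale_series (smult ?W)) (act ?W a)"
    by (simp add: linear_on_def fun_eq_iff scale_series_def Vhom_act_add[OF V M N _ _ a] Vhom_act_scale[OF V M N _ a])
next
  let ?W = "Vhom V M N"
  fix f assume "f \<in> carrier ?W"
  then have f: "f \<in> vertex_homs V M N"
    by simp
  show "linear_on (carrier V) (smult V) (scale_series (smult ?W)) (\<lambda>a. act ?W a f)"
    by (simp add: linear_on_def fun_eq_iff scale_series_def Vhom_act_alg_add[OF V M N f] Vhom_act_alg_scale[OF V M N f])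
  show "act ?W (vac V) f = (\<lambda>n. if n = 0 then f else 0)"
    by (intro ext) (simp add: Vhom_act_vac[OF V M N f])
qed

end

section \<open>Exactness\<close>

lemma vmodule_hom_push:
  assumes V: "vertex_algebra V" and M: "vmodule V M" and A: "vmodule V A" and B: "vmodule V B"
    and \<phi>: "vmodule_hom V A B \<phi>"
  shows "vmodule_hom V (Vhom V M A) (Vhom V M B) (push \<phi>)"
proof -
  note lin = vmodule_hom_lin_map[OF A B \<phi>]
  note hom = vertex_homs_push[OF V M A B \<phi>]
  show ?thesis
    unfolding vmodule_hom_def
  proof (intro conjI ballI allI)
    show "push \<phi> ` carrier (Vhom V M A) \<subseteq> carrier (Vhom V M B)"
      using hom by auto
    show "linear_on (carrier (Vhom V M A)) (smult (Vhom V M A)) (smult (Vhom V M B)) (push \<phi>)"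
      unfolding linear_on_def
    proof (intro conjI ballI allI ext)
      fix f g u n assume "f \<in> carrier (Vhom V M A)" "g \<in> carrier (Vhom V M A)"
      then show "push \<phi> (f + g) u n = (push \<phi> f + push \<phi> g) u n"
        by (cases "u \<in> carrier M")
          (simp_all add: push_def lin_map_add[OF lin] vertex_homs_closed vertex_homs_outside lin_map_0[OF lin])
    next
      fix c f u n assume "f \<in> carrier (Vhom V M A)"
      then show "push \<phi> (smult (Vhom V M A) c f) u n = smult (Vhom V M B) c (push \<phi> f) u n"
        using lin_map_scale[OF lin space_onD(1)[OF vmodule_space[OF A]], of c]
        by (cases "u \<in> carrier M")
          (simp_all add: push_def lin_map_scale[OF lin] vertex_homs_closed vertex_homs_outside)
    qed
  next
    fix a f n assume a: "a \<in> carrier V" and "f \<in> carrier (Vhom V M A)"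
    then have f: "f \<in> vertex_homs V M A"
      by simp
    show "push \<phi> (act (Vhom V M A) a f n) = act (Vhom V M B) a (push \<phi> f) n"
    proof (intro ext)
      fix u j
      show "push \<phi> (act (Vhom V M A) a f n) u j = act (Vhom V M B) a (push \<phi> f) n u j"
      proof (cases "u \<in> carrier M")
        case u: True
        have "act B a (push \<phi> f u j) m = \<phi> (act A a (f u j) m)" for m j
          unfolding push_def by (rule vmodule_hom_act[OF \<phi> a vertex_homs_closed[OF f u], symmetric])
        moreover have "push \<phi> f (act M a u m) j = \<phi> (f (act M a u m) j)" for m j
          by (simp add: push_def)
        moreover have "\<phi> (vprod (smult A) (\<lambda>m j. act A a (f u j) m) (\<lambda>m j. f (act M a u m) j) n j) =
            vprod (smult B) (\<lambda>m j. \<phi> (act A a (f u j) m)) (\<lambda>m j. \<phi> (f (act M a u m) j)) n j"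
          by (rule lin_map_vprod[OF lin])
            (use char0_space.low2_admissible[OF space_on_char0[OF vmodule_space[OF A]] low2_act_hom[OF V M A f a u]]
              char0_space.low1_admissible[OF space_on_char0[OF vmodule_space[OF A]] low1_hom_act[OF V M A f a u]]
              act_hom_closed[OF V M A f a u] in auto)
        ultimately show ?thesis
          unfolding Vhom_act[OF V M B hom[OF f] a u] push_def[of \<phi> "act (Vhom V M A) a f n"] Vhom_act[OF V M A f a u]
          by presburger
      qed (simp add: push_def Vhom_act_outside[OF V M A] Vhom_act_outside[OF V M B] lin_map_0[OF lin])
    qed
  next
    fix f assume "f \<in> carrier (Vhom V M A)"
    then show "push \<phi> (D (Vhom V M A) f) = D (Vhom V M B) (push \<phi> f)"
      unfolding push_def
      by (intro ext, case_tac "u \<in> carrier M")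
        (simp_all add: lin_map_scale[OF lin] vertex_homs_closed vertex_homs_outside
          lin_map_scale[OF lin space_onD(1)[OF vmodule_space[OF A]]])
  qed
qed

lemma vmodule_hom_pull:
  assumes V: "vertex_algebra V" and A: "vmodule V A" and B: "vmodule V B" and N: "vmodule V N"
    and \<psi>: "vmodule_hom V A B \<psi>"
  shows "vmodule_hom V (Vhom V B N) (Vhom V A N) (pull A \<psi>)"
proof -
  note lin = vmodule_hom_lin_map[OF A B \<psi>]
  have hom: "pull A \<psi> f \<in> vertex_homs V A N" if f: "f \<in> vertex_homs V B N" for f
  proof (rule vertex_homsI)
    note flin = vertex_homs_lin_map[OF B N f]
    note cl = lin_map_closed[OF lin]
    show "pull A \<psi> f u = 0" if "u \<notin> carrier A" for u
      using that by (simp add: pull_def)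
    show "pull A \<psi> f u j \<in> carrier N" if "u \<in> carrier A" for u j
      using that by (simp add: pull_def vertex_homs_closed[OF f] cl)
    show "\<exists>J. \<forall>j<J. pull A \<psi> f u j = 0" if u: "u \<in> carrier A" for u
    proof -
      obtain J where "\<And>j. j < J \<Longrightarrow> f (\<psi> u) j = 0"
        using vertex_homs_low[OF f cl[OF u]] by blast
      then show ?thesis
        using u by (intro exI[of _ J]) (simp add: pull_def)
    qed
    show "pull A \<psi> f (u + w) j = pull A \<psi> f u j + pull A \<psi> f w j" if "u \<in> carrier A" "w \<in> carrier A" for u w j
      using that by (simp add: pull_def lin_map_add[OF lin] lin_map_add[OF flin] cl space_onD(2)[OF vmodule_space[OF A]])
    show "pull A \<psi> f (smult A c u) j = smult N c (pull A \<psi> f u j)" if "u \<in> carrier A" for c u j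
      using that by (simp add: pull_def lin_map_scale[OF lin] lin_map_scale[OF flin] cl space_onD(3)[OF vmodule_space[OF A]])
    show "pull A \<psi> f (D A u) j = D N (pull A \<psi> f u j) - smult N (of_int (j + 1)) (pull A \<psi> f u (j + 1))"
      if "u \<in> carrier A" for u j
      using that vmodule_D_closed[OF A that] vertex_homs_D[OF f cl[OF that]]
      by (simp add: pull_def vmodule_hom_D[OF \<psi>])
    fix a assume a: "a \<in> carrier V"
    obtain k where k: "\<And>u. u \<in> carrier B \<Longrightarrow>
        (mult_minus ^^ k) (\<lambda>m j. act N a (f u j) m) = (mult_minus ^^ k) (\<lambda>m j. f (act B a u m) j)"
      using vertex_homs_locality[OF f a] by blast
    have "(mult_minus ^^ k) (\<lambda>m j. act N a (pull A \<psi> f u j) m) = (mult_minus ^^ k) (\<lambda>m j. pull A \<psi> f (act A a u m) j)"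
      if u: "u \<in> carrier A" for u
      using k[OF cl[OF u]] u by (simp add: pull_def vmodule_hom_act[OF \<psi> a] vmodule_act_closed[OF A a])
    then show "\<exists>k. \<forall>u\<in>carrier A. (mult_minus ^^ k) (\<lambda>m j. act N a (pull A \<psi> f u j) m) =
        (mult_minus ^^ k) (\<lambda>m j. pull A \<psi> f (act A a u m) j)"
      by blast
  qed
  interpret char0_space "smult N"
    using space_on_char0[OF vmodule_space[OF N]] .
  show ?thesis
    unfolding vmodule_hom_def
  proof (intro conjI ballI allI)
    show "pull A \<psi> ` carrier (Vhom V B N) \<subseteq> carrier (Vhom V A N)"
      using hom by auto
    show "linear_on (carrier (Vhom V B N)) (smult (Vhom V B N)) (smult (Vhom V A N)) (pull A \<psi>)"
      by (auto simp: linear_on_def pull_def fun_eq_iff)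
  next
    fix a f n assume a: "a \<in> carrier V" and "f \<in> carrier (Vhom V B N)"
    then have f: "f \<in> vertex_homs V B N"
      by simp
    show "pull A \<psi> (act (Vhom V B N) a f n) = act (Vhom V A N) a (pull A \<psi> f) n"
    proof (intro ext)
      fix u j
      show "pull A \<psi> (act (Vhom V B N) a f n) u j = act (Vhom V A N) a (pull A \<psi> f) n u j"
      proof (cases "u \<in> carrier A")
        case u: True
        then show ?thesis
          by (simp add: Vhom_act[OF V A N hom[OF f] a u])
            (simp add: pull_def vmodule_act_closed[OF A a] vmodule_hom_act[OF \<psi> a]
              Vhom_act[OF V B N f a lin_map_closed[OF lin u]])
      qed (simp add: pull_def Vhom_act_outside[OF V A N])
    qed
  next
    fix f assume "f \<in> carrier (Vhom V B N)"
    show "pull A \<psi> (D (Vhom V B N) f) = D (Vhom V A N) (pull A \<psi> f)"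
      by (auto simp: pull_def fun_eq_iff)
  qed
qed

text \<open>The lift is the inverse of \<phi> on its image applied to each coefficient. Every
  identity required of it is checked after applying the injective \<phi>, where it becomes the one
  known for g; locality keeps its exponent.\<close>

lemma vertex_homs_lift:
  assumes V: "vertex_algebra V" and M: "vmodule V M" and A: "vmodule V A" and B: "vmodule V B"
    and \<phi>: "vmodule_hom V A B \<phi>" and inj: "kernel A \<phi> = {0}"
    and g: "g \<in> vertex_homs V M B" and range: "\<And>u n. u \<in> carrier M \<Longrightarrow> g u n \<in> \<phi> ` carrier A"
  shows "g \<in> push \<phi> ` vertex_homs V M A"
proof -
  note lin = vmodule_hom_lin_map[OF A B \<phi>]
  note glin = vertex_homs_lin_map[OF M B g]
  note S = vmodule_space[OF A]
  have eqI: "x = y" if "x \<in> carrier A" "y \<in> carrier A" "\<phi> x = \<phi> y" for x y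
  proof -
    have "x - y \<in> kernel A \<phi>"
      using that by (simp add: kernel_def space_onD(4)[OF S] lin_map_diff[OF lin])
    then show ?thesis
      using inj by simp
  qed
  define h where "h = (\<lambda>u n. if u \<in> carrier M then inv_into (carrier A) \<phi> (g u n) else 0)"
  have h: "h u n \<in> carrier A" "\<phi> (h u n) = g u n" if "u \<in> carrier M" for u n
    using that range[OF that] by (simp_all add: h_def inv_into_into f_inv_into_f)
  have "h \<in> vertex_homs V M A"
  proof (rule vertex_homsI)
    show "h u = 0" if "u \<notin> carrier M" for u
      using that by (simp add: h_def fun_eq_iff)
    show "h u j \<in> carrier A" if "u \<in> carrier M" for u j
      using that by (rule h)
    show "\<exists>J. \<forall>j<J. h u j = 0" if u: "u \<in> carrier M" for u
    proof -
      obtain J where "\<And>j. j < J \<Longrightarrow> g u j = 0"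
        using vertex_homs_low[OF g u] by blast
      then show ?thesis
        using h[OF u] by (intro exI[of _ J] allI impI eqI space_onD(1)[OF S]) (simp_all add: lin_map_0[OF lin])
    qed
    show "h (u + w) j = h u j + h w j" if "u \<in> carrier M" "w \<in> carrier M" for u w j
      using that by (intro eqI) (simp_all add: h space_onD(2)[OF vmodule_space[OF M]] space_onD(2)[OF S]
          lin_map_add[OF lin] lin_map_add[OF glin])
    show "h (smult M c u) j = smult A c (h u j)" if "u \<in> carrier M" for c u j
      using that by (intro eqI) (simp_all add: h space_onD(3)[OF vmodule_space[OF M]] space_onD(3)[OF S]
          lin_map_scale[OF lin] lin_map_scale[OF glin])
    show "h (D M u) j = D A (h u j) - smult A (of_int (j + 1)) (h u (j + 1))" if "u \<in> carrier M" for u j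
    proof (rule eqI)
      have cl: "D A (h u j) \<in> carrier A" "smult A (of_int (j + 1)) (h u (j + 1)) \<in> carrier A"
        using h[OF that] by (simp_all add: vmodule_D_closed[OF A] space_onD(3)[OF S] del: of_int_add)
      then show "D A (h u j) - smult A (of_int (j + 1)) (h u (j + 1)) \<in> carrier A"
        by (rule space_onD(4)[OF S])
      show "\<phi> (h (D M u) j) = \<phi> (D A (h u j) - smult A (of_int (j + 1)) (h u (j + 1)))"
        unfolding lin_map_diff[OF lin cl] lin_map_scale[OF lin h(1)[OF that]] vmodule_hom_D[OF \<phi> h(1)[OF that]]
          h(2)[OF that] h(2)[OF vmodule_D_closed[OF M that]]
        by (rule vertex_homs_D[OF g that])
    qed (rule h(1)[OF vmodule_D_closed[OF M that]])
    fix a assume a: "a \<in> carrier V"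
    obtain k where k: "\<And>u. u \<in> carrier M \<Longrightarrow>
        (mult_minus ^^ k) (\<lambda>m j. act B a (g u j) m) = (mult_minus ^^ k) (\<lambda>m j. g (act M a u m) j)"
      using vertex_homs_locality[OF g a] by blast
    have "(mult_minus ^^ k) (\<lambda>m j. act A a (h u j) m) = (mult_minus ^^ k) (\<lambda>m j. h (act M a u m) j)"
      if u: "u \<in> carrier M" for u
    proof -
      have cl: "act A a (h u j) m \<in> carrier A" "h (act M a u m) j \<in> carrier A" for m j
        using u by (simp_all add: h vmodule_act_closed[OF A a] vmodule_act_closed[OF M a])
      have "(\<lambda>m j. \<phi> ((mult_minus ^^ k) (\<lambda>m j. act A a (h u j) m) m j)) =
          (mult_minus ^^ k) (\<lambda>m j. act B a (g u j) m)"
        using u by (simp add: lin_map_mult_minus_pow[OF lin cl(1), symmetric] vmodule_hom_act[OF \<phi> a] h)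
      also have "\<dots> = (\<lambda>m j. \<phi> ((mult_minus ^^ k) (\<lambda>m j. h (act M a u m) j) m j))"
        using u by (simp add: lin_map_mult_minus_pow[OF lin cl(2), symmetric] k h vmodule_act_closed[OF M a])
      finally have eq: "\<phi> ((mult_minus ^^ k) (\<lambda>m j. act A a (h u j) m) m j) =
          \<phi> ((mult_minus ^^ k) (\<lambda>m j. h (act M a u m) j) m j)" for m j
        by (simp add: fun_eq_iff)
      show ?thesis
        by (intro ext eqI space_on_mult_minus_pow[OF S] cl eq)
    qed
    then show "\<exists>k. \<forall>u\<in>carrier M. (mult_minus ^^ k) (\<lambda>m j. act A a (h u j) m) =
        (mult_minus ^^ k) (\<lambda>m j. h (act M a u m) j)"
      by blast
  qed
  moreover have "push \<phi> h u n = g u n" for u n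
    using vertex_homs_outside[OF g, of u]
    by (cases "u \<in> carrier M") (simp_all add: push_def h, simp add: h_def lin_map_0[OF lin])
  ultimately show ?thesis
    by (intro image_eqI[of _ _ h]) (simp_all add: fun_eq_iff)
qed

text \<open>Since f vanishes on the kernel, it is constant on the fibres of \<psi>, and the choice
  of preimages does not matter. Surjectivity lets every condition on B be checked at some \<psi> u,
  with the same locality exponent.\<close>

lemma vertex_homs_descend:
  assumes V: "vertex_algebra V" and A: "vmodule V A" and B: "vmodule V B" and N: "vmodule V N"
    and \<psi>: "vmodule_hom V A B \<psi>" and surj: "\<psi> ` carrier A = carrier B"
    and f: "f \<in> vertex_homs V A N" and ker: "\<And>u. u \<in> kernel A \<psi> \<Longrightarrow> f u = 0"
  shows "f \<in> pull A \<psi> ` vertex_homs V B N"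
proof -
  note lin = vmodule_hom_lin_map[OF A B \<psi>]
  note flin = vertex_homs_lin_map[OF A N f]
  note S = vmodule_space[OF A]
  have eq: "f x j = f y j" if "x \<in> carrier A" "y \<in> carrier A" "\<psi> x = \<psi> y" for x y j
  proof -
    have "x - y \<in> kernel A \<psi>"
      using that by (simp add: kernel_def space_onD(4)[OF S] lin_map_diff[OF lin])
    then show ?thesis
      using ker[of "x - y"] lin_map_diff[OF flin that(1,2), of j] by simp
  qed
  define h where "h = (\<lambda>v. if v \<in> carrier B then f (inv_into (carrier A) \<psi> v) else 0)"
  have h: "h (\<psi> u) j = f u j" if "u \<in> carrier A" for u j
  proof -
    have \<psi>u: "\<psi> u \<in> \<psi> ` carrier A"
      using that by simp
    have "f (inv_into (carrier A) \<psi> (\<psi> u)) j = f u j"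
      by (rule eq[OF inv_into_into[OF \<psi>u] that f_inv_into_f[OF \<psi>u]])
    then show ?thesis
      using \<psi>u surj by (simp add: h_def)
  qed
  have ex: "\<exists>u\<in>carrier A. v = \<psi> u" if "v \<in> carrier B" for v
    using that surj by auto
  have "h \<in> vertex_homs V B N"
  proof (rule vertex_homsI)
    show "h v = 0" if "v \<notin> carrier B" for v
      using that by (simp add: h_def)
    show "h v j \<in> carrier N" if "v \<in> carrier B" for v j
      using ex[OF that] h vertex_homs_closed[OF f] by auto
    show "\<exists>J. \<forall>j<J. h v j = 0" if v: "v \<in> carrier B" for v
    proof -
      obtain u where u: "u \<in> carrier A" "v = \<psi> u"
        using ex[OF v] by blast
      obtain J where "\<And>j. j < J \<Longrightarrow> f u j = 0"
        using vertex_homs_low[OF f u(1)] by blast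
      then show ?thesis
        using u h by auto
    qed
    show "h (v + w) j = h v j + h w j" if v: "v \<in> carrier B" and w: "w \<in> carrier B" for v w j
    proof -
      obtain x y where xy: "x \<in> carrier A" "v = \<psi> x" "y \<in> carrier A" "w = \<psi> y"
        using ex[OF v] ex[OF w] by blast
      then show ?thesis
        using h[of "x + y" j] h[of x j] h[of y j] space_onD(2)[OF S]
        by (simp add: lin_map_add[OF lin] lin_map_add[OF flin])
    qed
    show "h (smult B c v) j = smult N c (h v j)" if v: "v \<in> carrier B" for c v j
    proof -
      obtain x where x: "x \<in> carrier A" "v = \<psi> x"
        using ex[OF v] by blast
      then show ?thesis
        using h[of "smult A c x" j] h[of x j] space_onD(3)[OF S, of x c]
        by (simp add: lin_map_scale[OF lin] lin_map_scale[OF flin])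
    qed
    show "h (D B v) j = D N (h v j) - smult N (of_int (j + 1)) (h v (j + 1))" if v: "v \<in> carrier B" for v j
    proof -
      obtain x where x: "x \<in> carrier A" "v = \<psi> x"
        using ex[OF v] by blast
      then show ?thesis
        using h[OF vmodule_D_closed[OF A x(1)], of j] vertex_homs_D[OF f x(1), of j]
        by (simp add: h vmodule_hom_D[OF \<psi>])
    qed
    fix a assume a: "a \<in> carrier V"
    obtain k where k: "\<And>u. u \<in> carrier A \<Longrightarrow>
        (mult_minus ^^ k) (\<lambda>m j. act N a (f u j) m) = (mult_minus ^^ k) (\<lambda>m j. f (act A a u m) j)"
      using vertex_homs_locality[OF f a] by blast
    have "(mult_minus ^^ k) (\<lambda>m j. act N a (h v j) m) = (mult_minus ^^ k) (\<lambda>m j. h (act B a v m) j)"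
      if v: "v \<in> carrier B" for v
    proof -
      obtain x where x: "x \<in> carrier A" "v = \<psi> x"
        using ex[OF v] by blast
      have "h (act B a v m) j = f (act A a x m) j" for m j
        using h[OF vmodule_act_closed[OF A a x(1)], of m j] x by (simp add: vmodule_hom_act[OF \<psi> a])
      then show ?thesis
        using k[OF x(1)] x by (simp add: h)
    qed
    then show "\<exists>k. \<forall>v\<in>carrier B. (mult_minus ^^ k) (\<lambda>m j. act N a (h v j) m) =
        (mult_minus ^^ k) (\<lambda>m j. h (act B a v m) j)"
      by blast
  qed
  moreover have "pull A \<psi> h u n = f u n" for u n
    using vertex_homs_outside[OF f, of u] h by (simp add: pull_def)
  ultimately show ?thesis
    by (intro image_eqI[of _ _ h]) (simp_all add: fun_eq_iff)
qed

lemma Vhom_left_exact_push: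
  assumes V: "vertex_algebra V" and ex: "left_exact_seq V A \<phi> B \<psi> C" and M: "vmodule V M"
  shows "left_exact_seq V (Vhom V M A) (push \<phi>) (Vhom V M B) (push \<psi>) (Vhom V M C)"
proof -
  have mods: "vmodule V A" "vmodule V B" "vmodule V C" and \<phi>: "vmodule_hom V A B \<phi>" and \<psi>: "vmodule_hom V B C \<psi>"
    and inj: "kernel A \<phi> = {0}" and im: "\<phi> ` carrier A = kernel B \<psi>"
    using ex by (simp_all add: left_exact_seq_def vmodule_seq_def)
  have \<phi>0: "\<phi> 0 = 0" and \<psi>0: "\<psi> 0 = 0"
    using lin_map_0[OF vmodule_hom_lin_map[OF mods(1,2) \<phi>]] lin_map_0[OF vmodule_hom_lin_map[OF mods(2,3) \<psi>]] by auto
  have "f = 0" if f: "f \<in> vertex_homs V M A" and "push \<phi> f = 0" for f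
  proof (intro ext)
    fix u n
    have "\<phi> (f u n) = 0"
      using fun_cong[OF fun_cong[OF \<open>push \<phi> f = 0\<close>], of u n] by (simp add: push_def)
    then show "f u n = 0 u n"
      using inj vertex_homs_closed[OF f, of u n] vertex_homs_outside[OF f, of u]
      by (cases "u \<in> carrier M") (auto simp: kernel_def)
  qed
  then have ker: "kernel (Vhom V M A) (push \<phi>) = {0}"
    using vertex_homs_0[OF V M mods(1)] \<phi>0 by (auto simp: kernel_def push_def fun_eq_iff)
  have "push \<phi> f \<in> kernel (Vhom V M B) (push \<psi>)" if f: "f \<in> vertex_homs V M A" for f
  proof -
    have "push \<phi> f \<in> vertex_homs V M B"
      using vmodule_hom_push[OF V M mods(1,2) \<phi>] f by (auto simp: vmodule_hom_def)
    moreover have "\<psi> (\<phi> (f u n)) = 0" for u n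
    proof (cases "u \<in> carrier M")
      case True
      then have "\<phi> (f u n) \<in> kernel B \<psi>"
        unfolding im[symmetric] using vertex_homs_closed[OF f] by blast
      then show ?thesis
        by (simp add: kernel_def)
    qed (simp add: vertex_homs_outside[OF f] \<phi>0 \<psi>0)
    ultimately show ?thesis
      by (simp add: kernel_def push_def fun_eq_iff)
  qed
  moreover have "g \<in> push \<phi> ` vertex_homs V M A" if "g \<in> kernel (Vhom V M B) (push \<psi>)" for g
  proof (rule vertex_homs_lift[OF V M mods(1,2) \<phi> inj])
    show g: "g \<in> vertex_homs V M B"
      using that by (simp add: kernel_def)
    show "g u n \<in> \<phi> ` carrier A" if "u \<in> carrier M" for u n
      using \<open>g \<in> kernel (Vhom V M B) (push \<psi>)\<close> vertex_homs_closed[OF g that]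
      unfolding im by (simp add: kernel_def push_def fun_eq_iff)
  qed
  ultimately have "push \<phi> ` carrier (Vhom V M A) = kernel (Vhom V M B) (push \<psi>)"
    by auto
  then show ?thesis
    using ker by (simp add: left_exact_seq_def vmodule_seq_def vmodule_Vhom[OF V M] mods
        vmodule_hom_push[OF V M mods(1,2) \<phi>] vmodule_hom_push[OF V M mods(2,3) \<psi>])
qed

lemma Vhom_left_exact_pull:
  fixes B :: "('k::field_char_0, 'v::ab_group_add, 'e::ab_group_add) vmod"
    and N :: "('k, 'v, 'n::ab_group_add) vmod"
  assumes V: "vertex_algebra V" and ex: "right_exact_seq V A \<phi> B \<psi> C" and N: "vmodule V N"
  shows "left_exact_seq V (Vhom V C N) (pull B \<psi>) (Vhom V B N) (pull A \<phi>) (Vhom V A N)"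
proof -
  have mods: "vmodule V A" "vmodule V B" "vmodule V C" and \<phi>: "vmodule_hom V A B \<phi>" and \<psi>: "vmodule_hom V B C \<psi>"
    and im: "\<phi> ` carrier A = kernel B \<psi>" and surj: "\<psi> ` carrier B = carrier C"
    using ex by (simp_all add: right_exact_seq_def vmodule_seq_def)
  have "f = 0" if f: "f \<in> vertex_homs V C N" and "pull B \<psi> f = 0" for f
  proof (intro ext)
    fix v n
    show "f v n = 0 v n"
    proof (cases "v \<in> carrier C")
      case True
      then obtain u where "u \<in> carrier B" "v = \<psi> u"
        using surj by auto
      then show ?thesis
        using fun_cong[OF \<open>pull B \<psi> f = 0\<close>, of u] by (simp add: pull_def)
    qed (simp add: vertex_homs_outside[OF f])
  qed
  moreover have "pull B \<psi> 0 = (0 :: 'e \<Rightarrow> int \<Rightarrow> 'n)"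
    by (simp add: pull_def fun_eq_iff)
  ultimately have ker: "kernel (Vhom V C N) (pull B \<psi>) = {0}"
    using vertex_homs_0[OF V mods(3) N] by (auto simp: kernel_def)
  have "pull B \<psi> f \<in> kernel (Vhom V B N) (pull A \<phi>)" if f: "f \<in> vertex_homs V C N" for f
  proof -
    have hom: "pull B \<psi> f \<in> vertex_homs V B N"
      using vmodule_hom_pull[OF V mods(2,3) N \<psi>] f by (auto simp: vmodule_hom_def)
    have *: "pull B \<psi> f (\<phi> u) n = 0" if "u \<in> carrier A" for u n
    proof -
      have "\<phi> u \<in> kernel B \<psi>"
        unfolding im[symmetric] using that by simp
      then show ?thesis
        using lin_map_0[OF vertex_homs_lin_map[OF mods(3) N f]] by (simp add: kernel_def pull_def)
    qed
    have "pull A \<phi> (pull B \<psi> f) u n = 0" for u n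
      unfolding pull_def[of A] using *[of u n] by simp
    then show ?thesis
      using hom by (simp add: kernel_def fun_eq_iff)
  qed
  moreover have "g \<in> pull B \<psi> ` vertex_homs V C N" if g: "g \<in> kernel (Vhom V B N) (pull A \<phi>)" for g
  proof (rule vertex_homs_descend[OF V mods(2,3) N \<psi> surj])
    show "g \<in> vertex_homs V B N"
      using g by (simp add: kernel_def)
    show "g u = 0" if "u \<in> kernel B \<psi>" for u
    proof -
      obtain x where x: "x \<in> carrier A" "u = \<phi> x"
        using \<open>u \<in> kernel B \<psi>\<close> unfolding im[symmetric] by blast
      have "pull A \<phi> g = 0"
        using g by (simp add: kernel_def)
      from fun_cong[OF this, of x] show ?thesis
        using x by (simp add: pull_def)
    qed
  qed
  ultimately have "pull B \<psi> ` carrier (Vhom V C N) = kernel (Vhom V B N) (pull A \<phi>)"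
    by auto
  then show ?thesis
    using ker by (simp add: left_exact_seq_def vmodule_seq_def vmodule_Vhom[OF V _ N] mods
        vmodule_hom_pull[OF V mods(1,2) N \<phi>] vmodule_hom_pull[OF V mods(2,3) N \<psi>])
qed

theorem theorem7p1:
  fixes V :: "('k::{alg_closed_field, field_char_0}, 'v::ab_group_add) valg"
  assumes "vertex_algebra V"
  shows
    "(\<forall>(N' :: ('k, 'v, 'a::ab_group_add) vmod) (\<phi> :: 'a \<Rightarrow> 'b) (N :: ('k, 'v, 'b::ab_group_add) vmod)
        (\<psi> :: 'b \<Rightarrow> 'c) (N'' :: ('k, 'v, 'c::ab_group_add) vmod) (M :: ('k, 'v, 'm::ab_group_add) vmod).
        left_exact_seq V N' \<phi> N \<psi> N'' \<longrightarrow> vmodule V M \<longrightarrow>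
        left_exact_seq V (Vhom V M N') (push \<phi>) (Vhom V M N) (push \<psi>) (Vhom V M N'')) \<and>
     (\<forall>(M' :: ('k, 'v, 'd::ab_group_add) vmod) (\<phi> :: 'd \<Rightarrow> 'e) (M :: ('k, 'v, 'e::ab_group_add) vmod)
        (\<psi> :: 'e \<Rightarrow> 'f) (M'' :: ('k, 'v, 'f::ab_group_add) vmod) (N :: ('k, 'v, 'n::ab_group_add) vmod).
        right_exact_seq V M' \<phi> M \<psi> M'' \<longrightarrow> vmodule V N \<longrightarrow>
        left_exact_seq V (Vhom V M'' N) (pull M \<psi>) (Vhom V M N) (pull M' \<phi>) (Vhom V M' N))"
  using Vhom_left_exact_push[OF assms] Vhom_left_exact_pull[OF assms] by blast

end
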